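(* Let $G$ and $H$ be finite simple graphs which are both $K_3$-free and which are $1$-homeomorphic to each other. Then $G$ and $H$ are homeomorphic, i.e. $G$ and $H$ can be equipped with graph topologies such that the resulting topological graphs $(G,\mathcal{B},\mathcal{O})$ and $(H,\mathcal{C},\mathcal{P})$ are homeomorphic.
   Context: All graphs are finite and simple. A graph is $K_3$-free if it contains no triangles. A graph $H$ is $1$-homeomorphic to $G$ (the classical notion of homeomorphism in topological graph theory) if it can be deformed to $G$ by applying or reversing barycentric subdivision steps of edges; a subdivision step replaces an edge $(x,y)$ by a new vertex $z$ and the two edges $(x,z),(z,y)$. For a vertex $x$ of a graph $G=(V,E)$, the unit sphere $S(x)$ is the subgraph of $G$ generated (induced) by all vertices adjacent to $x$. The intersection of two subgraphs is the subgraph formed by their common vertices and common edges; a subgraph is also regarded as the set of its vertices when speaking of topologies on $V$. Dimension: $\dim(\emptyset)=-1$ and inductively $\dim(G)=\frac{1}{|V|}\sum_{x\in V}(1+\dim(S(x)))$. Homotopy: the one-point graph $K_1$ is contractible. A homotopy extension of a graph selects a contractible (induced) subgraph $H$ and adds a new vertex $z$ connected exactly to all vertices of $H$ (so $S(z)=H$). The reverse step removes a vertex $z$ with contractible unit sphere $S(z)$, together with all edges at $z$. Two graphs are homotopic if one can be obtained from the other by a finite sequence of such steps; a graph is contractible if it is homotopic to $K_1$. (This is an inductive definition.) Graph topology: two subgraphs $A,B$ satisfy the dimension assumption if $\dim(A\cap B)\ge \min(\dim(A),\dim(B))$, where the dimensions are those of these subgraphs as graphs themselves. A topology $\mathcal{O}$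 on $V$ is a graph topology on $G=(V,E)$ if it has a sub-base $\mathcal{B}$ consisting of contractible subgraphs of $G$ such that (i) the intersection of any two elements of $\mathcal{B}$ satisfying the dimension assumption is contractible; (ii) every edge of $G$ is contained in some $B\in\mathcal{B}$; (iii) the nerve graph $\mathcal{G}=(\mathcal{B},\mathcal{E})$, whose vertices are the elements of $\mathcal{B}$ and whose edges are the pairs of distinct $A,B\in\mathcal{B}$ satisfying the dimension assumption, is homotopic to $G$. A graph with such a topology, written $(G,\mathcal{B},\mathcal{O})$, is a topological graph. Homeomorphism: given topological graphs $(G,\mathcal{B},\mathcal{O})$ and $(H,\mathcal{C},\mathcal{P})$ with nerve graphs $\mathcal{G},\mathcal{H}$, a map $\phi:\mathcal{O}\to\mathcal{P}$ is continuous if it induces a graph homomorphism $\mathcal{G}\to\mathcal{H}$ (it maps each $A\in\mathcal{B}$ to an element $\phi(A)\in\mathcal{C}$, edges of the nerve going to edges) such that $\dim(\phi(A))\le\dim(A)$ for every $A\in\mathcal{B}$. If $\phi$ has an inverse which is also continuous, $\phi$ is a graph homeomorphism and the topological graphs are homeomorphic. *)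

theory Defs
  imports
    "Graph_Theory.Pair_Digraph"
    "Graph_Theory.Digraph_Component"
    "Graph_Theory.Digraph_Isomorphism"
    "Graph_Theory.Kuratowski"
    "HOL-Analysis.Abstract_Topology"
begin

text \<open>A finite simple graph is a \<^locale>\<open>pair_graph\<close>: an edge is stored as its two opposite arcs,
  and the vertex set may be empty. In \<^const>\<open>subgraph\<close> the arc set of the subgraph need not be
  symmetric, so a subgraph of a graph is always required to be a \<^locale>\<open>pair_graph\<close> as well.\<close>

definition K3_free :: "'a pair_pre_digraph \<Rightarrow> bool" where
  "K3_free G \<longleftrightarrow> \<not> (\<exists>K. subgraph K (with_proj G) \<and> K\<^bsub>3\<^esub> K)"

definition generated :: "'a pair_pre_digraph \<Rightarrow> 'a set \<Rightarrow> 'a pair_pre_digraph" where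
  "generated G W = \<lparr>pverts = W, parcs = parcs G \<inter> W \<times> W\<rparr>"

definition sphere :: "'a pair_pre_digraph \<Rightarrow> 'a \<Rightarrow> 'a pair_pre_digraph" where
  "sphere G x = generated G {y. (x, y) \<in> parcs G}"

definition graph_inter :: "'a pair_pre_digraph \<Rightarrow> 'a pair_pre_digraph \<Rightarrow> 'a pair_pre_digraph" where
  "graph_inter A B = \<lparr>pverts = pverts A \<inter> pverts B, parcs = parcs A \<inter> parcs B\<rparr>"


subsection \<open>Homeomorphism in the classical sense\<close>

definition subdivision_of :: "'a pair_pre_digraph \<Rightarrow> 'a pair_pre_digraph \<Rightarrow> bool" where
  "subdivision_of G H \<longleftrightarrow>
     pair_graph G \<and> (\<exists>e \<in> parcs G. \<exists>w. w \<notin> pverts G \<and> H = subdivide G e w)"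

text \<open>Deformations need an unlimited supply of new vertices, so here and for homotopy below they are
  carried out on copies of the graphs with natural numbers as vertices. This also makes it possible
  to compare graphs with different vertex types.\<close>

definition one_homeomorphic :: "'a pair_pre_digraph \<Rightarrow> 'b pair_pre_digraph \<Rightarrow> bool" where
  "one_homeomorphic G H \<longleftrightarrow>
     (\<exists>G' H' :: nat pair_pre_digraph.
        digraph_iso (with_proj G) (with_proj G') \<and> digraph_iso (with_proj H) (with_proj H') \<and>
        equivclp subdivision_of G' H')"


subsection \<open>Dimension\<close>

text \<open>The value outside finite simple graphs is irrelevant; the guard is there for termination.\<close>

function graph_dim :: "'a pair_pre_digraph \<Rightarrow> real" where
  "graph_dim G =
     (if \<not> pair_graph G then undefined
      else if pverts G = {} then - 1
      else (\<Sum>x\<in>pverts G. 1 + graph_dim (sphere G x)) / real (card (pverts G)))"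
  by pat_completeness auto

termination
proof (relation "measure (\<lambda>G. card (pverts G))")
  show "wf (measure (\<lambda>G :: 'a pair_pre_digraph. card (pverts G)))" by simp
next
  fix G :: "'a pair_pre_digraph" and x
  assume "\<not> \<not> pair_graph G" and x: "x \<in> pverts G"
  then interpret pair_graph G by simp
  have "pverts (sphere G x) \<subseteq> pverts G - {x}"
    by (auto simp: sphere_def generated_def dest: in_arcsD2 pair_no_loops)
  with x have "pverts (sphere G x) \<subset> pverts G" by auto
  then show "(sphere G x, G) \<in> measure (\<lambda>G. card (pverts G))"
    using pair_finite_verts by (simp add: psubset_card_mono)
qed

declare graph_dim.simps [simp del]

definition dim_assumption :: "'a pair_pre_digraph \<Rightarrow> 'a pair_pre_digraph \<Rightarrow> bool" where
  "dim_assumption A B \<longleftrightarrow> graph_dim (graph_inter A B) \<ge> min (graph_dim A) (graph_dim B)"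


subsection \<open>Homotopy\<close>

definition cone_extension :: "'a pair_pre_digraph \<Rightarrow> 'a set \<Rightarrow> 'a \<Rightarrow> 'a pair_pre_digraph" where
  "cone_extension G W z =
     \<lparr>pverts = insert z (pverts G), parcs = parcs G \<union> {z} \<times> W \<union> W \<times> {z}\<rparr>"

inductive nat_homotopic :: "nat pair_pre_digraph \<Rightarrow> nat pair_pre_digraph \<Rightarrow> bool"
  and nat_contractible :: "nat pair_pre_digraph \<Rightarrow> bool" where
  refl: "pair_graph G \<Longrightarrow> nat_homotopic G G"
| extend: "\<lbrakk>nat_homotopic G H; W \<subseteq> pverts H; nat_contractible (generated H W); z \<notin> pverts H\<rbrakk>
    \<Longrightarrow> nat_homotopic G (cone_extension H W z)"
| remove: "\<lbrakk>nat_homotopic G H; z \<in> pverts H; nat_contractible (sphere H z)\<rbrakk>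
    \<Longrightarrow> nat_homotopic G (generated H (pverts H - {z}))"
| contractible: "\<lbrakk>nat_homotopic G P; K\<^bsub>1\<^esub> (with_proj P)\<rbrakk> \<Longrightarrow> nat_contractible G"

definition homotopic :: "'a pair_pre_digraph \<Rightarrow> 'b pair_pre_digraph \<Rightarrow> bool" where
  "homotopic G H \<longleftrightarrow>
     (\<exists>G' H'. digraph_iso (with_proj G) (with_proj G') \<and> digraph_iso (with_proj H) (with_proj H') \<and>
        nat_homotopic G' H')"

definition contractible :: "'a pair_pre_digraph \<Rightarrow> bool" where
  "contractible G \<longleftrightarrow> (\<exists>G'. digraph_iso (with_proj G) (with_proj G') \<and> nat_contractible G')"


subsection \<open>Topological graphs and their homeomorphisms\<close>

text \<open>A sub-base element is a subgraph, which enters the topology through its vertex set.\<close>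

definition subbase_of :: "'a pair_pre_digraph set \<Rightarrow> 'a topology \<Rightarrow> bool" where
  "subbase_of \<B> T \<longleftrightarrow>
     openin T = arbitrary union_of
       (finite intersection_of (\<lambda>U. U \<in> pverts ` \<B>) relative_to topspace T)"

definition nerve :: "'a pair_pre_digraph set \<Rightarrow> 'a pair_pre_digraph pair_pre_digraph" where
  "nerve \<B> =
     \<lparr>pverts = \<B>, parcs = {(A, B). A \<in> \<B> \<and> B \<in> \<B> \<and> A \<noteq> B \<and> dim_assumption A B}\<rparr>"

definition topological_graph ::
  "'a pair_pre_digraph \<Rightarrow> 'a pair_pre_digraph set \<Rightarrow> 'a topology \<Rightarrow> bool" where
  "topological_graph G \<B> T \<longleftrightarrow>
     pair_graph G \<and>
     topspace T = pverts G \<and> subbase_of \<B> T \<and>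
     (\<forall>A\<in>\<B>. pair_graph A \<and> subgraph (with_proj A) (with_proj G) \<and> contractible A) \<and>
     (\<forall>A\<in>\<B>. \<forall>B\<in>\<B>. dim_assumption A B \<longrightarrow> contractible (graph_inter A B)) \<and>
     (\<forall>e\<in>parcs G. \<exists>B\<in>\<B>. e \<in> parcs B) \<and>
     homotopic (nerve \<B>) G"

text \<open>A map of topological graphs acts on open sets by \<open>\<phi>\<close> and on the sub-base, i.e. on the vertices
  of the nerve graph, by \<open>f\<close>; both actions agree under the identification of a subgraph with its
  vertex set. If distinct elements of \<open>\<C>\<close> have distinct vertex sets, then \<open>f\<close> is
  determined by \<open>\<phi>\<close>.\<close>

definition continuous_graph_map ::
  "'a pair_pre_digraph set \<Rightarrow> 'a topology \<Rightarrow> 'b pair_pre_digraph set \<Rightarrow> 'b topology \<Rightarrow>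
   ('a set \<Rightarrow> 'b set) \<Rightarrow> ('a pair_pre_digraph \<Rightarrow> 'b pair_pre_digraph) \<Rightarrow> bool" where
  "continuous_graph_map \<B> T \<C> P \<phi> f \<longleftrightarrow>
     (\<forall>U. openin T U \<longrightarrow> openin P (\<phi> U)) \<and>
     (\<forall>A\<in>\<B>. f A \<in> \<C> \<and> pverts (f A) = \<phi> (pverts A)) \<and>
     (\<forall>(A, B) \<in> parcs (nerve \<B>). (f A, f B) \<in> parcs (nerve \<C>)) \<and>
     (\<forall>A\<in>\<B>. graph_dim (f A) \<le> graph_dim A)"

definition homeomorphic_topological_graphs ::
  "'a pair_pre_digraph set \<Rightarrow> 'a topology \<Rightarrow> 'b pair_pre_digraph set \<Rightarrow> 'b topology \<Rightarrow> bool" where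
  "homeomorphic_topological_graphs \<B> T \<C> P \<longleftrightarrow>
     (\<exists>\<phi> f \<psi> g.
        continuous_graph_map \<B> T \<C> P \<phi> f \<and> continuous_graph_map \<C> P \<B> T \<psi> g \<and>
        (\<forall>U. openin T U \<longrightarrow> \<psi> (\<phi> U) = U) \<and> (\<forall>U. openin P U \<longrightarrow> \<phi> (\<psi> U) = U) \<and>
        (\<forall>A\<in>\<B>. g (f A) = A) \<and> (\<forall>C\<in>\<C>. f (g C) = C))"

end

theory Submission
  imports Defs
begin

text \<open>Both graphs receive the same combinatorial sub-base. Order the vertices of each component so that
  every vertex but the first has an earlier neighbour, and let the back degree of a vertex be its
  number of earlier neighbours; choosing one earlier neighbour for each vertex gives a spanning tree.
  Every further back edge from \<open>v\<close> to \<open>u\<close> gives a tree too: the spanning tree restricted to the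
  vertices before \<open>v\<close>, with \<open>v\<close> attached as a leaf to \<open>u\<close>. Two different such trees meet in a graph
  in which the earlier \<open>v\<close> is isolated, so its dimension is less than 1 and they are not adjacent in
  the nerve. The sub-base consists of these trees and, if there are further back edges, of the first
  two vertices of the component. Its nerve is, per component, a point or a complete bipartite graph
  \<open>K(2, b + 1)\<close>, where \<open>b\<close> is the first Betti number. The graph itself is homotopic to this
  nerve, because in a triangle-free graph a vertex with back degree \<open>d\<close> can be traded for \<open>d - 1\<close>
  handles, whose feet can be slid through the component.

  The vertex sets of the trees of a component form a chain, so nerve, dimensions and topology depend
  on the order only through the list of back degrees that are at least 2, together with the
  information whether the last vertex has such a back degree and whether the component is a point.
  Subdividing an edge preserves every such profile of an order. Conversely, removing a subdivision
  vertex from an order either preserves the profile or decreases a weight. So the profiles of minimal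
  weight are invariant under subdivision, and graphs that are 1-homeomorphic have orders with the
  same profile.\<close>

section \<open>Finite simple graphs as vertex and arc sets\<close>

text \<open>A subdivision changes the number of vertices, so no bijection of vertices can induce the
  homeomorphism; it has to come from a lattice of open sets that does not see vertices of back
  degree 1. In a triangle-free graph unit spheres are discrete, so the dimension is the proportion
  of non-isolated vertices. This is why one isolated vertex in the intersection separates two trees,
  which have dimension 1. Trees alone would give a nerve without edges. The two one-point elements
  repair this: each lies in every tree of its component, and K(2, b + 1), with 2(b + 1) edges and b
  + 3 vertices, has first Betti number b like the component. For b = 0 they are left out, since the
  component may consist of one vertex. Weights are needed because subdividing can create new
  profiles: an order may place the new vertex after both of its neighbours, where it has back degree
  2, and the original graph need not have an order with that profile. So only minimal profiles can
  be compared.\<close>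

lemma pair_graph_iff:
  "pair_graph G \<longleftrightarrow> finite (pverts G) \<and> parcs G \<subseteq> pverts G \<times> pverts G \<and>
     (\<forall>x y. (x, y) \<in> parcs G \<longrightarrow> (y, x) \<in> parcs G) \<and> (\<forall>x. (x, x) \<notin> parcs G)" (is "?L \<longleftrightarrow> ?R")
proof
  assume ?L
  then interpret pair_graph G .
  show ?R
    using pair_finite_verts arc_fst_in_verts arc_snd_in_verts pair_no_loops pair_sym_arcs
    by (force simp: symmetric_def sym_def)
next
  assume R: ?R
  then have "finite (parcs G)" by (meson finite_SigmaI rev_finite_subset)
  with R show ?L by unfold_locales (auto simp: symmetric_def sym_def)
qed

lemma pair_graphD:
  assumes "pair_graph G"
  shows "finite (pverts G)" "(x, y) \<in> parcs G \<Longrightarrow> x \<in> pverts G" "(x, y) \<in> parcs G \<Longrightarrow> y \<in> pverts G"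
    "(x, y) \<in> parcs G \<Longrightarrow> (y, x) \<in> parcs G" "(x, x) \<notin> parcs G"
  using assms by (auto simp: pair_graph_iff)

lemma generated_simps [simp]:
  "pverts (generated G W) = W" "parcs (generated G W) = parcs G \<inter> W \<times> W"
  by (simp_all add: generated_def)

lemma cone_extension_simps [simp]:
  "pverts (cone_extension G W z) = insert z (pverts G)"
  "parcs (cone_extension G W z) = parcs G \<union> {z} \<times> W \<union> W \<times> {z}"
  by (simp_all add: cone_extension_def)

lemma pair_graph_generated: "pair_graph G \<Longrightarrow> W \<subseteq> pverts G \<Longrightarrow> pair_graph (generated G W)"
  by (auto simp: pair_graph_iff dest: rev_finite_subset)

lemma pair_graph_cone:
  "pair_graph G \<Longrightarrow> W \<subseteq> pverts G \<Longrightarrow> z \<notin> pverts G \<Longrightarrow> pair_graph (cone_extension G W z)"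
  by (auto simp: pair_graph_iff)

lemma sphere_cone:
  assumes "pair_graph G" "W \<subseteq> pverts G" "z \<notin> pverts G"
  shows "sphere (cone_extension G W z) z = generated G W"
proof -
  have "{y. (z, y) \<in> parcs (cone_extension G W z)} = W"
    using assms by (auto simp: pair_graph_iff)
  moreover have "z \<notin> W" using assms by auto
  ultimately show ?thesis by (auto simp: sphere_def generated_def)
qed

lemma cone_minus:
  assumes "pair_graph G" "W \<subseteq> pverts G" "z \<notin> pverts G"
  shows "generated (cone_extension G W z) (pverts (cone_extension G W z) - {z}) = G"
  using assms by (intro pair_pre_digraph.equality) (auto simp: pair_graph_iff)

lemma minus_cone:
  assumes "pair_graph G" "z \<in> pverts G"
  shows "cone_extension (generated G (pverts G - {z})) {y. (z, y) \<in> parcs G} z = G"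
  using assms by (intro pair_pre_digraph.equality) (auto simp: pair_graph_iff)

section \<open>Homotopy is an equivalence relation\<close>

lemma nat_homotopic_pair_graph:
  assumes "nat_homotopic G H"
  shows "pair_graph G \<and> pair_graph H"
  using assms
  \<comment> \<open>Homotopy is defined jointly with contractibility; the constant predicate
    \<open>True\<close> for the second half turns the mutual induction into one over the sequence of
    steps.\<close>
  by (induction rule: nat_homotopic_nat_contractible.inducts(1)[where ?P2.0 = "\<lambda>_. True"])
    (auto intro: pair_graph_cone pair_graph_generated)

lemma nat_homotopic_trans:
  assumes "nat_homotopic H K" "nat_homotopic G H"
  shows "nat_homotopic G K"
  using assms
  by (induction rule: nat_homotopic_nat_contractible.inducts(1)[where ?P2.0 = "\<lambda>_. True"])
    (auto intro: nat_homotopic_nat_contractible.intros)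

lemmas nat_homotopic_trans' [trans] = nat_homotopic_trans[rotated]

lemma nat_homotopic_cone:
  assumes "pair_graph H" "W \<subseteq> pverts H" "nat_contractible (generated H W)" "z \<notin> pverts H"
  shows "nat_homotopic H (cone_extension H W z)"
  using assms by (auto intro: nat_homotopic_nat_contractible.intros)

lemma nat_homotopic_remove:
  assumes "pair_graph H" "z \<in> pverts H" "nat_contractible (sphere H z)"
  shows "nat_homotopic H (generated H (pverts H - {z}))"
  using assms by (auto intro: nat_homotopic_nat_contractible.intros)

text \<open>Each step is undone by the opposite one: the sphere of a cone vertex is the subgraph it
  was attached to, and a removed vertex can be put back over its former sphere.\<close>

lemma nat_homotopic_sym:
  assumes "nat_homotopic G H"
  shows "nat_homotopic H G"
  using assms
proof (induct rule: nat_homotopic_nat_contractible.inducts(1)[where ?P2.0 = "\<lambda>_. True"])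
  case (extend G H W z)
  then have H: "pair_graph H" using nat_homotopic_pair_graph by blast
  have "nat_homotopic (cone_extension H W z)
      (generated (cone_extension H W z) (pverts (cone_extension H W z) - {z}))"
    using H extend by (intro nat_homotopic_remove pair_graph_cone) (auto simp: sphere_cone)
  moreover have "generated (cone_extension H W z) (pverts (cone_extension H W z) - {z}) = H"
    using H extend by (intro cone_minus)
  ultimately show ?case using nat_homotopic_trans[OF extend(2)] by simp
next
  case (remove G H z)
  then have H: "pair_graph H" using nat_homotopic_pair_graph by blast
  let ?W = "{y. (z, y) \<in> parcs H}"
  have "generated (generated H (pverts H - {z})) ?W = sphere H z"
    using H by (intro pair_pre_digraph.equality) (auto simp: sphere_def pair_graph_iff)
  then have "nat_homotopic (generated H (pverts H - {z}))
      (cone_extension (generated H (pverts H - {z})) ?W z)"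
    using H remove by (intro nat_homotopic_cone pair_graph_generated) (auto simp: pair_graph_iff)
  moreover have "cone_extension (generated H (pverts H - {z})) ?W z = H"
    using H remove by (intro minus_cone)
  ultimately show ?case using nat_homotopic_trans[OF remove(2)] by simp
qed (auto intro: nat_homotopic_nat_contractible.intros)

lemma nat_contractible_homotopic:
  assumes "nat_homotopic G H" "nat_contractible H"
  shows "nat_contractible G"
  using assms(2)
proof cases
  case (contractible P)
  then show ?thesis
    using assms(1) nat_homotopic_trans by (intro nat_homotopic_nat_contractible.contractible[of G P]) auto
qed

section \<open>Trees given by a list of vertices and a parent function\<close>

text \<open>If \<open>x\<close> does not occur in \<open>xs\<close>, nothing stops
  \<open>takeWhile\<close> and the value is all of \<open>set xs\<close>;
  \<open>before_append\<close> relies on this.\<close>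

definition before :: "'a list \<Rightarrow> 'a \<Rightarrow> 'a set" where
  "before xs x = set (takeWhile (\<lambda>y. y \<noteq> x) xs)"

lemma before_append: "before (xs @ ys) x = (if x \<in> set xs then before xs x else set xs \<union> before ys x)"
  by (auto simp: before_def takeWhile_append)

lemma before_Cons: "before (y # ys) x = (if x = y then {} else insert y (before ys x))"
  by (cases "x = y") (simp_all add: before_def)

lemma before_Nil [simp]: "before [] x = {}"
  by (simp add: before_def)

lemma before_subset: "before xs x \<subseteq> set xs - {x}"
  by (auto simp: before_def dest: set_takeWhileD)

text \<open>Parents are taken on \<open>tl xs\<close> because the head of \<open>xs\<close> is the
  root.\<close>

definition tree_of :: "'a list \<Rightarrow> ('a \<Rightarrow> 'a) \<Rightarrow> 'a pair_pre_digraph" where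
  "tree_of xs p = \<lparr>pverts = set xs, parcs = (\<Union>x\<in>set (tl xs). {(x, p x), (p x, x)})\<rparr>"

definition parent_fun :: "'a list \<Rightarrow> ('a \<Rightarrow> 'a) \<Rightarrow> bool" where
  "parent_fun xs p \<longleftrightarrow> xs \<noteq> [] \<and> distinct xs \<and> (\<forall>x\<in>set (tl xs). p x \<in> before xs x)"

lemma tree_of_simps [simp]:
  "pverts (tree_of xs p) = set xs"
  "parcs (tree_of xs p) = (\<Union>x\<in>set (tl xs). {(x, p x), (p x, x)})"
  by (simp_all add: tree_of_def)

lemma parent_fun_snoc:
  assumes "xs \<noteq> []"
  shows "parent_fun (xs @ [v]) p \<longleftrightarrow> parent_fun xs p \<and> v \<notin> set xs \<and> p v \<in> set xs"
proof -
  have "set (tl xs) \<subseteq> set xs" using assms by (cases xs) auto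
  then show ?thesis using assms by (auto simp: parent_fun_def before_append before_Cons)
qed

lemma pair_graph_tree_of:
  assumes "parent_fun xs p"
  shows "pair_graph (tree_of xs p)"
proof -
  have "x \<in> set xs \<and> p x \<in> set xs \<and> p x \<noteq> x" if "x \<in> set (tl xs)" for x
    using that assms before_subset[of xs x] by (cases xs) (auto simp: parent_fun_def)
  then have "x \<in> set xs" "p x \<in> set xs" "p x \<noteq> x" "x \<noteq> p x" if "x \<in> set (tl xs)" for x
    using that by metis+
  then show ?thesis by (auto simp: pair_graph_iff)
qed

lemma nat_contractible_point: "nat_contractible \<lparr>pverts = {u}, parcs = {}\<rparr>"
  by (rule nat_homotopic_nat_contractible.contractible[OF nat_homotopic_nat_contractible.refl])
    (auto simp: pair_graph_iff complete_digraph_pair_def)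

lemma generated_point:
  "pair_graph H \<Longrightarrow> generated H {u} = \<lparr>pverts = {u}, parcs = {}\<rparr>"
  by (intro pair_pre_digraph.equality) (auto simp: pair_graph_iff)

lemma nat_homotopic_leaf:
  assumes "pair_graph H" "u \<in> pverts H" "z \<notin> pverts H"
  shows "nat_homotopic H (cone_extension H {u} z)"
  using assms by (intro nat_homotopic_cone) (auto simp: generated_point nat_contractible_point)

text \<open>The last vertex of the list is nobody's parent, hence a leaf, and a leaf is a cone over
  a point. Peeling leaves from the end leaves the root.\<close>

lemma nat_contractible_tree_of:
  assumes "parent_fun xs p"
  shows "nat_contractible (tree_of xs p)"
  using assms
proof (induction xs rule: rev_induct)
  case Nil
  then show ?case by (simp add: parent_fun_def)
next
  case (snoc v xs)
  show ?case
  proof (cases "xs = []")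
    case True
    then show ?thesis by (simp add: tree_of_def nat_contractible_point)
  next
    case False
    have "tree_of (xs @ [v]) p = cone_extension (tree_of xs p) {p v} v"
      using False by (intro pair_pre_digraph.equality) auto
    moreover have "nat_homotopic (tree_of xs p) (cone_extension (tree_of xs p) {p v} v)"
      using snoc False by (intro nat_homotopic_leaf) (auto simp: parent_fun_snoc pair_graph_tree_of)
    moreover have "nat_contractible (tree_of xs p)"
      using snoc False by (auto simp: parent_fun_snoc)
    ultimately show ?thesis
      using nat_contractible_homotopic nat_homotopic_sym by auto
  qed
qed

section \<open>Sliding the attachments of a vertex\<close>

definition independent :: "'a pair_pre_digraph \<Rightarrow> 'a set \<Rightarrow> bool" where
  "independent G W \<longleftrightarrow> (\<forall>x\<in>W. \<forall>y\<in>W. (x, y) \<notin> parcs G)"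

lemma generated_cone:
  assumes "pair_graph Y" "t \<notin> pverts Y" "I \<subseteq> pverts Y" "t \<notin> I" "t \<notin> J"
  shows "generated (cone_extension Y J t) (insert t I) = cone_extension (generated Y I) (J \<inter> I) t"
  using assms by (intro pair_pre_digraph.equality) (auto dest: pair_graphD)

lemma nat_contractible_star:
  assumes "finite J" "z \<notin> J"
  shows "nat_contractible (cone_extension \<lparr>pverts = J, parcs = {}\<rparr> J z)"
proof -
  obtain js where js: "set js = J" "distinct js" using assms finite_distinct_list by blast
  have "cone_extension \<lparr>pverts = J, parcs = {}\<rparr> J z = tree_of (z # js) (\<lambda>x. z)"
    using js by (intro pair_pre_digraph.equality) auto
  then show ?thesis
    using js assms by (auto intro!: nat_contractible_tree_of simp: parent_fun_def before_Cons)
qed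

text \<open>The wide cone with apex \<open>s\<close> is built while \<open>t\<close> is still
  present: \<open>insert t I\<close> spans a star at \<open>t\<close> with one more leaf
  \<open>a'\<close> hanging at \<open>a\<close>, a contractible base. Afterwards the neighbours of
  \<open>t\<close> are \<open>J\<close> and \<open>s\<close>, which form a star at \<open>s\<close>,
  so \<open>t\<close> can be removed.\<close>

lemma slide_aux:
  fixes Y :: "nat pair_pre_digraph"
  assumes Y: "pair_graph Y" and W: "insert a (insert a' W) \<subseteq> pverts Y" and aa': "(a, a') \<in> parcs Y"
    and ind: "independent Y (insert a W)" "independent Y (insert a' W)" "a \<notin> W" "a' \<notin> W"
    and fresh: "t \<notin> pverts Y" "s \<notin> pverts Y" "s \<noteq> t"
  shows "nat_homotopic (cone_extension Y (insert a W) t) (cone_extension Y (insert a (insert a' W)) s)"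
proof -
  define J where "J = insert a W"
  define I where "I = insert a' J"
  let ?D = "\<lparr>pverts = J, parcs = {}\<rparr>"
  let ?X = "cone_extension Y J t"
  let ?Z = "cone_extension ?X (insert t I) s"
  have I: "I \<subseteq> pverts Y" "J \<subseteq> I" "t \<notin> I" "s \<notin> I" "a' \<notin> J" "a \<in> J" "J \<subseteq> pverts Y"
    and J: "finite J" "t \<notin> J" "s \<notin> J" "J \<inter> I = J"
    using W fresh pair_graphD[OF Y] aa' ind finite_subset[of J "pverts Y"] by (auto simp: I_def J_def)
  have X: "pair_graph ?X" using Y I fresh by (intro pair_graph_cone) auto
  have gJ: "generated Y J = ?D"
    using ind by (intro pair_pre_digraph.equality) (auto simp: independent_def J_def)
  \<comment> \<open>Independence of \<open>insert a' W\<close> leaves \<open>a\<close> as the only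
    neighbour of \<open>a'\<close> inside \<open>I\<close>; so \<open>I\<close> spans a discrete
    graph with one leaf attached.\<close>
  have "(a', x) \<in> parcs Y \<longleftrightarrow> x = a" "(x, a') \<in> parcs Y \<longleftrightarrow> x = a" if "x \<in> I" for x
    using that aa' pair_graphD[OF Y] ind by (auto simp: I_def J_def independent_def)
  moreover have "parcs Y \<inter> J \<times> J = {}" using gJ by (metis generated_simps(2) pair_pre_digraph.select_convs(2))
  ultimately have gI: "generated Y I = cone_extension ?D {a} a'"
    using I unfolding I_def by (intro pair_pre_digraph.equality) auto
  have star: "nat_contractible (cone_extension ?D J z)" if "z \<notin> J" for z
    using J that by (intro nat_contractible_star)
  have D: "pair_graph ?D" using J by (auto simp: pair_graph_iff)
  have "generated ?X (insert t I) = cone_extension (cone_extension ?D J t) {a} a'"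
    using I J Y fresh by (simp add: generated_cone gI) (auto simp: cone_extension_def)
  moreover have "nat_homotopic (cone_extension ?D J t) (cone_extension (cone_extension ?D J t) {a} a')"
    using I J D fresh W by (intro nat_homotopic_leaf pair_graph_cone) (auto simp: I_def)
  ultimately have "nat_contractible (generated ?X (insert t I))"
    using star[of t] J nat_contractible_homotopic nat_homotopic_sym by metis
  then have 1: "nat_homotopic ?X ?Z"
    using X I fresh by (intro nat_homotopic_cone) auto
  have Z: "pair_graph ?Z" using 1 nat_homotopic_pair_graph by blast
  have nt: "(t, x) \<notin> parcs Y" "(x, t) \<notin> parcs Y" for x using Y fresh by (auto dest: pair_graphD)
  have "{y. (t, y) \<in> parcs ?Z} = insert s J"
    using nt I J fresh by auto
  moreover have "generated ?Z (insert s J) = cone_extension (generated ?X J) J s"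
    using X I J fresh by (subst generated_cone) (auto simp: Int_absorb1 Int_absorb2)
  moreover have "generated ?X J = generated Y J"
    using J by (intro pair_pre_digraph.equality) auto
  ultimately have "nat_contractible (sphere ?Z t)"
    using star[of s] J gJ by (simp add: sphere_def)
  then have "nat_homotopic ?Z (generated ?Z (pverts ?Z - {t}))"
    using Z by (intro nat_homotopic_remove) auto
  also have "generated ?Z (pverts ?Z - {t}) = cone_extension Y I s"
    using nt fresh Y I by (intro pair_pre_digraph.equality) (auto dest: pair_graphD)
  finally have "nat_homotopic ?X (cone_extension Y I s)" by (rule nat_homotopic_trans'[OF 1])
  then show ?thesis unfolding I_def J_def insert_commute[of a' a W] .
qed

text \<open>Both cones are homotopic to the cone over \<open>insert a (insert a' W)\<close>. The
  effect is to move one attachment of the cone vertex along the edge from \<open>a\<close> to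
  \<open>a'\<close>.\<close>

lemma slide:
  fixes Y :: "nat pair_pre_digraph"
  assumes Y: "pair_graph Y" and W: "insert a (insert a' W) \<subseteq> pverts Y" and aa': "(a, a') \<in> parcs Y"
    and ind: "independent Y (insert a W)" "independent Y (insert a' W)" "a \<notin> W" "a' \<notin> W"
    and fresh: "t \<notin> pverts Y" "t' \<notin> pverts Y"
  shows "nat_homotopic (cone_extension Y (insert a W) t) (cone_extension Y (insert a' W) t')"
proof -
  obtain s where s: "s \<notin> pverts Y \<union> {t, t'}"
    using ex_new_if_finite[of "pverts Y \<union> {t, t'}"] pair_graphD(1)[OF Y] by auto
  have "nat_homotopic (cone_extension Y (insert a W) t) (cone_extension Y (insert a (insert a' W)) s)"
    using assms s by (intro slide_aux) auto
  moreover have "nat_homotopic (cone_extension Y (insert a' W) t') (cone_extension Y (insert a' (insert a W)) s)"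
    using assms s pair_graphD(4)[OF Y aa'] by (intro slide_aux) auto
  then have "nat_homotopic (cone_extension Y (insert a (insert a' W)) s) (cone_extension Y (insert a' W) t')"
    unfolding insert_commute[of a' a W] by (rule nat_homotopic_sym)
  ultimately show ?thesis
    by (rule nat_homotopic_trans')
qed

text \<open>The path \<open>a - p - s - q - b\<close> outside \<open>Y\<close>. With a single inner
  vertex, a foot could slide only to vertices that are not adjacent to the other foot. Here
  \<open>p\<close> is joined to its foot and to \<open>s\<close>, which has no neighbour in
  \<open>Y\<close>, so the feet move freely and may even meet on the way.\<close>

definition long_handle ::
  "'a pair_pre_digraph \<Rightarrow> 'a \<Rightarrow> 'a \<Rightarrow> 'a \<Rightarrow> 'a \<Rightarrow> 'a \<Rightarrow> 'a pair_pre_digraph" where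
  "long_handle Y a b p s q =
     cone_extension (cone_extension (cone_extension Y {b} q) {a} p) {p, q} s"

lemma long_handle_commute: "long_handle Y a b p s q = long_handle Y b a q s p"
  by (intro pair_pre_digraph.equality) (auto simp: long_handle_def)

text \<open>At each foot a leaf is grown and the foot is slid onto it, which lengthens the handle by
  one edge. The first slide asks for \<open>a\<close> and \<open>b\<close> to be distinct and
  non-adjacent.\<close>

lemma homotopic_long_handle:
  fixes Y :: "nat pair_pre_digraph"
  assumes Y: "pair_graph Y" "a \<in> pverts Y" "b \<in> pverts Y" "a \<noteq> b" "(a, b) \<notin> parcs Y"
    and fresh: "{t, p, s, q} \<inter> pverts Y = {}" "distinct [t, p, s, q]"
  shows "nat_homotopic (cone_extension Y {a, b} t) (long_handle Y a b p s q)"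
proof -
  let ?Y1 = "cone_extension Y {b} q"
  let ?Y2 = "cone_extension ?Y1 {a} p"
  have ba: "(b, a) \<notin> parcs Y" "(a, a) \<notin> parcs Y" "(b, b) \<notin> parcs Y"
    "(q, q) \<notin> parcs Y" "(p, p) \<notin> parcs Y" "\<And>x. (q, x) \<notin> parcs Y" "\<And>x. (x, q) \<notin> parcs Y"
    "\<And>x. (p, x) \<notin> parcs Y" "\<And>x. (x, p) \<notin> parcs Y"
    using Y fresh by (auto dest: pair_graphD)
  have Y1: "pair_graph ?Y1" and Y2: "pair_graph ?Y2"
    using Y fresh by (auto intro!: pair_graph_cone)
  have "nat_homotopic (cone_extension Y {a, b} t) (cone_extension (cone_extension Y {a, b} t) {b} q)"
    using Y fresh by (intro nat_homotopic_leaf pair_graph_cone) auto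
  also have "cone_extension (cone_extension Y {a, b} t) {b} q = cone_extension ?Y1 (insert b {a}) t"
    by (intro pair_pre_digraph.equality) auto
  also have "nat_homotopic (cone_extension ?Y1 (insert b {a}) t) (cone_extension ?Y1 (insert q {a}) s)"
    using Y Y1 fresh ba by (intro slide) (auto simp: independent_def)
  also have "nat_homotopic (cone_extension ?Y1 (insert q {a}) s)
      (cone_extension (cone_extension ?Y1 (insert q {a}) s) {a} p)"
    using Y Y1 fresh by (intro nat_homotopic_leaf pair_graph_cone[OF Y1]) auto
  also have "cone_extension (cone_extension ?Y1 (insert q {a}) s) {a} p = cone_extension ?Y2 (insert a {q}) s"
    by (intro pair_pre_digraph.equality) auto
  also have "nat_homotopic (cone_extension ?Y2 (insert a {q}) s) (cone_extension ?Y2 (insert p {q}) s)"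
    using Y Y2 fresh ba by (intro slide) (auto simp: independent_def)
  finally show ?thesis by (simp add: long_handle_def)
qed

lemma long_handle_step:
  fixes Y :: "nat pair_pre_digraph"
  assumes Y: "pair_graph Y" "(a, a') \<in> parcs Y" "b \<in> pverts Y"
    and fresh: "{p, s, q} \<inter> pverts Y = {}" "distinct [p, s, q]"
  shows "nat_homotopic (long_handle Y a b p s q) (long_handle Y a' b p s q)"
proof -
  let ?Z = "cone_extension (cone_extension Y {b} q) {q} s"
  \<comment> \<open>Reading \<open>p\<close> as the last cone vertex, over \<open>{c, s}\<close>,
    makes moving the foot \<open>c\<close> a single \<open>slide\<close>.\<close>
  have eq: "long_handle Y c b p s q = cone_extension ?Z (insert c {s}) p" for c
    by (intro pair_pre_digraph.equality) (auto simp: long_handle_def)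
  have V: "a \<in> pverts Y" "a' \<in> pverts Y" "(a, a) \<notin> parcs Y" "(a', a') \<notin> parcs Y"
    "\<And>x. (s, x) \<notin> parcs Y" "\<And>x. (x, s) \<notin> parcs Y"
    using Y fresh by (auto dest: pair_graphD)
  have Z: "pair_graph ?Z" using Y fresh by (auto intro!: pair_graph_cone)
  show ?thesis unfolding eq
    using Y Z V fresh by (intro slide) (auto simp: independent_def)
qed

lemma long_handle_reach:
  fixes Y :: "nat pair_pre_digraph"
  assumes "(a, a') \<in> (parcs Y)\<^sup>*" "pair_graph Y" "a \<in> pverts Y" "b \<in> pverts Y"
    and "{p, s, q} \<inter> pverts Y = {}" "distinct [p, s, q]"
  shows "nat_homotopic (long_handle Y a b p s q) (long_handle Y a' b p s q)"
  using assms(1)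
proof induction
  case base
  show ?case using assms unfolding long_handle_def
    by (intro nat_homotopic_nat_contractible.refl pair_graph_cone) auto
next
  case (step y z)
  then show ?case using long_handle_step[of Y y z b p s q] assms nat_homotopic_trans by metis
qed

lemma rtrancl_in_pverts:
  "(a, b) \<in> (parcs Y)\<^sup>* \<Longrightarrow> pair_graph Y \<Longrightarrow> a \<in> pverts Y \<Longrightarrow> b \<in> pverts Y"
  by (induction rule: rtrancl_induct) (auto dest: pair_graphD)

text \<open>Lengthen the handle, walk both feet along their paths, shorten it again. Non-adjacency
  of the feet is required only at the start and at the end.\<close>

lemma handle_move:
  fixes Y :: "nat pair_pre_digraph"
  assumes Y: "pair_graph Y" and ab: "a \<in> pverts Y" "b \<in> pverts Y" "a \<noteq> b" "(a, b) \<notin> parcs Y"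
    and ab': "a' \<noteq> b'" "(a', b') \<notin> parcs Y"
    and reach: "(a, a') \<in> (parcs Y)\<^sup>*" "(b, b') \<in> (parcs Y)\<^sup>*"
    and fresh: "t \<notin> pverts Y" "t' \<notin> pverts Y"
  shows "nat_homotopic (cone_extension Y {a, b} t) (cone_extension Y {a', b'} t')"
proof -
  have fin: "finite (pverts Y)" using Y by (rule pair_graphD)
  obtain p where p: "p \<notin> pverts Y \<union> {t, t'}"
    using ex_new_if_finite[of "pverts Y \<union> {t, t'}"] fin by auto
  obtain s where s: "s \<notin> pverts Y \<union> {t, t', p}"
    using ex_new_if_finite[of "pverts Y \<union> {t, t', p}"] fin by auto
  obtain q where q: "q \<notin> pverts Y \<union> {t, t', p, s}"
    using ex_new_if_finite[of "pverts Y \<union> {t, t', p, s}"] fin by auto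
  have V: "a' \<in> pverts Y" "b' \<in> pverts Y" using rtrancl_in_pverts[OF reach(1) Y] rtrancl_in_pverts[OF reach(2) Y] ab by auto
  have "nat_homotopic (cone_extension Y {a, b} t) (long_handle Y a b p s q)"
    using Y ab fresh p s q by (intro homotopic_long_handle) auto
  also have "nat_homotopic (long_handle Y a b p s q) (long_handle Y a' b p s q)"
    using Y ab reach p s q by (intro long_handle_reach) auto
  also have "long_handle Y a' b p s q = long_handle Y b a' q s p"
    by (rule long_handle_commute)
  also have "nat_homotopic (long_handle Y b a' q s p) (long_handle Y b' a' q s p)"
    using Y ab V reach p s q by (intro long_handle_reach) auto
  also have "long_handle Y b' a' q s p = long_handle Y a' b' p s q"
    by (rule long_handle_commute)
  also have "nat_homotopic (long_handle Y a' b' p s q) (cone_extension Y {a', b'} t')"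
    using Y V ab' fresh p s q by (intro nat_homotopic_sym[OF homotopic_long_handle]) auto
  finally show ?thesis .
qed

section \<open>Normal form of a connected graph\<close>

definition back_nbrs :: "'a pair_pre_digraph \<Rightarrow> 'a list \<Rightarrow> 'a \<Rightarrow> 'a set" where
  "back_nbrs G xs v = {u \<in> before xs v. (v, u) \<in> parcs G}"

lemma finite_back_nbrs [simp]: "finite (back_nbrs G xs v)"
  by (simp add: back_nbrs_def before_def)

definition add_handles :: "'a pair_pre_digraph \<Rightarrow> 'a \<Rightarrow> 'a \<Rightarrow> 'a set \<Rightarrow> 'a pair_pre_digraph" where
  "add_handles X x0 x1 K =
     \<lparr>pverts = pverts X \<union> K, parcs = parcs X \<union> K \<times> {x0, x1} \<union> {x0, x1} \<times> K\<rparr>"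

lemma add_handles_simps [simp]:
  "pverts (add_handles X x0 x1 K) = pverts X \<union> K"
  "parcs (add_handles X x0 x1 K) = parcs X \<union> K \<times> {x0, x1} \<union> {x0, x1} \<times> K"
  by (simp_all add: add_handles_def)

lemma add_handles_empty [simp]: "add_handles X x0 x1 {} = X"
  by (simp add: add_handles_def)

text \<open>A vertex attached to \<open>d\<close> pairwise non-adjacent vertices of one component is worth
  \<open>d - 1\<close> handles, and the feet of all handles can be moved to the same pair of vertices.\<close>

lemma detach_vertex:
  fixes Y :: "nat pair_pre_digraph"
  assumes "finite W" "W \<noteq> {}" "pair_graph Y" "W \<subseteq> pverts Y" "independent Y W" "v \<notin> pverts Y"
    and "finite A"
    and "\<And>w. w \<in> W \<Longrightarrow> (w, x0) \<in> (parcs Y)\<^sup>* \<and> (w, x1) \<in> (parcs Y)\<^sup>*"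
    and "2 \<le> card W \<Longrightarrow> x0 \<noteq> x1 \<and> (x0, x1) \<notin> parcs Y"
  shows "\<exists>K. finite K \<and> card K = card W - 1 \<and> K \<inter> (pverts Y \<union> A) = {} \<and>
      nat_homotopic (cone_extension Y W v) (add_handles Y x0 x1 K)"
  using assms
proof (induct W arbitrary: Y rule: finite_ne_induct)
  case (singleton w)
  then have "nat_homotopic (cone_extension Y {w} v) (add_handles Y x0 x1 {})"
    by (auto intro: nat_homotopic_sym[OF nat_homotopic_leaf])
  then show ?case by (intro exI[of _ "{}"]) auto
next
  case (insert a W)
  note Y = \<open>pair_graph Y\<close>
  have W1: "1 \<le> card W" using insert(1,2) by (simp add: Suc_le_eq card_gt_0_iff)
  then have x: "x0 \<noteq> x1" "(x0, x1) \<notin> parcs Y" using insert by auto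
  obtain w where w: "w \<in> W" using insert(2) by auto
  have V: "a \<in> pverts Y" "w \<in> pverts Y" "W \<subseteq> pverts Y" using insert(6) w by auto
  have xV: "x0 \<in> pverts Y" "x1 \<in> pverts Y"
    using rtrancl_in_pverts[OF _ Y V(1)] insert(10)[of a] by auto
  obtain y where y: "y \<notin> pverts Y \<union> {v}"
    using ex_new_if_finite[of "pverts Y \<union> {v}"] pair_graphD(1)[OF Y] by auto
  obtain h where h: "h \<notin> pverts Y \<union> {v} \<union> A"
    using ex_new_if_finite[of "pverts Y \<union> {v} \<union> A"] pair_graphD(1)[OF Y] \<open>finite A\<close> by auto
  let ?Y1 = "cone_extension Y {a} y"
  let ?Z = "cone_extension Y W v"
  let ?Y' = "cone_extension Y {x0, x1} h"
  have ne: "a \<noteq> v" "a \<noteq> y" "x0 \<noteq> v" "x1 \<noteq> v" "x0 \<noteq> h" "x1 \<noteq> h" "v \<notin> W" "y \<notin> W" "h \<notin> W"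
    using V xV insert(8) y h by auto
  have no_arc: "(v, u) \<notin> parcs Y" "(u, v) \<notin> parcs Y" "(y, u) \<notin> parcs Y" "(u, y) \<notin> parcs Y"
    "(h, u) \<notin> parcs Y" "(u, h) \<notin> parcs Y" for u
    using Y insert(8) y h by (auto dest: pair_graphD)
  have Y1: "pair_graph ?Y1" and Z: "pair_graph ?Z" and Y': "pair_graph ?Y'"
    using Y V xV insert(8) y h by (auto intro!: pair_graph_cone)
  have X: "pair_graph (cone_extension Y (insert a W) v)"
    using Y V insert(8) by (intro pair_graph_cone) auto
  have ind: "independent Y (insert a W)" by fact
  \<comment> \<open>Peeling \<open>a\<close> off \<open>v\<close>: once a leaf \<open>y\<close> at
    \<open>a\<close> takes over the attachment, \<open>y\<close> is a handle from \<open>a\<close>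
    to \<open>v\<close>, and its feet can be moved to \<open>x0\<close> and
    \<open>x1\<close>.\<close>
  have "nat_homotopic (cone_extension Y (insert a W) v)
      (cone_extension (cone_extension Y (insert a W) v) {a} y)"
    using X V y by (intro nat_homotopic_leaf) auto
  also have "cone_extension (cone_extension Y (insert a W) v) {a} y = cone_extension ?Y1 (insert a W) v"
    by (intro pair_pre_digraph.equality) auto
  also have "nat_homotopic (cone_extension ?Y1 (insert a W) v) (cone_extension ?Y1 (insert y W) v)"
  proof (rule slide[OF Y1])
    show "independent ?Y1 (insert a W)" "independent ?Y1 (insert y W)"
      using ind ne no_arc insert(3) by (auto simp: independent_def)
  qed (use V insert(3,8) y ne in auto)
  also have "cone_extension ?Y1 (insert y W) v = cone_extension ?Z {a, v} y"
    by (intro pair_pre_digraph.equality) auto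
  also have "nat_homotopic (cone_extension ?Z {a, v} y) (cone_extension ?Z {x0, x1} h)"
  proof (rule handle_move[OF Z])
    have mono: "(parcs Y)\<^sup>* \<subseteq> (parcs ?Z)\<^sup>*" by (intro rtrancl_mono) auto
    then show "(a, x0) \<in> (parcs ?Z)\<^sup>*" using insert(10)[of a] by auto
    \<comment> \<open>The foot at \<open>v\<close> leaves through a remaining attachment
      \<open>w\<close>, which exists because the induction starts from singletons.\<close>
    have "(v, w) \<in> parcs ?Z" using w by auto
    moreover have "(w, x1) \<in> (parcs ?Z)\<^sup>*" using mono insert(10)[of w] w by auto
    ultimately show "(v, x1) \<in> (parcs ?Z)\<^sup>*" by (rule converse_rtrancl_into_rtrancl)
  qed (use V x y h ne no_arc insert(3) in auto)
  also have "cone_extension ?Z {x0, x1} h = cone_extension ?Y' W v"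
    by (intro pair_pre_digraph.equality) auto
  finally have 1: "nat_homotopic (cone_extension Y (insert a W) v) (cone_extension ?Y' W v)" .
  have "\<exists>K. finite K \<and> card K = card W - 1 \<and> K \<inter> (pverts ?Y' \<union> A) = {} \<and>
      nat_homotopic (cone_extension ?Y' W v) (add_handles ?Y' x0 x1 K)"
  proof (rule insert(4))
    show "independent ?Y' W" using ind ne by (auto simp: independent_def)
    have "(parcs Y)\<^sup>* \<subseteq> (parcs ?Y')\<^sup>*" by (intro rtrancl_mono) auto
    then show "(u, x0) \<in> (parcs ?Y')\<^sup>* \<and> (u, x1) \<in> (parcs ?Y')\<^sup>*" if "u \<in> W" for u
      using insert(10)[of u] that by auto
  qed (use V x ne insert(8) h \<open>finite A\<close> in \<open>auto intro: Y'\<close>)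
  then obtain K where K: "finite K" "card K = card W - 1" "K \<inter> (pverts ?Y' \<union> A) = {}"
      "nat_homotopic (cone_extension ?Y' W v) (add_handles ?Y' x0 x1 K)" by blast
  have "add_handles ?Y' x0 x1 K = add_handles Y x0 x1 (insert h K)"
    by (intro pair_pre_digraph.equality) auto
  then have "nat_homotopic (cone_extension Y (insert a W) v) (add_handles Y x0 x1 (insert h K))"
    using 1 K(4) nat_homotopic_trans by metis
  moreover have "card (insert h K) = card (insert a W) - 1"
    using K insert(1,3) W1 by auto
  ultimately show ?case using K h by (intro exI[of _ "insert h K"]) auto
qed

section \<open>Connected vertex orders and the normal form of one component\<close>

definition block :: "'a pair_pre_digraph \<Rightarrow> 'a list \<Rightarrow> bool" where
  "block G xs \<longleftrightarrow> xs \<noteq> [] \<and> distinct xs \<and> (\<forall>v\<in>set (tl xs). back_nbrs G xs v \<noteq> {})"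

text \<open>For a block this is edges minus vertices plus 1. The subtraction is truncated, so the
  first vertex, with no earlier neighbour, contributes 0 and not -1.\<close>

definition betti :: "'a pair_pre_digraph \<Rightarrow> 'a list \<Rightarrow> nat" where
  "betti G xs = (\<Sum>v\<in>set xs. card (back_nbrs G xs v) - 1)"

lemma back_nbrs_cong:
  assumes "\<And>u w. u \<in> set xs \<Longrightarrow> w \<in> set xs \<Longrightarrow> (u, w) \<in> parcs G \<longleftrightarrow> (u, w) \<in> parcs H" "v \<in> set xs"
  shows "back_nbrs G xs v = back_nbrs H xs v"
  using assms before_subset[of xs v] by (auto simp: back_nbrs_def)

lemma back_nbrs_append: "v \<in> set xs \<Longrightarrow> back_nbrs G (xs @ ys) v = back_nbrs G xs v"
  by (simp add: back_nbrs_def before_append)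

lemma block_snoc:
  assumes "xs \<noteq> []"
  shows "block G (xs @ [v]) \<longleftrightarrow> block G xs \<and> v \<notin> set xs \<and> (\<exists>u\<in>set xs. (v, u) \<in> parcs G)"
proof -
  have tl: "set (tl xs) \<subseteq> set xs" using assms by (cases xs) auto
  then have "back_nbrs G (xs @ [v]) x = back_nbrs G xs x" if "x \<in> set (tl xs)" for x
    using that by (intro back_nbrs_append) auto
  moreover have "back_nbrs G (xs @ [v]) v = {u \<in> set xs. (v, u) \<in> parcs G}" if "v \<notin> set xs"
    using that by (simp add: back_nbrs_def before_append before_Cons)
  ultimately show ?thesis using assms tl by (auto simp: block_def)
qed

lemma block_reach_hd:
  assumes "block G xs" "x \<in> set xs"
  shows "(x, hd xs) \<in> (parcs G)\<^sup>*"
  using assms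
proof (induction xs arbitrary: x rule: rev_induct)
  case (snoc v xs)
  show ?case
  proof (cases "xs = []")
    case False
    then have b: "block G xs" "\<exists>u\<in>set xs. (v, u) \<in> parcs G" using snoc.prems by (auto simp: block_snoc)
    then show ?thesis using snoc False by (auto intro: converse_rtrancl_into_rtrancl)
  qed (use snoc in auto)
qed auto

lemma block_reach:
  assumes "pair_graph G" "block G xs" "x \<in> set xs" "y \<in> set xs"
  shows "(x, y) \<in> (parcs G)\<^sup>*"
proof -
  have "sym (parcs G)" using assms(1) by (auto simp: sym_def dest: pair_graphD)
  then have "(hd xs, y) \<in> (parcs G)\<^sup>*"
    using block_reach_hd[OF assms(2,4)] by (metis sym_rtrancl symD)
  then show ?thesis using block_reach_hd[OF assms(2,3)] by simp
qed

text \<open>The vertices of \<open>rest\<close> are detached from the back. The prefix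
  \<open>p\<close> stays and carries the feet \<open>x0\<close> and \<open>x1\<close> of all
  handles, so no new handle touches a vertex of \<open>rest\<close> and the back degrees survive for
  the induction.\<close>

lemma block_reduce:
  fixes X :: "nat pair_pre_digraph"
  assumes "pair_graph X" "p \<noteq> []" "block X (p @ rest)" "set (p @ rest) \<subseteq> pverts X"
    and "\<And>v u. v \<in> set rest \<Longrightarrow> (v, u) \<in> parcs X \<Longrightarrow> u \<in> set (p @ rest)"
    and "\<And>v u w. v \<in> set rest \<Longrightarrow> (v, u) \<in> parcs X \<Longrightarrow> (v, w) \<in> parcs X \<Longrightarrow> (u, w) \<notin> parcs X"
    and "x0 \<in> set p" "x1 \<in> set p"
    and "\<And>v. v \<in> set rest \<Longrightarrow> 2 \<le> card (back_nbrs X (p @ rest) v) \<Longrightarrow> x0 \<noteq> x1 \<and> (x0, x1) \<notin> parcs X"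
    and "finite A"
  shows "\<exists>K. finite K \<and> K \<inter> (pverts X \<union> A) = {} \<and> card K = (\<Sum>v\<in>set rest. card (back_nbrs X (p @ rest) v) - 1) \<and>
      nat_homotopic X (add_handles (generated X (pverts X - set rest)) x0 x1 K)"
  using assms
proof (induction rest arbitrary: X A rule: rev_induct)
  case Nil
  have "generated X (pverts X) = X"
    using Nil(1) by (intro pair_pre_digraph.equality) (auto simp: pair_graph_iff)
  with Nil(1) have "nat_homotopic X (add_handles (generated X (pverts X - set [])) x0 x1 {})"
    by (simp add: nat_homotopic_nat_contractible.refl)
  then show ?case by (intro exI[of _ "{}"]) auto
next
  case (snoc v rest)
  note X = \<open>pair_graph X\<close>
  let ?Y = "generated X (pverts X - {v})"
  let ?xs = "p @ rest"
  define W where "W = {u. (v, u) \<in> parcs X}"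
  have blk: "block X ?xs" "v \<notin> set ?xs"
    using snoc.prems(2,3) block_snoc[of ?xs X v] by auto
  have v: "v \<in> pverts X" using snoc.prems(4) by auto
  have W: "W \<subseteq> set ?xs" "back_nbrs X (?xs @ [v]) v = W"
    using snoc.prems(5)[of v] pair_graphD(5)[OF X] blk
    by (auto simp: W_def back_nbrs_def before_append before_Cons)
  have xsV: "set ?xs \<subseteq> pverts ?Y" using snoc.prems(4) blk by auto
  have Y: "pair_graph ?Y" using X by (intro pair_graph_generated) auto
  have arcs: "(u, w) \<in> parcs ?Y \<longleftrightarrow> (u, w) \<in> parcs X" if "u \<in> set ?xs" "w \<in> set ?xs" for u w
    using that xsV by auto
  have Yblk: "block ?Y ?xs"
    using blk(1) back_nbrs_cong[of ?xs ?Y X] arcs snoc.prems(2)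
    unfolding block_def by (metis list.set_sel(2))
  have goodY: "x0 \<noteq> x1 \<and> (x0, x1) \<notin> parcs ?Y" if "2 \<le> card W"
    using snoc.prems(9)[of v] W that by auto
  \<comment> \<open>The avoided set includes \<open>v\<close>: it is no longer a vertex of
    \<open>?Y\<close>, but the handles have to be fresh for \<open>X\<close>.\<close>
  have "\<exists>K. finite K \<and> card K = card W - 1 \<and> K \<inter> (pverts ?Y \<union> insert v A) = {} \<and>
      nat_homotopic (cone_extension ?Y W v) (add_handles ?Y x0 x1 K)"
  proof (rule detach_vertex)
    show "finite W" using W(2) by (metis finite_back_nbrs)
    show "W \<noteq> {}" using snoc.prems(2,3) block_snoc[of ?xs X v] by (auto simp: W_def)
    show "W \<subseteq> pverts ?Y" using W xsV by auto
    show "independent ?Y W" using snoc.prems(6)[of v] by (auto simp: independent_def W_def)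
    show "(w, x0) \<in> (parcs ?Y)\<^sup>* \<and> (w, x1) \<in> (parcs ?Y)\<^sup>*" if "w \<in> W" for w
      using that W snoc.prems(7,8) by (intro conjI block_reach[OF Y Yblk]) auto
  qed (use Y goodY \<open>finite A\<close> in auto)
  then obtain K1 where K1: "finite K1" "card K1 = card W - 1" "K1 \<inter> (pverts ?Y \<union> insert v A) = {}"
      "nat_homotopic (cone_extension ?Y W v) (add_handles ?Y x0 x1 K1)" by blast
  let ?X1 = "add_handles ?Y x0 x1 K1"
  have 1: "nat_homotopic X ?X1" using K1(4) minus_cone[OF X v] by (simp add: W_def)
  have X1: "pair_graph ?X1" using 1 nat_homotopic_pair_graph by blast
  have arcs1: "(u, w) \<in> parcs ?X1 \<longleftrightarrow> (u, w) \<in> parcs X" if "u \<in> set ?xs" "w \<in> set ?xs" for u w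
    using that xsV K1(3) arcs by auto
  have bk: "back_nbrs ?X1 ?xs u = back_nbrs X ?xs u" if "u \<in> set ?xs" for u
    using back_nbrs_cong[of ?xs ?X1 X] arcs1 that by auto
  have disj: "set p \<inter> set rest = {}" using blk by (auto simp: block_def)
  have arcs2: "(u, w) \<in> parcs ?X1 \<longleftrightarrow> (u, w) \<in> parcs ?Y" if "u \<in> set rest" for u w
    using that xsV K1(3) disj snoc.prems(7,8) by auto
  have "\<exists>K. finite K \<and> K \<inter> (pverts ?X1 \<union> insert v A) = {} \<and> card K = (\<Sum>v\<in>set rest. card (back_nbrs ?X1 ?xs v) - 1) \<and>
      nat_homotopic ?X1 (add_handles (generated ?X1 (pverts ?X1 - set rest)) x0 x1 K)"
  proof (rule snoc.IH)
    show "block ?X1 ?xs"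
      using blk(1) bk snoc.prems(2) unfolding block_def by (metis list.set_sel(2))
    show "u \<in> set ?xs" if "w \<in> set rest" "(w, u) \<in> parcs ?X1" for w u
      using that arcs2 snoc.prems(5)[of w u] by auto
    show "(u, w) \<notin> parcs ?X1" if "x \<in> set rest" "(x, u) \<in> parcs ?X1" "(x, w) \<in> parcs ?X1" for x u w
    proof -
      have "(x, u) \<in> parcs X" "(x, w) \<in> parcs X" "u \<in> set ?xs" "w \<in> set ?xs"
        using that arcs2 snoc.prems(5)[of x u] snoc.prems(5)[of x w] by auto
      then show ?thesis using arcs1 snoc.prems(6)[of x u w] that(1) by auto
    qed
    show "x0 \<noteq> x1 \<and> (x0, x1) \<notin> parcs ?X1" if "u \<in> set rest" "2 \<le> card (back_nbrs ?X1 ?xs u)" for u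
      using that bk[of u] back_nbrs_append[of u ?xs X "[v]"] snoc.prems(9)[of u] arcs1[of x0 x1] snoc.prems(7,8)
      by auto
  qed (use X1 snoc.prems xsV in auto)
  then obtain K2 where K2: "finite K2" "K2 \<inter> (pverts ?X1 \<union> insert v A) = {}"
      "card K2 = (\<Sum>v\<in>set rest. card (back_nbrs ?X1 ?xs v) - 1)"
      "nat_homotopic ?X1 (add_handles (generated ?X1 (pverts ?X1 - set rest)) x0 x1 K2)" by blast
  let ?K = "K1 \<union> K2"
  have x: "x0 \<notin> set rest" "x0 \<noteq> v" "x1 \<notin> set rest" "x1 \<noteq> v"
    using disj blk snoc.prems(7,8) by auto
  have "set rest \<inter> K1 = {}" using xsV K1(3) by auto
  then have "add_handles (generated ?X1 (pverts ?X1 - set rest)) x0 x1 K2 =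
      add_handles (generated X (pverts X - set (rest @ [v]))) x0 x1 ?K"
    using x xsV snoc.prems(7,8) by (intro pair_pre_digraph.equality) auto
  then have "nat_homotopic X (add_handles (generated X (pverts X - set (rest @ [v]))) x0 x1 ?K)"
    using nat_homotopic_trans[OF K2(4) 1] by simp
  moreover have "?K \<inter> (pverts X \<union> A) = {}" using K1(3) K2(2) v by auto
  moreover have "card ?K = (\<Sum>u\<in>set (rest @ [v]). card (back_nbrs X (p @ rest @ [v]) u) - 1)"
  proof -
    have "(\<Sum>u\<in>set rest. card (back_nbrs ?X1 ?xs u) - 1) = (\<Sum>u\<in>set rest. card (back_nbrs X (p @ rest @ [v]) u) - 1)"
      using bk back_nbrs_append[of _ ?xs X "[v]"] by (intro sum.cong) auto
    moreover have "v \<notin> set rest" using blk by auto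
    moreover have "K1 \<inter> K2 = {}" using K2(2) by auto
    ultimately show ?thesis
      using K1(1,2) K2(1,3) W(2) by (simp add: card_Un_disjoint)
  qed
  ultimately show ?case using K1(1) K2(1) by (intro exI[of _ ?K]) simp
qed

text \<open>With Betti number 0 the block shrinks to its first vertex. Otherwise its first three
  vertices span a path \<open>x0 - c - x1\<close>, as a triangle is excluded; \<open>c\<close>
  together with the handles at \<open>x0\<close> and \<open>x1\<close> makes
  \<open>betti X xs + 1\<close> common neighbours of these two.\<close>

lemma block_normal_form:
  fixes X :: "nat pair_pre_digraph"
  assumes X: "pair_graph X" and b: "block X xs" and xsV: "set xs \<subseteq> pverts X"
    and closed: "\<And>v u. v \<in> set xs \<Longrightarrow> (v, u) \<in> parcs X \<Longrightarrow> u \<in> set xs"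
    and tri: "\<And>v u w. v \<in> set xs \<Longrightarrow> (v, u) \<in> parcs X \<Longrightarrow> (v, w) \<in> parcs X \<Longrightarrow> (u, w) \<notin> parcs X"
    and R: "R = pverts X - set xs"
  shows "\<exists>S T. finite S \<and> finite T \<and> S \<inter> T = {} \<and> (S \<union> T) \<inter> R = {} \<and>
      card S = (if betti X xs = 0 then 0 else 2) \<and> card T = Suc (betti X xs) \<and>
      nat_homotopic X \<lparr>pverts = R \<union> S \<union> T, parcs = parcs X \<inter> R \<times> R \<union> S \<times> T \<union> T \<times> S\<rparr>"
proof -
  let ?f = "\<lambda>v. card (back_nbrs X xs v) - 1"
  have dist: "distinct xs" using b by (simp add: block_def)
  have sym: "(u, v) \<in> parcs X \<longleftrightarrow> (v, u) \<in> parcs X" for u v using X by (auto dest: pair_graphD)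
  have noloop: "(v, v) \<notin> parcs X" for v using X by (auto dest: pair_graphD)
  show ?thesis
  proof (cases "betti X xs = 0")
    case True
    obtain x rest where xs: "xs = [x] @ rest" using b by (cases xs) (auto simp: block_def)
    have small: "card (back_nbrs X xs v) \<le> 1" if "v \<in> set xs" for v
      using True that by (auto simp: betti_def)
    have "\<exists>K. finite K \<and> K \<inter> (pverts X \<union> {}) = {} \<and>
        card K = (\<Sum>v\<in>set rest. card (back_nbrs X ([x] @ rest) v) - 1) \<and>
        nat_homotopic X (add_handles (generated X (pverts X - set rest)) x x K)"
    proof (rule block_reduce[OF X])
      \<comment> \<open>The conclusion is absurd, but with Betti number 0 the premise, a back degree
        of at least 2, never holds; so both feet may be the same vertex.\<close>
      show "x \<noteq> x \<and> (x, x) \<notin> parcs X" if "v \<in> set rest" "2 \<le> card (back_nbrs X ([x] @ rest) v)" for v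
        using small[of v] that xs by auto
      show "u \<in> set ([x] @ rest)" if "v \<in> set rest" "(v, u) \<in> parcs X" for v u
        using closed[of v u] that xs by auto
      show "(u, w) \<notin> parcs X" if "v \<in> set rest" "(v, u) \<in> parcs X" "(v, w) \<in> parcs X" for v u w
        using tri[of v u w] that xs by auto
    qed (use b xs xsV in auto)
    then obtain K where K: "finite K" "card K = (\<Sum>v\<in>set rest. ?f v)"
        "nat_homotopic X (add_handles (generated X (pverts X - set rest)) x x K)"
      using xs by auto
    have "(\<Sum>v\<in>set rest. ?f v) = 0"
      using small xs by (intro sum.neutral) force
    then have "K = {}" using K by auto
    moreover have "pverts X - set rest = insert x R" using xs xsV R dist by auto
    moreover have "parcs X \<inter> insert x R \<times> insert x R = parcs X \<inter> R \<times> R"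
      using closed[of x] sym noloop[of x] R xs by auto
    ultimately have "nat_homotopic X
        \<lparr>pverts = R \<union> {} \<union> {x}, parcs = parcs X \<inter> R \<times> R \<union> {} \<times> {x} \<union> {x} \<times> {}\<rparr>"
      using K(3) by (simp add: generated_def)
    then show ?thesis using True R xs by (intro exI[of _ "{}"] exI[of _ "{x}"]) auto
  next
    case False
    obtain v1 where v1: "xs = v1 # tl xs" using b by (cases xs) (auto simp: block_def)
    have f1: "?f v1 = 0" by (subst v1) (simp add: back_nbrs_def before_Cons)
    have "tl xs \<noteq> []"
    proof
      assume "tl xs = []"
      then have "set xs = {v1}" using v1 by (metis list.simps(15) empty_set)
      then show False using False f1 by (simp add: betti_def)
    qed
    then obtain v2 where v2: "xs = v1 # v2 # tl (tl xs)" using v1 by (metis list.collapse)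
    have bk2: "back_nbrs X xs v2 \<subseteq> {v1}"
      by (subst v2) (auto simp: back_nbrs_def before_Cons)
    then have f2: "?f v2 = 0" using card_mono[OF _ bk2] by simp
    have "tl (tl xs) \<noteq> []"
    proof
      assume "tl (tl xs) = []"
      then have "set xs = {v1, v2}" using v2 by (metis list.simps(15) empty_set)
      moreover have "v1 \<noteq> v2" using dist v2 by (metis distinct_length_2_or_more)
      ultimately show False using False f1 f2 by (simp add: betti_def)
    qed
    then obtain v3 rest where xs: "xs = [v1, v2, v3] @ rest" using v2
      by (metis append_Cons append_Nil list.collapse)
    have d: "v1 \<noteq> v2" "v1 \<noteq> v3" "v2 \<noteq> v3" "{v1, v2, v3} \<inter> set rest = {}" using dist xs by auto
    have "back_nbrs X xs v2 \<noteq> {}" "back_nbrs X xs v3 \<noteq> {}" using b xs by (auto simp: block_def)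
    then have a12: "(v2, v1) \<in> parcs X" and a3: "(v3, v1) \<in> parcs X \<or> (v3, v2) \<in> parcs X"
      using xs d by (auto simp: back_nbrs_def before_Cons)
    have not_both: "\<not> ((v3, v1) \<in> parcs X \<and> (v3, v2) \<in> parcs X)"
      using tri[of v3 v2 v1] a12 xs by auto
    have bk3: "back_nbrs X xs v3 \<subseteq> {if (v3, v1) \<in> parcs X then v1 else v2}"
      using xs d not_both by (auto simp: back_nbrs_def before_Cons)
    then have f3: "?f v3 = 0" using card_mono[OF _ bk3] by simp
    have bsum: "betti X xs = (\<Sum>v\<in>set rest. ?f v)"
    proof -
      have "set xs = insert v1 (insert v2 (insert v3 (set rest)))" using xs by auto
      then show ?thesis using d f1 f2 f3 by (simp add: betti_def)
    qed
    obtain x0 c x1 where c: "{x0, c, x1} = {v1, v2, v3}" "distinct [x0, c, x1]"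
        "(c, x0) \<in> parcs X" "(c, x1) \<in> parcs X" "(x0, x1) \<notin> parcs X"
    proof (cases "(v3, v1) \<in> parcs X")
      case True
      then show ?thesis using that[of v2 v1 v3] a12 not_both d sym by auto
    next
      case False
      then show ?thesis using that[of v1 v2 v3] a12 a3 d sym by auto
    qed
    have x01: "x0 \<in> {v1, v2, v3}" "x1 \<in> {v1, v2, v3}" "c \<in> {v1, v2, v3}" using c(1) by auto
    have "\<exists>K. finite K \<and> K \<inter> (pverts X \<union> {}) = {} \<and>
        card K = (\<Sum>v\<in>set rest. card (back_nbrs X ([v1, v2, v3] @ rest) v) - 1) \<and>
        nat_homotopic X (add_handles (generated X (pverts X - set rest)) x0 x1 K)"
    proof (rule block_reduce[OF X])
      show "u \<in> set ([v1, v2, v3] @ rest)" if "v \<in> set rest" "(v, u) \<in> parcs X" for v u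
        using closed[of v u] that xs by auto
      show "(u, w) \<notin> parcs X" if "v \<in> set rest" "(v, u) \<in> parcs X" "(v, w) \<in> parcs X" for v u w
        using tri[of v u w] that xs by auto
    qed (use b xs xsV c x01 in auto)
    then obtain K where K: "finite K" "K \<inter> pverts X = {}" "card K = (\<Sum>v\<in>set rest. ?f v)"
        "nat_homotopic X (add_handles (generated X (pverts X - set rest)) x0 x1 K)"
      using xs by auto
    let ?C = "{x0, c, x1}"
    have V: "pverts X - set rest = R \<union> ?C" using c(1) R xs xsV dist by auto
    have cross: "(u, w) \<notin> parcs X \<and> (w, u) \<notin> parcs X" if "u \<in> ?C" "w \<in> R" for u w
    proof -
      have "u \<in> set xs" using that c(1) xs by auto
      then show ?thesis using closed[of u w] sym[of u w] that R by auto
    qed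
    have "parcs X \<inter> (R \<union> ?C) \<times> (R \<union> ?C) = parcs X \<inter> R \<times> R \<union> parcs X \<inter> ?C \<times> ?C"
      using cross by blast
    also have "parcs X \<inter> ?C \<times> ?C = {x0, x1} \<times> {c} \<union> {c} \<times> {x0, x1}"
      using c(3,4,5) noloop sym by auto
    finally have "add_handles (generated X (pverts X - set rest)) x0 x1 K =
        \<lparr>pverts = R \<union> {x0, x1} \<union> insert c K,
         parcs = parcs X \<inter> R \<times> R \<union> {x0, x1} \<times> insert c K \<union> insert c K \<times> {x0, x1}\<rparr>"
      unfolding V by (intro pair_pre_digraph.equality) auto
    note final = this
    have CV: "?C \<subseteq> set xs" using c(1) xs by auto
    have "c \<notin> K" "x0 \<notin> K" "x1 \<notin> K" "K \<inter> R = {}" "?C \<inter> R = {}" using CV xsV K(2) R by auto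
    note fresh = this
    show ?thesis
    proof (rule exI[of _ "{x0, x1}"], rule exI[of _ "insert c K"], intro conjI)
      show "card (insert c K) = Suc (betti X xs)" using K(1,3) bsum fresh by simp
      show "nat_homotopic X \<lparr>pverts = R \<union> {x0, x1} \<union> insert c K,
          parcs = parcs X \<inter> R \<times> R \<union> {x0, x1} \<times> insert c K \<union> insert c K \<times> {x0, x1}\<rparr>"
        using K(4) by (simp only: final)
    qed (use fresh K(1) False c(2) in auto)
  qed
qed

text \<open>The colour of a vertex is its component together with its side. In the normal form component
  \<open>i\<close> is a single vertex or \<open>K(2, b + 1)\<close>, where \<open>b\<close> is its Betti number.\<close>

definition bipartite_blocks :: "'a pair_pre_digraph \<Rightarrow> ('a \<Rightarrow> nat \<times> bool) \<Rightarrow> bool" where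
  "bipartite_blocks F \<kappa> \<longleftrightarrow> finite (pverts F) \<and>
     parcs F = {(x, y). x \<in> pverts F \<and> y \<in> pverts F \<and> fst (\<kappa> x) = fst (\<kappa> y) \<and> snd (\<kappa> x) \<noteq> snd (\<kappa> y)}"

definition color_count :: "nat list \<Rightarrow> nat \<times> bool \<Rightarrow> nat" where
  "color_count bs c = (if fst c < length bs then
     (if snd c then (if bs ! fst c = 0 then 0 else 2) else Suc (bs ! fst c)) else 0)"

text \<open>Blocks are normalised one at a time. \<open>U\<close> is the part already in normal
  form, coloured by \<open>\<kappa>0\<close>, and \<open>ns\<close> lists the Betti numbers of its
  components; the next block becomes component \<open>length ns\<close>.\<close>

lemma blocks_normal_form:
  fixes X :: "nat pair_pre_digraph"
  assumes "pair_graph X" "distinct (concat bs)" "U \<inter> set (concat bs) = {}" "pverts X = U \<union> set (concat bs)"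
    and "\<And>b. b \<in> set bs \<Longrightarrow> block X b"
    and "\<And>b v u. b \<in> set bs \<Longrightarrow> v \<in> set b \<Longrightarrow> (v, u) \<in> parcs X \<Longrightarrow> u \<in> set b"
    and "\<And>v u w. v \<in> set (concat bs) \<Longrightarrow> (v, u) \<in> parcs X \<Longrightarrow> (v, w) \<in> parcs X \<Longrightarrow> (u, w) \<notin> parcs X"
    and "bipartite_blocks (generated X U) \<kappa>0" "\<And>x. x \<in> U \<Longrightarrow> fst (\<kappa>0 x) < length ns"
    and "\<And>c. card {x \<in> U. \<kappa>0 x = c} = color_count ns c"
  shows "\<exists>F \<kappa>. nat_homotopic X F \<and> bipartite_blocks F \<kappa> \<and>
    (\<forall>c. card {x \<in> pverts F. \<kappa> x = c} = color_count (ns @ map (betti X) bs) c)"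
  using assms
proof (induction bs arbitrary: X U \<kappa>0 "ns")
  case Nil
  have "generated X U = X"
    using Nil.prems(1,4) by (intro pair_pre_digraph.equality) (auto simp: pair_graph_iff)
  with Nil.prems show ?case
    by (intro exI[of _ X] exI[of _ \<kappa>0]) (auto intro: nat_homotopic_nat_contractible.refl)
next
  case (Cons b bs)
  let ?R = "pverts X - set b"
  have R: "?R = U \<union> set (concat bs)" using Cons.prems(2,3,4) by auto
  have sym: "(u, v) \<in> parcs X \<longleftrightarrow> (v, u) \<in> parcs X" for u v
    using Cons.prems(1) by (auto dest: pair_graphD)
  have "\<exists>S T. finite S \<and> finite T \<and> S \<inter> T = {} \<and> (S \<union> T) \<inter> ?R = {} \<and>
      card S = (if betti X b = 0 then 0 else 2) \<and> card T = Suc (betti X b) \<and>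
      nat_homotopic X \<lparr>pverts = ?R \<union> S \<union> T, parcs = parcs X \<inter> ?R \<times> ?R \<union> S \<times> T \<union> T \<times> S\<rparr>"
  proof (rule block_normal_form)
    show "block X b" using Cons.prems(5) by simp
    show "u \<in> set b" if "v \<in> set b" "(v, u) \<in> parcs X" for u v
      using Cons.prems(6)[of b v u] that by simp
    show "(u, w) \<notin> parcs X" if "v \<in> set b" "(v, u) \<in> parcs X" "(v, w) \<in> parcs X" for v u w
      using Cons.prems(7)[of v u w] that by simp
  qed (use Cons.prems(1,4) in auto)
  then obtain S T where ST: "finite S" "finite T" "S \<inter> T = {}" "(S \<union> T) \<inter> ?R = {}"
      "card S = (if betti X b = 0 then 0 else 2)" "card T = Suc (betti X b)"
      "nat_homotopic X \<lparr>pverts = ?R \<union> S \<union> T, parcs = parcs X \<inter> ?R \<times> ?R \<union> S \<times> T \<union> T \<times> S\<rparr>"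
    by blast
  define Y where "Y = \<lparr>pverts = ?R \<union> S \<union> T, parcs = parcs X \<inter> ?R \<times> ?R \<union> S \<times> T \<union> T \<times> S\<rparr>"
  have XY: "nat_homotopic X Y" using ST(7) by (simp add: Y_def)
  have Y: "pair_graph Y" using XY nat_homotopic_pair_graph by blast
  have YV: "pverts Y = ?R \<union> S \<union> T" and YA: "parcs Y = parcs X \<inter> ?R \<times> ?R \<union> S \<times> T \<union> T \<times> S"
    by (simp_all add: Y_def)
  define \<kappa>1 where "\<kappa>1 x = (if x \<in> S then (length ns, True) else if x \<in> T then (length ns, False) else \<kappa>0 x)" for x
  let ?U = "U \<union> S \<union> T"
  have disj: "set (concat bs) \<inter> (S \<union> T) = {}" "U \<inter> (S \<union> T) = {}" using ST(4) R by auto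
  have old: "(u, w) \<in> parcs Y \<longleftrightarrow> (u, w) \<in> parcs X" if "b' \<in> set bs" "u \<in> set b'" for b' u w
  proof -
    have u: "u \<in> set (concat bs)" using that by auto
    then have "u \<in> ?R" "u \<notin> S \<union> T" using R disj by auto
    moreover have "w \<in> ?R" if "(u, w) \<in> parcs X"
    proof -
      have "w \<in> set b'" using Cons.prems(6)[of b' u w] that \<open>b' \<in> set bs\<close> \<open>u \<in> set b'\<close> by auto
      then show ?thesis using R \<open>b' \<in> set bs\<close> by auto
    qed
    ultimately show ?thesis using YA by auto
  qed
  have bk: "back_nbrs Y b' v = back_nbrs X b' v" if "b' \<in> set bs" "v \<in> set b'" for b' v
    using old[OF that(1)] that(2) by (intro back_nbrs_cong) auto
  have fin: "finite (pverts X)" using Cons.prems(1) by (rule pair_graphD)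
  have "\<exists>F \<kappa>. nat_homotopic Y F \<and> bipartite_blocks F \<kappa> \<and>
    (\<forall>c. card {x \<in> pverts F. \<kappa> x = c} = color_count ((ns @ [betti X b]) @ map (betti Y) bs) c)"
  proof (rule Cons.IH[OF Y, of ?U \<kappa>1 "ns @ [betti X b]"])
    show "distinct (concat bs)" using Cons.prems(2) by simp
    show "?U \<inter> set (concat bs) = {}" using Cons.prems(3) disj by auto
    show "pverts Y = ?U \<union> set (concat bs)" using YV R by auto
    show "block Y b'" if "b' \<in> set bs" for b'
    proof -
      have "block X b'" using Cons.prems(5) that by simp
      moreover have "set (tl b') \<subseteq> set b'" by (cases b') auto
      ultimately show ?thesis using bk[OF that] by (auto simp: block_def)
    qed
    show "u \<in> set b'" if "b' \<in> set bs" "v \<in> set b'" "(v, u) \<in> parcs Y" for b' u v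
      using old[of b' v u] that Cons.prems(6)[of b' v u] by auto
    show "(u, w) \<notin> parcs Y" if "v \<in> set (concat bs)" "(v, u) \<in> parcs Y" "(v, w) \<in> parcs Y" for u v w
    proof -
      from that(1) obtain b' where b': "b' \<in> set bs" "v \<in> set b'" by auto
      then have X: "(v, u) \<in> parcs X" "(v, w) \<in> parcs X" using old that by auto
      then have "u \<in> set b'" using Cons.prems(6)[of b' v u] b' by auto
      then show ?thesis using Cons.prems(7)[of v u w] X that(1) old[of b' u w] b' by auto
    qed
    show "bipartite_blocks (generated Y ?U) \<kappa>1"
    proof -
      have *: "parcs (generated X U) = {(x, y). x \<in> U \<and> y \<in> U \<and> fst (\<kappa>0 x) = fst (\<kappa>0 y) \<and> snd (\<kappa>0 x) \<noteq> snd (\<kappa>0 y)}"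
        using Cons.prems(8) by (simp add: bipartite_blocks_def)
      have UR: "U \<subseteq> ?R" using R by auto
      have "parcs Y \<inter> ?U \<times> ?U = parcs X \<inter> U \<times> U \<union> S \<times> T \<union> T \<times> S"
        using YA UR ST(4) by auto
      also have "\<dots> = {(x, y). x \<in> ?U \<and> y \<in> ?U \<and> fst (\<kappa>1 x) = fst (\<kappa>1 y) \<and> snd (\<kappa>1 x) \<noteq> snd (\<kappa>1 y)}"
      proof -
        have "fst (\<kappa>0 x) \<noteq> length ns \<and> length ns \<noteq> fst (\<kappa>0 x)" if "x \<in> U" for x
          using Cons.prems(9)[OF that] by simp
        moreover have "x \<notin> S \<and> x \<notin> T" if "x \<in> U" for x using that disj by auto
        moreover have "x \<notin> S" if "x \<in> T" for x using that ST(3) by auto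
        moreover have "(x, y) \<in> parcs X \<longleftrightarrow> fst (\<kappa>0 x) = fst (\<kappa>0 y) \<and> snd (\<kappa>0 x) \<noteq> snd (\<kappa>0 y)"
          if "x \<in> U" "y \<in> U" for x y using * that by auto
        ultimately show ?thesis by (auto simp: \<kappa>1_def)
      qed
      finally show ?thesis
        using Cons.prems(4) fin ST(1,2) by (auto simp: bipartite_blocks_def)
    qed
    show "fst (\<kappa>1 x) < length (ns @ [betti X b])" if "x \<in> ?U" for x
      using that Cons.prems(9)[of x] by (auto simp: \<kappa>1_def)
    show "card {x \<in> ?U. \<kappa>1 x = c} = color_count (ns @ [betti X b]) c" for c
    proof (cases "fst c = length ns")
      case True
      have "\<kappa>0 x \<noteq> c" if "x \<in> U" for x using Cons.prems(9)[OF that] True by auto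
      then have "{x \<in> ?U. \<kappa>1 x = c} = (if snd c then S else T)"
        using True ST(3) disj by (cases c) (auto simp: \<kappa>1_def)
      then show ?thesis using True ST(5,6) by (simp add: color_count_def)
    next
      case False
      then have "{x \<in> ?U. \<kappa>1 x = c} = {x \<in> U. \<kappa>0 x = c}"
        using disj by (auto simp: \<kappa>1_def)
      then show ?thesis using Cons.prems(10)[of c] False
        by (auto simp: color_count_def nth_append)
    qed
  qed
  moreover have "betti Y b' = betti X b'" if "b' \<in> set bs" for b'
    using bk[OF that] by (simp add: betti_def)
  then have "map (betti Y) bs = map (betti X) bs" by simp
  ultimately obtain F \<kappa> where "nat_homotopic Y F" "bipartite_blocks F \<kappa>"
    "\<forall>c. card {x \<in> pverts F. \<kappa> x = c} = color_count (ns @ map (betti X) (b # bs)) c"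
    by auto
  then show ?case using XY nat_homotopic_trans by blast
qed

text \<open>Adjacency is a function of the two colours, so any bijections between the colour classes
  glue to an isomorphism.\<close>

lemma bipartite_blocks_iso:
  assumes F: "bipartite_blocks F \<kappa>" and H: "bipartite_blocks H \<mu>"
    and card: "\<And>c. card {x \<in> pverts F. \<kappa> x = c} = card {x \<in> pverts H. \<mu> x = c}"
  shows "\<exists>f. bij_betw f (pverts F) (pverts H) \<and>
    (\<forall>x\<in>pverts F. \<forall>y\<in>pverts F. (x, y) \<in> parcs F \<longleftrightarrow> (f x, f y) \<in> parcs H)"
proof -
  have "\<exists>f. bij_betw f {x \<in> pverts F. \<kappa> x = c} {x \<in> pverts H. \<mu> x = c}" for c
    using F H by (intro finite_same_card_bij card) (auto simp: bipartite_blocks_def)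
  then obtain g where g: "\<And>c. bij_betw (g c) {x \<in> pverts F. \<kappa> x = c} {x \<in> pverts H. \<mu> x = c}"
    by metis
  define f where "f x = g (\<kappa> x) x" for x
  have f: "f x \<in> pverts H \<and> \<mu> (f x) = \<kappa> x" if "x \<in> pverts F" for x
    using bij_betwE[OF g[of "\<kappa> x"]] that by (auto simp: f_def)
  have "inj_on f (pverts F)"
  proof (rule inj_onI)
    fix x y assume xy: "x \<in> pverts F" "y \<in> pverts F" "f x = f y"
    then have "\<kappa> x = \<kappa> y" using f by metis
    then show "x = y" using xy inj_onD[OF bij_betw_imp_inj_on[OF g[of "\<kappa> x"]], of x y] by (auto simp: f_def)
  qed
  moreover have "pverts H \<subseteq> f ` pverts F"
  proof
    fix y assume "y \<in> pverts H"
    then obtain x where "x \<in> pverts F" "\<kappa> x = \<mu> y" "y = g (\<mu> y) x"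
      using bij_betw_imp_surj_on[OF g[of "\<mu> y"]] by auto
    then have "x \<in> pverts F" "y = f x" by (simp_all add: f_def)
    then show "y \<in> f ` pverts F" by auto
  qed
  ultimately have "bij_betw f (pverts F) (pverts H)" using f by (auto simp: bij_betw_def)
  then show ?thesis using F H f by (intro exI[of _ f]) (auto simp: bipartite_blocks_def)
qed

section \<open>Profiles of vertex orders and subdivisions\<close>

definition degs :: "'a pair_pre_digraph \<Rightarrow> 'a list \<Rightarrow> nat list" where
  "degs G xs = map (\<lambda>v. card (back_nbrs G xs v)) xs"

text \<open>The flags record what dimension and topology still see: a one-vertex block has a
  spanning tree of dimension 0, and if the last vertex has back degree at least 2, the largest extra
  trees already cover the block.\<close>

definition profile :: "nat list \<Rightarrow> bool \<times> nat list \<times> bool" where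
  "profile ds = (length ds = 1, filter (\<lambda>d. 2 \<le> d) ds, 2 \<le> last ds)"

lemma length_degs [simp]: "length (degs G xs) = length xs"
  by (simp add: degs_def)

lemma block_degs: "block G xs \<longleftrightarrow> xs \<noteq> [] \<and> distinct xs \<and> 0 \<notin> set (tl (degs G xs))"
  by (auto simp: block_def degs_def map_tl[symmetric])

lemma degs_cong:
  assumes "\<And>u w. u \<in> set xs \<Longrightarrow> w \<in> set xs \<Longrightarrow> (u, w) \<in> parcs G \<longleftrightarrow> (u, w) \<in> parcs H"
  shows "degs G xs = degs H xs"
  using back_nbrs_cong[OF assms] by (simp add: degs_def)

text \<open>Each entry is multiplied by its position counted from the end. Moving a 2 forward past
  entries that are at least 2 never increases the total, and keeps it only if all of them are
  2.\<close>

fun weight :: "nat list \<Rightarrow> nat" where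
  "weight [] = 0"
| "weight (d # ds) = d * length (d # ds) + weight ds"

lemma weight_append: "weight (xs @ ys) = weight xs + sum_list xs * length ys + weight ys"
  by (induction xs) (auto simp: algebra_simps)

text \<open>The flag breaks ties: removing a subdivision vertex can leave the list alone and switch
  the flag off, but never on.\<close>

definition mu :: "bool \<times> nat list \<times> bool \<Rightarrow> nat" where
  "mu p = weight (fst (snd p)) + of_bool (snd (snd p))"

lemma profile_insert_one:
  assumes "as \<noteq> []" "bs \<noteq> []"
  shows "profile (as @ 1 # bs) = profile (as @ bs)"
  using assms by (cases as; cases bs) (auto simp: profile_def)

lemma ge2_sum_list: "\<forall>d\<in>set ds. (2::nat) \<le> d \<Longrightarrow> 2 * length ds \<le> sum_list ds"
  by (induction ds) auto

lemma sum_list_eq_2_length: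
  "\<forall>d\<in>set ds. (2::nat) \<le> d \<Longrightarrow> sum_list ds = 2 * length ds \<Longrightarrow> ds = replicate (length ds) 2"
proof (induction ds)
  case (Cons d ds)
  then have "2 * length ds \<le> sum_list ds" by (intro ge2_sum_list) auto
  with Cons show ?case by auto
qed simp

text \<open>What happens to the degree list of an order when a subdivision vertex that comes after both
  of its neighbours is removed.\<close>

lemma mu_merge:
  fixes p q y :: "nat list"
  assumes "p \<noteq> []" "1 \<le> d"
  defines "ds \<equiv> p @ [d] @ q @ [2] @ y" and "es \<equiv> p @ [Suc d] @ q @ y"
  shows "profile es = profile ds \<or> mu (profile es) < mu (profile ds)"
proof -
  let ?F = "filter (\<lambda>d. (2::nat) \<le> d)"
  let ?P = "?F p" and ?Q = "?F q" and ?Y = "?F y"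
  have Q: "2 * length ?Q \<le> sum_list ?Q" by (rule ge2_sum_list) auto
  \<comment> \<open>If \<open>y\<close> is empty, the removed 2 is the last entry of
    \<open>ds\<close>, so the flag can be lost but not gained.\<close>
  have flag: "2 \<le> last ds" if "2 \<le> last es"
    using that by (auto simp: ds_def es_def split: if_splits)
  have len: "length es \<noteq> 1" "length ds \<noteq> 1" using assms(1) by (auto simp: ds_def es_def)
  show ?thesis
  proof (cases "d = 1")
    case True
    have Fd: "?F ds = ?P @ ?Q @ [2] @ ?Y" and Fe: "?F es = ?P @ [2] @ ?Q @ ?Y"
      using True by (simp_all add: ds_def es_def numeral_2_eq_2)
    \<comment> \<open>For \<open>d = 1\<close> the filtered list only sees the 2 jump forward over
      \<open>?Q\<close>: it gains \<open>length ?Q\<close> positions, and each entry of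
      \<open>?Q\<close> loses one.\<close>
    have w: "weight (?F ds) + 2 * length ?Q = weight (?F es) + sum_list ?Q"
      unfolding Fd Fe by (simp add: weight_append algebra_simps)
    show ?thesis
    proof (cases "sum_list ?Q = 2 * length ?Q")
      case True
      have "?Q = replicate (length ?Q) 2" by (rule sum_list_eq_2_length[OF _ True]) auto
      then have "[2] @ ?Q = ?Q @ [2]" by (metis append_Cons append_Nil replicate_append_same)
      then have "?F es = ?F ds" unfolding Fd Fe by (metis append.assoc)
      then show ?thesis using flag len by (cases "2 \<le> last es = (2 \<le> last ds)") (auto simp: profile_def mu_def)
    next
      case False
      then have "weight (?F es) < weight (?F ds)" using w Q by linarith
      then show ?thesis using flag by (auto simp: profile_def mu_def)
    qed
  next
    case False
    then have d: "2 \<le> d" using assms(2) by simp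
    have Fd: "?F ds = ?P @ [d] @ ?Q @ [2] @ ?Y" and Fe: "?F es = ?P @ [Suc d] @ ?Q @ ?Y"
      using d by (simp_all add: ds_def es_def)
    \<comment> \<open>An entry disappears, so \<open>?P\<close>, \<open>d\<close> and
      \<open>?Q\<close> drop by one position each. Raising \<open>d\<close> costs
      \<open>length ?Q + length ?Y + 1\<close>, which is less than the loss:
      \<open>sum_list ?Q\<close> is at least \<open>2 * length ?Q\<close>, and the removed 2 counted
      for \<open>2 * (length ?Y + 1)\<close>.\<close>
    have "weight (?F es) + sum_list ?P + sum_list ?Q + d + 2 + 2 * length ?Y =
        weight (?F ds) + length ?Q + length ?Y + 1"
      unfolding Fd Fe by (simp add: weight_append algebra_simps)
    then have "weight (?F es) < weight (?F ds)" using Q by linarith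
    then show ?thesis using flag by (auto simp: profile_def mu_def)
  qed
qed

section \<open>Effect of a subdivision on vertex orders\<close>

definition splits :: "'a pair_pre_digraph \<Rightarrow> 'a pair_pre_digraph \<Rightarrow> 'a \<Rightarrow> 'a \<Rightarrow> 'a \<Rightarrow> bool" where
  "splits G H u v w \<longleftrightarrow> pair_graph G \<and> (u, v) \<in> parcs G \<and> w \<notin> pverts G \<and>
     pverts H = insert w (pverts G) \<and>
     parcs H = (parcs G - {(u, v), (v, u)}) \<union> {(u, w), (w, u), (w, v), (v, w)}"

lemma splits_sym: "splits G H u v w \<Longrightarrow> splits G H v u w"
  by (auto simp: splits_def dest: pair_graphD)

lemma subdivision_of_splits:
  "subdivision_of G H \<Longrightarrow> \<exists>u v w. splits G H u v w"
  by (force simp: subdivision_of_def splits_def subdivide.simps)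

lemma splitsD:
  assumes "splits G H u v w"
  shows "pair_graph G" "(u, v) \<in> parcs G" "(v, u) \<in> parcs G" "u \<noteq> v" "w \<noteq> u" "w \<noteq> v"
    "u \<in> pverts G" "v \<in> pverts G" "w \<notin> pverts G" "pverts H = insert w (pverts G)"
    "(w, x) \<in> parcs H \<longleftrightarrow> x = u \<or> x = v"
    "(v, x) \<in> parcs H \<longleftrightarrow> x = w \<or> x \<noteq> u \<and> (v, x) \<in> parcs G"
    "(w, x) \<notin> parcs G" "(x, w) \<notin> parcs G"
    "x \<noteq> u \<Longrightarrow> x \<noteq> v \<Longrightarrow> x \<noteq> w \<Longrightarrow> (x, y) \<in> parcs H \<longleftrightarrow> (x, y) \<in> parcs G"
    "y \<noteq> v \<Longrightarrow> y \<noteq> w \<Longrightarrow> (u, y) \<in> parcs H \<longleftrightarrow> (u, y) \<in> parcs G"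
  using assms unfolding splits_def by (auto dest: pair_graphD)

lemma pair_graph_splits: "splits G H u v w \<Longrightarrow> pair_graph H"
  using splitsD[of G H u v w] unfolding splits_def by (auto simp: pair_graph_iff)

lemma card_swap:
  assumes "finite A" "u \<in> A" "w \<notin> A"
  shows "card (insert w (A - {u})) = card A"
  using assms card_Suc_Diff1[OF assms(1,2)] by (subst card_insert_disjoint) auto

text \<open>Between its two neighbours \<open>w\<close> has one earlier neighbour, and the later end
  \<open>v\<close> merely exchanges its back neighbour \<open>u\<close> for
  \<open>w\<close>.\<close>

lemma degs_between:
  assumes sp: "splits G H u v w" and d: "distinct (xs @ ys)" "w \<notin> set (xs @ ys)"
    and uv: "u \<in> set xs" "v \<in> set ys"
  defines "f \<equiv> \<lambda>x. card (back_nbrs G (xs @ ys) x)"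
  shows "degs H (xs @ w # ys) = map f xs @ 1 # map f ys"
proof -
  note s = splitsD[OF sp]
  have 1: "card (back_nbrs H (xs @ w # ys) x) = f x" if x: "x \<in> set xs" for x
  proof -
    have "x \<noteq> v" "x \<noteq> w" using x d uv by auto
    have sub: "before xs x \<subseteq> set xs - {v, w}" using before_subset[of xs x] d uv by auto
    have "(x, y) \<in> parcs H \<longleftrightarrow> (x, y) \<in> parcs G" if "y \<in> before xs x" for y
      using s(15)[of x y] s(16)[of y] that sub \<open>x \<noteq> v\<close> \<open>x \<noteq> w\<close> by (cases "x = u") auto
    then show ?thesis using x by (auto simp: f_def back_nbrs_def before_append intro!: arg_cong[where f = card])
  qed
  have "before (xs @ w # ys) w = set xs" using d by (simp add: before_append before_Cons)
  then have "back_nbrs H (xs @ w # ys) w = {u}" using s(11) uv d by (auto simp: back_nbrs_def)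
  then have 2: "card (back_nbrs H (xs @ w # ys) w) = 1" by simp
  have 3: "card (back_nbrs H (xs @ w # ys) x) = f x" if x: "x \<in> set ys" for x
  proof -
    have nx: "x \<notin> set xs" "x \<noteq> u" "x \<noteq> w" using x d uv by auto
    let ?A = "set xs \<union> before ys x"
    have A: "before (xs @ w # ys) x = insert w ?A" "before (xs @ ys) x = ?A" "w \<notin> ?A"
      using nx d before_subset[of ys x] by (auto simp: before_append before_Cons)
    show ?thesis
    proof (cases "x = v")
      case True
      have "back_nbrs H (xs @ w # ys) x = insert w (back_nbrs G (xs @ ys) x - {u})"
        using s(5,12) True A by (auto simp: back_nbrs_def)
      moreover have "u \<in> back_nbrs G (xs @ ys) x" "w \<notin> back_nbrs G (xs @ ys) x"
        using True A uv s(3) by (auto simp: back_nbrs_def)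
      ultimately show ?thesis unfolding f_def by (metis card_swap finite_back_nbrs)
    next
      case False
      then have "back_nbrs H (xs @ w # ys) x = back_nbrs G (xs @ ys) x"
        using s(14,15) nx A by (auto simp: back_nbrs_def)
      then show ?thesis by (simp add: f_def)
    qed
  qed
  show ?thesis using 1 2 3 by (simp add: degs_def)
qed

text \<open>When an initial \<open>w\<close> is removed, \<open>u\<close> becomes the first vertex
  and \<open>v\<close> exchanges \<open>w\<close> for \<open>u\<close>; only the entry 1 of
  \<open>u\<close> is lost.\<close>

lemma degs_first:
  assumes sp: "splits G H u v w" and d: "distinct (u # zs)" "w \<notin> set (u # zs)" and v: "v \<in> set zs"
  defines "f \<equiv> \<lambda>x. card (back_nbrs G (u # zs) x)"
  shows "degs H (w # u # zs) = 0 # 1 # map f zs"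
proof -
  note s = splitsD[OF sp]
  have "back_nbrs H (w # u # zs) u = {w}"
    using s(5) splitsD(12)[OF splits_sym[OF sp]] by (auto simp: back_nbrs_def before_Cons)
  moreover have "card (back_nbrs H (w # u # zs) x) = f x" if x: "x \<in> set zs" for x
  proof -
    have nx: "x \<noteq> u" "x \<noteq> w" using x d by auto
    let ?A = "insert u (before zs x)"
    have A: "before (w # u # zs) x = insert w ?A" "before (u # zs) x = ?A" "w \<notin> ?A"
      using nx d before_subset[of zs x] by (auto simp: before_Cons)
    show ?thesis
    proof (cases "x = v")
      case True
      have "back_nbrs H (w # u # zs) x = insert w (back_nbrs G (u # zs) x - {u})"
        using s(5,12) True A by (auto simp: back_nbrs_def)
      moreover have "u \<in> back_nbrs G (u # zs) x" "w \<notin> back_nbrs G (u # zs) x"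
        using True A s(3) by (auto simp: back_nbrs_def)
      ultimately show ?thesis unfolding f_def by (metis card_swap finite_back_nbrs)
    next
      case False
      then have "back_nbrs H (w # u # zs) x = back_nbrs G (u # zs) x"
        using s(14,15) nx A by (auto simp: back_nbrs_def)
      then show ?thesis by (simp add: f_def)
    qed
  qed
  moreover have "back_nbrs H (w # u # zs) w = {}" by (simp add: back_nbrs_def before_Cons)
  ultimately show ?thesis by (simp add: degs_def)
qed

text \<open>Behind both of its neighbours \<open>w\<close> has back degree 2. Without
  \<open>w\<close>, the edge between \<open>u\<close> and \<open>v\<close> is back and counts at the
  later end \<open>v\<close>.\<close>

lemma degs_last:
  assumes sp: "splits G H u v w" and d: "distinct (p @ v # q @ ys)" "w \<notin> set (p @ v # q @ ys)"
    and u: "u \<in> set p"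
  defines "g \<equiv> \<lambda>x. card (back_nbrs H (p @ v # q @ w # ys) x)"
  shows "degs H (p @ v # q @ w # ys) = map g p @ [g v] @ map g q @ [2] @ map g ys"
    and "degs G (p @ v # q @ ys) = map g p @ [Suc (g v)] @ map g q @ map g ys"
proof -
  note s = splitsD[OF sp]
  let ?h = "p @ v # q @ w # ys" and ?g = "p @ v # q @ ys"
  have "before ?h w = set (p @ v # q)" using d by (auto simp: before_append before_Cons)
  then have "back_nbrs H ?h w = {u, v}" using s(11) u by (auto simp: back_nbrs_def)
  then have "g w = 2" using s(4) by (simp add: g_def)
  then show "degs H ?h = map g p @ [g v] @ map g q @ [2] @ map g ys"
    by (simp add: degs_def g_def)
  have bv: "before ?h v = set p" "before ?g v = set p" using d by (auto simp: before_append before_Cons)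
  then have "back_nbrs G ?g v = insert u (back_nbrs H ?h v)" "u \<notin> back_nbrs H ?h v"
    using s(3,5,12) u d by (auto simp: back_nbrs_def)
  then have 1: "card (back_nbrs G ?g v) = Suc (g v)" by (simp add: g_def)
  have 2: "card (back_nbrs G ?g x) = g x" if x: "x \<in> set ?g" "x \<noteq> v" for x
  proof -
    have nw: "x \<noteq> w" using x d by auto
    have sub: "before ?g x \<subseteq> set ?g - {x}" by (rule before_subset)
    have b: "before ?h x - {w} = before ?g x" using x d before_subset[of ys x] before_subset[of q x] before_subset[of p x]
      by (auto simp: before_append before_Cons)
    have uvx: "v \<notin> before ?h x" "w \<notin> before ?h x" if "x = u"
      using that u d s(5) before_subset[of p u] by (auto simp: before_append)
    have "back_nbrs G ?g x = back_nbrs H ?h x"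
    proof (cases "x = u")
      case True
      then have eq: "before ?h x = before ?g x" using b uvx by auto
      have "(u, y) \<in> parcs H \<longleftrightarrow> (u, y) \<in> parcs G" if "y \<in> before ?g x" for y
        using that uvx[OF True] eq by (intro s(16)) metis+
      then show ?thesis using True eq by (auto simp: back_nbrs_def)
    next
      case False
      then have "(x, y) \<in> parcs H \<longleftrightarrow> (x, y) \<in> parcs G" for y using s(15) x(2) nw by auto
      then show ?thesis using b s(14)[of x] by (auto simp: back_nbrs_def)
    qed
    then show ?thesis by (simp add: g_def)
  qed
  have "v \<notin> set p" "v \<notin> set q" "v \<notin> set ys" using d by auto
  then show "degs G ?g = map g p @ [Suc (g v)] @ map g q @ map g ys"
    using 1 2 by (auto simp: degs_def)
qed

lemma block_split_aux:
  assumes sp: "splits G H u v w" and b: "block G (xs @ ys)" and uv: "u \<in> set xs" "v \<in> set ys" "w \<notin> set (xs @ ys)"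
  shows "\<exists>c. block H c \<and> set c = insert w (set (xs @ ys)) \<and> profile (degs H c) = profile (degs G (xs @ ys))"
proof -
  let ?c = "xs @ w # ys"
  let ?f = "\<lambda>x. card (back_nbrs G (xs @ ys) x)"
  have d: "distinct (xs @ ys)" using b by (simp add: block_def)
  have dc: "degs H ?c = map ?f xs @ 1 # map ?f ys" by (rule degs_between[OF sp d uv(3,1,2)])
  have ne: "xs \<noteq> []" "ys \<noteq> []" using uv by auto
  have dg: "degs G (xs @ ys) = map ?f xs @ map ?f ys" by (simp add: degs_def)
  have "block H ?c" using b d uv(3) dc dg ne unfolding block_degs by (cases xs) auto
  moreover have "profile (degs H ?c) = profile (degs G (xs @ ys))"
    unfolding dc dg using ne by (intro profile_insert_one) auto
  ultimately show ?thesis by (intro exI[of _ ?c]) auto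
qed

text \<open>The new vertex is placed between the two ends. There it is neither first nor last, so
  its back degree 1 does not show in the profile.\<close>

lemma block_split:
  assumes sp: "splits G H u v w" and b: "block G b" and uv: "u \<in> set b" "v \<in> set b" "w \<notin> set b"
  shows "\<exists>c. block H c \<and> set c = insert w (set b) \<and> profile (degs H c) = profile (degs G b)"
proof -
  obtain xs ys where b': "b = xs @ v # ys" using uv(2) split_list by metis
  show ?thesis
  proof (cases "u \<in> set xs")
    case True
    then show ?thesis using block_split_aux[OF sp, of xs "v # ys"] b b' uv by auto
  next
    case False
    then have "u \<in> set ys" using uv(1) b' splitsD(4)[OF sp] by auto
    then show ?thesis using block_split_aux[OF splits_sym[OF sp], of "xs @ [v]" ys] b b' uv by auto
  qed
qed

lemma block_merge_first:
  assumes sp: "splits G H u v w" and b: "block H (w # u # zs)" and v: "v \<in> set zs"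
  shows "block G (u # zs) \<and> profile (degs G (u # zs)) = profile (degs H (w # u # zs))"
proof -
  have d: "distinct (u # zs)" "w \<notin> set (u # zs)" using b by (auto simp: block_def)
  have H: "degs H (w # u # zs) = 0 # 1 # map (\<lambda>x. card (back_nbrs G (u # zs) x)) zs"
    by (rule degs_first[OF sp d v])
  have G: "degs G (u # zs) = 0 # map (\<lambda>x. card (back_nbrs G (u # zs) x)) zs"
    by (simp add: degs_def) (simp add: back_nbrs_def before_Cons)
  have "zs \<noteq> []" using v by auto
  then have "profile (degs H (w # u # zs)) = profile (degs G (u # zs))"
    unfolding H G
    using profile_insert_one[of "[0]" "map (\<lambda>x. card (back_nbrs G (u # zs) x)) zs"] by simp
  then show ?thesis using b d unfolding block_degs H G by auto
qed

lemma block_merge_last: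
  assumes sp: "splits G H u v w" and b: "block H (p @ v # q @ w # ys)" and u: "u \<in> set p"
  shows "block G (p @ v # q @ ys) \<and>
    (profile (degs G (p @ v # q @ ys)) = profile (degs H (p @ v # q @ w # ys)) \<or>
     mu (profile (degs G (p @ v # q @ ys))) < mu (profile (degs H (p @ v # q @ w # ys))))"
proof -
  have d: "distinct (p @ v # q @ ys)" "w \<notin> set (p @ v # q @ ys)" using b by (auto simp: block_def)
  define g where "g x = card (back_nbrs H (p @ v # q @ w # ys) x)" for x
  have H: "degs H (p @ v # q @ w # ys) = map g p @ [g v] @ map g q @ [2] @ map g ys"
    unfolding g_def by (rule degs_last(1)[OF sp d u])
  have G: "degs G (p @ v # q @ ys) = map g p @ [Suc (g v)] @ map g q @ map g ys"
    unfolding g_def by (rule degs_last(2)[OF sp d u])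
  have p: "p \<noteq> []" using u by auto
  then have "1 \<le> g v" using b unfolding block_degs H by (cases p) auto
  then have "profile (degs G (p @ v # q @ ys)) = profile (degs H (p @ v # q @ w # ys)) \<or>
     mu (profile (degs G (p @ v # q @ ys))) < mu (profile (degs H (p @ v # q @ w # ys)))"
    unfolding H G using p by (intro mu_merge) auto
  moreover have "block G (p @ v # q @ ys)"
    using b d p unfolding block_degs H G by (cases p) auto
  ultimately show ?thesis by blast
qed

text \<open>Only the place of \<open>w\<close> matters: before or between its neighbours, its
  removal keeps the profile; behind both, \<open>mu_merge\<close> applies.\<close>

lemma block_merge:
  assumes sp: "splits G H u v w" and c: "block H c" and uvw: "u \<in> set c" "v \<in> set c" "w \<in> set c"
  shows "\<exists>b. block G b \<and> set c = insert w (set b) \<and> w \<notin> set b \<and>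
    (profile (degs G b) = profile (degs H c) \<or> mu (profile (degs G b)) < mu (profile (degs H c)))"
proof -
  obtain xs ys where xy: "c = xs @ w # ys" using uvw(3) split_list by metis
  have d: "distinct (xs @ ys)" "w \<notin> set (xs @ ys)" using c xy by (auto simp: block_def)
  note s = splitsD[OF sp]
  have between: ?thesis if sp': "splits G H u' v' w" and uv': "u' \<in> set xs" "v' \<in> set ys" for u' v'
  proof -
    let ?f = "\<lambda>x. card (back_nbrs G (xs @ ys) x)"
    have dc: "degs H c = map ?f xs @ 1 # map ?f ys"
      unfolding xy by (rule degs_between[OF sp' d uv'])
    have ne: "xs \<noteq> []" "ys \<noteq> []" using uv' by auto
    have dg: "degs G (xs @ ys) = map ?f xs @ map ?f ys" by (simp add: degs_def)
    have "block G (xs @ ys)" using c d dc dg ne unfolding block_degs by (cases xs) auto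
    moreover have "profile (degs G (xs @ ys)) = profile (degs H c)"
      unfolding dc dg using ne by (intro profile_insert_one[symmetric]) auto
    ultimately show ?thesis using xy d by (intro exI[of _ "xs @ ys"]) auto
  qed
  have last: ?thesis if sp': "splits G H u' v' w" and p: "xs = p @ v' # q" "u' \<in> set p" for u' v' p q
    using block_merge_last[OF sp', of p q ys] c xy p d by (intro exI[of _ "xs @ ys"]) auto
  consider "u \<in> set xs" "v \<in> set ys" | "v \<in> set xs" "u \<in> set ys" | "u \<in> set xs" "v \<in> set xs"
    | "u \<in> set ys" "v \<in> set ys"
    using uvw xy s(5,6) by auto
  then show ?thesis
  proof cases
    case 1
    then show ?thesis using between[OF sp] by auto
  next
    case 2
    then show ?thesis using between[OF splits_sym[OF sp]] by auto
  next
    case 3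
    then obtain p q where p: "xs = p @ v # q" using split_list by metis
    show ?thesis
    proof (cases "u \<in> set p")
      case True
      then show ?thesis using last[OF sp p] by auto
    next
      case False
      then have "u \<in> set q" using 3 p s(4) by auto
      then obtain q1 q2 where "q = q1 @ u # q2" using split_list by metis
      then show ?thesis using last[OF splits_sym[OF sp], of "p @ v # q1" q2] p by auto
    qed
  next
    case 4
    \<comment> \<open>A vertex that is not first needs an earlier neighbour, but both neighbours of
      \<open>w\<close> come later. For the same reason the second vertex must be adjacent to
      \<open>w\<close>.\<close>
    have "xs = []"
    proof (rule ccontr)
      assume "xs \<noteq> []"
      then have "back_nbrs H c w \<noteq> {}" using c xy by (auto simp: block_def)
      then have "u \<in> before c w \<or> v \<in> before c w" using s(11) by (auto simp: back_nbrs_def)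
      moreover have "before c w = set xs" using xy d by (auto simp: before_append before_Cons)
      ultimately show False using 4 d by auto
    qed
    obtain y zs where ys: "ys = y # zs" using 4 by (cases ys) auto
    have "back_nbrs H c y \<noteq> {}" using c xy \<open>xs = []\<close> ys by (auto simp: block_def)
    then have "(y, w) \<in> parcs H" using xy \<open>xs = []\<close> ys d by (auto simp: back_nbrs_def before_Cons)
    then have "y = u \<or> y = v" using s(11) pair_graphD(4)[OF pair_graph_splits[OF sp]] by auto
    then show ?thesis
    proof
      assume "y = u"
      then show ?thesis
        using block_merge_first[OF sp, of zs] c xy \<open>xs = []\<close> ys 4 s(4) d by (intro exI[of _ ys]) auto
    next
      assume "y = v"
      then show ?thesis
        using block_merge_first[OF splits_sym[OF sp], of zs] c xy \<open>xs = []\<close> ys 4 s(4) d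
        by (intro exI[of _ ys]) auto
    qed
  qed
qed

section \<open>Decomposition of a graph into ordered components\<close>

definition blocks :: "'a pair_pre_digraph \<Rightarrow> 'a list list \<Rightarrow> bool" where
  "blocks G bs \<longleftrightarrow> distinct (concat bs) \<and> set (concat bs) = pverts G \<and> (\<forall>b\<in>set bs. block G b) \<and>
     (\<forall>x y. (x, y) \<in> parcs G \<longrightarrow> (\<exists>b\<in>set bs. x \<in> set b \<and> y \<in> set b))"

lemma distinct_concat_unique:
  assumes "distinct (concat bs)" "b \<in> set bs" "c \<in> set bs" "x \<in> set b" "x \<in> set c"
  shows "b = c"
  using assms by (induction bs) auto

lemma blocks_arcD: "blocks G bs \<Longrightarrow> (x, y) \<in> parcs G \<Longrightarrow> \<exists>b\<in>set bs. x \<in> set b \<and> y \<in> set b"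
  by (simp add: blocks_def)

lemma blocks_vertD: "blocks G bs \<Longrightarrow> x \<in> pverts G \<Longrightarrow> \<exists>b\<in>set bs. x \<in> set b"
  by (metis UN_E blocks_def set_concat)

lemma blocks_closed:
  assumes "blocks G bs" "b \<in> set bs" "v \<in> set b" "(v, u) \<in> parcs G"
  shows "u \<in> set b"
proof -
  obtain c where "c \<in> set bs" "v \<in> set c" "u \<in> set c" using blocks_arcD assms by metis
  then show ?thesis using distinct_concat_unique[of bs b c v] assms by (auto simp: blocks_def)
qed

lemma ex_max_nat:
  assumes "P k" "\<And>y. P y \<Longrightarrow> f y \<le> (b :: nat)"
  shows "\<exists>x. P x \<and> (\<forall>y. P y \<longrightarrow> f y \<le> f x)"
proof -
  define n where "n = Max (f ` Collect P)"
  have fin: "finite (f ` Collect P)" using assms(2) by (auto intro!: finite_subset[of _ "{..b}"])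
  then have "n \<in> f ` Collect P" unfolding n_def using assms(1) by (intro Max_in) auto
  moreover have "f y \<le> n" if "P y" for y unfolding n_def using fin that by (intro Max_ge) auto
  ultimately show ?thesis by auto
qed

text \<open>A longest block through \<open>x\<close> is closed, since a neighbour outside it could
  be appended.\<close>

lemma closed_block_exists:
  assumes G: "pair_graph G" and x: "x \<in> pverts G"
  shows "\<exists>b. block G b \<and> x \<in> set b \<and> set b \<subseteq> pverts G \<and> (\<forall>v\<in>set b. \<forall>u. (v, u) \<in> parcs G \<longrightarrow> u \<in> set b)"
proof -
  let ?P = "\<lambda>b. block G b \<and> x \<in> set b \<and> set b \<subseteq> pverts G"
  have "\<exists>b. ?P b \<and> (\<forall>c. ?P c \<longrightarrow> length c \<le> length b)"
  proof (rule ex_max_nat)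
    show "?P [x]" using x by (simp add: block_def)
    show "length c \<le> card (pverts G)" if "?P c" for c
    proof -
      have "card (set c) \<le> card (pverts G)" using that pair_graphD(1)[OF G] by (intro card_mono) auto
      then show ?thesis using that by (simp add: block_def distinct_card)
    qed
  qed
  then obtain b where b: "?P b" and max: "\<And>c. ?P c \<Longrightarrow> length c \<le> length b" by blast
  have "u \<in> set b" if v: "v \<in> set b" and vu: "(v, u) \<in> parcs G" for v u
  proof (rule ccontr)
    assume u: "u \<notin> set b"
    have "b \<noteq> []" using b by (auto simp: block_def)
    then have "block G (b @ [u])" using b u v pair_graphD(4)[OF G vu] by (auto simp: block_snoc)
    then show False using max[of "b @ [u]"] b pair_graphD(3)[OF G vu] by auto
  qed
  then show ?thesis using b by blast
qed

text \<open>Again by maximality: an uncovered vertex lies in a closed block, which is disjoint from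
  the others because a common vertex would make it reachable from a covered one.\<close>

lemma blocks_exist:
  assumes G: "pair_graph G"
  shows "\<exists>bs. blocks G bs"
proof -
  let ?P = "\<lambda>bs. distinct (concat bs) \<and> set (concat bs) \<subseteq> pverts G \<and> (\<forall>b\<in>set bs. block G b \<and>
    (\<forall>v\<in>set b. \<forall>u. (v, u) \<in> parcs G \<longrightarrow> u \<in> set b))"
  have "\<exists>bs. ?P bs \<and> (\<forall>cs. ?P cs \<longrightarrow> length (concat cs) \<le> length (concat bs))"
  proof (rule ex_max_nat)
    show "?P []" by simp
    show "length (concat cs) \<le> card (pverts G)" if "?P cs" for cs
    proof -
      have "card (set (concat cs)) \<le> card (pverts G)"
        using that pair_graphD(1)[OF G] by (intro card_mono) auto
      then show ?thesis using that by (metis distinct_card)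
    qed
  qed
  then obtain bs where bs: "?P bs" and max: "\<And>cs. ?P cs \<Longrightarrow> length (concat cs) \<le> length (concat bs)"
    by blast
  have reach: "y \<in> set b" if "(x, y) \<in> (parcs G)\<^sup>*" "x \<in> set b" "b \<in> set bs" for x y b
    using that(1) by induction (use that bs in auto)
  have "x \<in> set (concat bs)" if x: "x \<in> pverts G" for x
  proof (rule ccontr)
    assume nx: "x \<notin> set (concat bs)"
    obtain c where c: "block G c" "x \<in> set c" "set c \<subseteq> pverts G"
        "\<forall>v\<in>set c. \<forall>u. (v, u) \<in> parcs G \<longrightarrow> u \<in> set c"
      using closed_block_exists[OF G x] by blast
    have "set c \<inter> set b = {}" if "b \<in> set bs" for b
    proof (rule ccontr)
      assume "set c \<inter> set b \<noteq> {}"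
      then obtain y where "y \<in> set c" "y \<in> set b" by auto
      then have "x \<in> set b" using reach[of y x b] block_reach[OF G c(1), of y x] c that by auto
      then show False using nx that by auto
    qed
    then have "?P (c # bs)" using bs c by (auto simp: block_def)
    then show False using max[of "c # bs"] c by auto
  qed
  then have V: "set (concat bs) = pverts G" using bs by blast
  have "\<exists>b\<in>set bs. x \<in> set b \<and> y \<in> set b" if "(x, y) \<in> parcs G" for x y
  proof -
    have "x \<in> set (concat bs)" using V pair_graphD(2)[OF G that] by blast
    then obtain b where "b \<in> set bs" "x \<in> set b" by auto
    then show ?thesis using bs that by blast
  qed
  then show ?thesis using bs V by (intro exI[of _ bs]) (auto simp: blocks_def)
qed

text \<open>The other blocks contain none of \<open>u\<close>, \<open>v\<close> and
  \<open>w\<close>, so both graphs have the same arcs at their vertices.\<close>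

lemma blocks_replace:
  assumes sp: "splits G H u v w" and uv: "u \<in> set b" "v \<in> set b" "w \<notin> set b"
    and c: "set c = insert w (set b)" and bc: "block G b" "block H c"
  shows "blocks G (B1 @ b # B2) \<Longrightarrow> blocks H (B1 @ c # B2)"
    and "blocks H (B1 @ c # B2) \<Longrightarrow> blocks G (B1 @ b # B2)"
    and "blocks G (B1 @ b # B2) \<Longrightarrow> b' \<in> set B1 \<union> set B2 \<Longrightarrow> degs H b' = degs G b'"
proof -
  note s = splitsD[OF sp]
  have arcs: "(x, y) \<in> parcs H \<longleftrightarrow> (x, y) \<in> parcs G" if "x \<notin> set c" for x y
    using s(15)[of x y] that uv c by auto
  have HG: "parcs H = (parcs G - {(u, v), (v, u)}) \<union> {(u, w), (w, u), (w, v), (v, w)}"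
    using sp by (simp add: splits_def)
  have degs: "degs H b' = degs G b'" if "set b' \<inter> set c = {}" for b'
    using arcs that by (intro degs_cong) auto
  then have block: "block H b' \<longleftrightarrow> block G b'" if "set b' \<inter> set c = {}" for b'
    using that unfolding block_degs by simp
  let ?B = "set (concat (B1 @ B2))"
  \<comment> \<open>This separates the conditions on the exchanged block \<open>d\<close> from those
    on the blocks that stay.\<close>
  have eq: "blocks K (B1 @ d # B2) \<longleftrightarrow> (distinct (concat (B1 @ B2)) \<and> distinct d \<and> set d \<inter> ?B = {}) \<and>
      set d \<union> ?B = pverts K \<and> (block K d \<and> (\<forall>b'\<in>set (B1 @ B2). block K b')) \<and>
      (\<forall>x y. (x, y) \<in> parcs K \<longrightarrow> x \<in> set d \<and> y \<in> set d \<or> (\<exists>b\<in>set (B1 @ B2). x \<in> set b \<and> y \<in> set b))" for K d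
  proof -
    have 1: "distinct (concat (B1 @ d # B2)) \<longleftrightarrow> distinct (concat (B1 @ B2)) \<and> distinct d \<and> set d \<inter> ?B = {}"
      by (auto simp del: set_concat)
    have 2: "set (concat (B1 @ d # B2)) = set d \<union> ?B" by auto
    have 3: "(\<forall>b\<in>set (B1 @ d # B2). P b) \<longleftrightarrow> P d \<and> (\<forall>b\<in>set (B1 @ B2). P b)" for P by auto
    have 4: "(\<exists>b\<in>set (B1 @ d # B2). P b) \<longleftrightarrow> P d \<or> (\<exists>b\<in>set (B1 @ B2). P b)" for P by auto
    show ?thesis unfolding blocks_def 1 2 3 4 ..
  qed
  have bB: "set b' \<inter> set c = {}" if "set c \<inter> ?B = {}" "b' \<in> set (B1 @ B2)" for b'
  proof -
    have "set b' \<subseteq> ?B" using that(2) by auto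
    then show ?thesis using that(1) by (metis Int_commute inf.absorb_iff1 inf_assoc inf_bot_right)
  qed
  show 1: "blocks H (B1 @ c # B2)" if "blocks G (B1 @ b # B2)"
  proof -
    note all = that[unfolded eq]
    note g = all[THEN conjunct1, THEN conjunct1] all[THEN conjunct1, THEN conjunct2, THEN conjunct2]
      all[THEN conjunct2, THEN conjunct1] all[THEN conjunct2, THEN conjunct2, THEN conjunct1, THEN conjunct2]
      all[THEN conjunct2, THEN conjunct2, THEN conjunct2, rule_format]
    have "w \<notin> ?B" using g(3) s(9) by (metis UnI2)
    then have cB: "set c \<inter> ?B = {}" unfolding c using g(2) by (metis Int_insert_left_if0)
    moreover have "\<forall>b'\<in>set (B1 @ B2). block H b'" using g(4) block[OF bB[OF cB]] by simp
    moreover have "x \<in> set c \<and> y \<in> set c \<or> (\<exists>b\<in>set (B1 @ B2). x \<in> set b \<and> y \<in> set b)"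
      if "(x, y) \<in> parcs H" for x y
    proof (cases "(x, y) \<in> parcs G")
      case True
      then show ?thesis using g(5)[OF True] unfolding c by (elim disjE) simp_all
    next
      case False
      then show ?thesis using that uv unfolding HG c by auto
    qed
    moreover have "distinct c" using bc by (simp add: block_def)
    moreover have "set c \<union> ?B = pverts H" unfolding c s(10) g(3)[symmetric] by (rule Un_insert_left)
    ultimately show ?thesis using g(1) bc(2) unfolding eq by simp
  qed
  show "blocks G (B1 @ b # B2)" if "blocks H (B1 @ c # B2)"
  proof -
    note all = that[unfolded eq]
    note h = all[THEN conjunct1, THEN conjunct1] all[THEN conjunct1, THEN conjunct2, THEN conjunct2]
      all[THEN conjunct2, THEN conjunct1] all[THEN conjunct2, THEN conjunct2, THEN conjunct1, THEN conjunct2]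
      all[THEN conjunct2, THEN conjunct2, THEN conjunct2, rule_format]
    have "set b \<inter> ?B = {}" using h(2) unfolding c Int_insert_left by (simp split: if_splits)
    moreover have "\<forall>b'\<in>set (B1 @ B2). block G b'" using h(4) block[OF bB[OF h(2)]] by simp
    moreover have "x \<in> set b \<and> y \<in> set b \<or> (\<exists>b\<in>set (B1 @ B2). x \<in> set b \<and> y \<in> set b)"
      if xy: "(x, y) \<in> parcs G" for x y
    proof (cases "(x, y) \<in> parcs H")
      case True
      moreover have "x \<noteq> w" "y \<noteq> w" using xy s(13,14) by auto
      moreover have "x \<in> set c \<and> y \<in> set c \<or> (\<exists>b\<in>set (B1 @ B2). x \<in> set b \<and> y \<in> set b)"
        using h(5) True .
      ultimately show ?thesis unfolding c by (elim disjE) simp_all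
    next
      case False
      then show ?thesis using xy uv HG by auto
    qed
    moreover have "set b \<union> ?B = pverts G"
    proof -
      have "w \<notin> ?B" using h(2) unfolding c Int_insert_left by (simp split: if_splits)
      moreover have "insert w (set b) \<union> ?B = insert w (pverts G)" using h(3) s(10) c by simp
      ultimately show ?thesis using s(9) uv(3)
        by (metis Un_insert_left Diff_insert_absorb UnE)
    qed
    moreover have "distinct b" using bc by (simp add: block_def)
    ultimately show ?thesis using h(1) bc(1) unfolding eq by simp
  qed
  show "degs H b' = degs G b'" if "blocks G (B1 @ b # B2)" "b' \<in> set B1 \<union> set B2"
  proof (rule degs)
    have "set c \<inter> ?B = {}"
      using 1[OF that(1), unfolded eq] by (elim conjE)
    then show "set b' \<inter> set c = {}" using bB that(2) by auto
  qed
qed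

section \<open>Profiles of minimal weight\<close>

definition profiles :: "'a pair_pre_digraph \<Rightarrow> (bool \<times> nat list \<times> bool) list set" where
  "profiles G = {map (\<lambda>b. profile (degs G b)) bs |bs. blocks G bs}"

definition total_mu :: "(bool \<times> nat list \<times> bool) list \<Rightarrow> nat" where
  "total_mu ps = sum_list (map mu ps)"

lemma profiles_split_subset:
  assumes sp: "splits G H u v w"
  shows "profiles G \<subseteq> profiles H"
proof
  fix ps assume "ps \<in> profiles G"
  then obtain bs where bs: "blocks G bs" and ps: "ps = map (\<lambda>b. profile (degs G b)) bs"
    by (auto simp: profiles_def)
  note s = splitsD[OF sp]
  obtain b where b: "b \<in> set bs" "u \<in> set b" "v \<in> set b" using blocks_arcD[OF bs s(2)] by blast
  then obtain B1 B2 where B: "bs = B1 @ b # B2" using split_list by metis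
  have wb: "w \<notin> set b" using bs b s(9) by (auto simp: blocks_def)
  have blk: "block G b" using bs b by (auto simp: blocks_def)
  obtain c where c: "block H c" "set c = insert w (set b)" "profile (degs H c) = profile (degs G b)"
    using block_split[OF sp blk b(2,3) wb] by blast
  note r = blocks_replace[OF sp b(2,3) wb c(2) blk c(1), of B1 B2]
  have "blocks H (B1 @ c # B2)" using r(1) bs B by simp
  moreover have "map (\<lambda>b. profile (degs H b)) (B1 @ c # B2) = ps"
    using r(3) bs B c(3) by (simp add: ps)
  ultimately show "ps \<in> profiles H" unfolding profiles_def by (metis (mono_tags, lifting) mem_Collect_eq)
qed

lemma profiles_merge:
  assumes sp: "splits G H u v w" and ps: "ps \<in> profiles H"
  shows "\<exists>qs\<in>profiles G. qs = ps \<or> total_mu qs < total_mu ps"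
proof -
  obtain bs where bs: "blocks H bs" and ps: "ps = map (\<lambda>b. profile (degs H b)) bs"
    using ps by (auto simp: profiles_def)
  note s = splitsD[OF sp]
  have "(w, u) \<in> parcs H" "(w, v) \<in> parcs H" using s(11) by auto
  moreover obtain c where c: "c \<in> set bs" "w \<in> set c" using blocks_vertD[OF bs, of w] s(10) by auto
  ultimately have uv: "u \<in> set c" "v \<in> set c" using blocks_closed[OF bs c] by auto
  obtain B1 B2 where B: "bs = B1 @ c # B2" using c split_list by metis
  have blk: "block H c" using bs c by (auto simp: blocks_def)
  obtain b where b: "block G b" "set c = insert w (set b)" "w \<notin> set b"
      "profile (degs G b) = profile (degs H c) \<or> mu (profile (degs G b)) < mu (profile (degs H c))"
    using block_merge[OF sp blk uv c(2)] by blast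
  have uvb: "u \<in> set b" "v \<in> set b" using uv b s(5,6) by auto
  note r = blocks_replace[OF sp uvb b(3,2,1) blk, of B1 B2]
  have G: "blocks G (B1 @ b # B2)" using r(2) bs B by simp
  let ?qs = "map (\<lambda>b. profile (degs G b)) (B1 @ b # B2)"
  have "ps = map (\<lambda>b. profile (degs G b)) B1 @ profile (degs H c) # map (\<lambda>b. profile (degs G b)) B2"
    using r(3)[OF G] B ps by simp
  then have "?qs = ps \<or> total_mu ?qs < total_mu ps" using b(4) by (auto simp: total_mu_def)
  then show ?thesis using G unfolding profiles_def by blast
qed

definition min_profiles :: "'a pair_pre_digraph \<Rightarrow> (bool \<times> nat list \<times> bool) list set" where
  "min_profiles G = {ps \<in> profiles G. \<forall>qs\<in>profiles G. total_mu ps \<le> total_mu qs}"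

text \<open>\<open>profiles G\<close> is contained in \<open>profiles H\<close>, and each member of
  \<open>profiles H\<close> lies in \<open>profiles G\<close> or strictly above a member of it. Two
  such sets have the same elements of least weight.\<close>

lemma min_profiles_splits:
  assumes sp: "splits G H u v w"
  shows "min_profiles G = min_profiles H"
proof -
  have sub: "profiles G \<subseteq> profiles H" by (rule profiles_split_subset[OF sp])
  have below: "\<exists>qs\<in>profiles G. total_mu qs \<le> total_mu ps" if "ps \<in> profiles H" for ps
  proof -
    from profiles_merge[OF sp that] obtain qs where "qs \<in> profiles G" "qs = ps \<or> total_mu qs < total_mu ps"
      by blast
    then show ?thesis by (intro bexI[of _ qs]) auto
  qed
  have "ps \<in> min_profiles H" if "ps \<in> min_profiles G" for ps
  proof -
    have "ps \<in> profiles G" and min: "\<And>qs. qs \<in> profiles G \<Longrightarrow> total_mu ps \<le> total_mu qs"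
      using that by (auto simp: min_profiles_def)
    moreover have "total_mu ps \<le> total_mu qs" if "qs \<in> profiles H" for qs
      using below[OF that] min order_trans by blast
    ultimately show ?thesis using sub by (auto simp: min_profiles_def)
  qed
  moreover have "ps \<in> min_profiles G" if "ps \<in> min_profiles H" for ps
  proof -
    have "ps \<in> profiles H" and min: "\<And>qs. qs \<in> profiles H \<Longrightarrow> total_mu ps \<le> total_mu qs"
      using that by (auto simp: min_profiles_def)
    then obtain qs where "qs \<in> profiles G" "qs = ps \<or> total_mu qs < total_mu ps"
      using profiles_merge[OF sp] by blast
    then have "ps \<in> profiles G" using min[of qs] sub by auto
    then show ?thesis using min sub by (auto simp: min_profiles_def)
  qed
  ultimately show ?thesis by blast
qed

lemma min_profiles_equivclp:
  assumes "equivclp subdivision_of G H"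
  shows "min_profiles G = min_profiles H"
  using assms
proof induction
  case (step y z)
  then have "min_profiles y = min_profiles z"
    using min_profiles_splits subdivision_of_splits by metis
  then show ?case using step by simp
qed simp

lemma common_profile:
  assumes "equivclp subdivision_of G H" "pair_graph G"
  shows "\<exists>bs cs. blocks G bs \<and> blocks H cs \<and>
    map (\<lambda>b. profile (degs G b)) bs = map (\<lambda>b. profile (degs H b)) cs"
proof -
  obtain bs where "blocks G bs" using blocks_exist[OF assms(2)] by blast
  then have "\<exists>ps. ps \<in> profiles G" by (auto simp: profiles_def)
  then obtain ps where "ps \<in> profiles G" "\<forall>qs. qs \<in> profiles G \<longrightarrow> total_mu ps \<le> total_mu qs"
    using ex_has_least_nat[of "\<lambda>ps. ps \<in> profiles G" _ total_mu] by blast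
  then have "ps \<in> min_profiles G" by (simp add: min_profiles_def)
  moreover from this have "ps \<in> min_profiles H" using min_profiles_equivclp[OF assms(1)] by simp
  ultimately show ?thesis by (auto simp: min_profiles_def profiles_def)
qed

section \<open>Isomorphisms and dimension\<close>

definition graph_iso :: "('a \<Rightarrow> 'b) \<Rightarrow> 'a pair_pre_digraph \<Rightarrow> 'b pair_pre_digraph \<Rightarrow> bool" where
  "graph_iso f G H \<longleftrightarrow> bij_betw f (pverts G) (pverts H) \<and>
     (\<forall>x\<in>pverts G. \<forall>y\<in>pverts G. (x, y) \<in> parcs G \<longleftrightarrow> (f x, f y) \<in> parcs H)"

lemma graph_iso_parcs:
  assumes "graph_iso f G H" "pair_graph G" "parcs H \<subseteq> pverts H \<times> pverts H"
  shows "parcs H = map_prod f f ` parcs G"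
proof (intro equalityI subsetI)
  fix e assume e: "e \<in> parcs H"
  then have "e \<in> f ` pverts G \<times> f ` pverts G"
    using assms(1,3) by (auto simp: graph_iso_def bij_betw_def)
  then obtain x y where xy: "x \<in> pverts G" "y \<in> pverts G" "e = (f x, f y)" by blast
  then have "(x, y) \<in> parcs G" using e assms(1) by (auto simp: graph_iso_def)
  then show "e \<in> map_prod f f ` parcs G" using xy by force
next
  fix e assume "e \<in> map_prod f f ` parcs G"
  then show "e \<in> parcs H" using assms(1,2) by (auto simp: graph_iso_def dest: pair_graphD)
qed

lemma graph_iso_inverse:
  assumes "graph_iso f G H"
  shows "graph_iso (the_inv_into (pverts G) f) H G"
proof -
  have inj: "inj_on f (pverts G)" and im: "f ` pverts G = pverts H"
    using assms by (auto simp: graph_iso_def bij_betw_def)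
  let ?g = "the_inv_into (pverts G) f"
  have "bij_betw ?g (pverts H) (pverts G)"
    using assms by (auto simp: graph_iso_def intro: bij_betw_the_inv_into)
  moreover have "?g y \<in> pverts G \<and> f (?g y) = y" if "y \<in> pverts H" for y
    using that inj im by (metis f_the_inv_into_f the_inv_into_into order_refl)
  ultimately show ?thesis using assms unfolding graph_iso_def by metis
qed

lemma digraph_isoI:
  assumes "graph_iso f G H" "pair_graph G" "parcs H \<subseteq> pverts H \<times> pverts H"
  shows "digraph_iso (with_proj G) (with_proj H)"
proof -
  interpret pair_graph G by fact
  let ?h = "\<lparr>iso_verts = f, iso_arcs = map_prod f f, iso_head = snd, iso_tail = fst\<rparr>"
  have inj: "inj_on f (pverts G)" and im: "pverts H = f ` pverts G"
    using assms(1) by (auto simp: graph_iso_def bij_betw_def)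
  have "inj_on (map_prod f f) (parcs G)"
  proof (rule inj_on_subset)
    show "inj_on (map_prod f f) (pverts G \<times> pverts G)" by (intro map_prod_inj_on inj)
    show "parcs G \<subseteq> pverts G \<times> pverts G" using assms(2) by (auto dest: pair_graphD)
  qed
  then have "pre_digraph.digraph_isomorphism (with_proj G) ?h"
    using inj wf_digraph_axioms by (auto simp: pre_digraph.digraph_isomorphism_def)
  moreover have "with_proj H = app_iso ?h (with_proj G)"
    using graph_iso_parcs[OF assms] im by (simp add: with_proj_def app_iso_def)
  ultimately show ?thesis unfolding digraph_iso_def by blast
qed

lemma digraph_isoD:
  assumes "digraph_iso (with_proj G) (with_proj H)" "pair_graph G"
  shows "pair_graph H" "\<exists>f. graph_iso f G H"
proof -
  obtain h where h: "pre_digraph.digraph_isomorphism (with_proj G) h" "with_proj H = app_iso h (with_proj G)"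
    using assms(1) by (auto simp: digraph_iso_def)
  let ?f = "iso_verts h"
  have V: "pverts H = ?f ` pverts G" and A: "parcs H = iso_arcs h ` parcs G"
    and th: "iso_tail h = fst" "iso_head h = snd"
    using h(2) by (simp_all add: with_proj_def app_iso_def)
  have inj: "inj_on ?f (pverts G)" and
    arc: "\<And>a. a \<in> parcs G \<Longrightarrow> ?f (fst a) = fst (iso_arcs h a) \<and> ?f (snd a) = snd (iso_arcs h a)"
    using h(1) th by (auto simp: pre_digraph.digraph_isomorphism_def)
  have "iso_arcs h a = map_prod ?f ?f a" if "a \<in> parcs G" for a
    using arc[OF that] by (cases a; cases "iso_arcs h a") auto
  then have A': "parcs H = map_prod ?f ?f ` parcs G" unfolding A by (intro image_cong) auto
  have "(x, y) \<in> parcs G \<longleftrightarrow> (?f x, ?f y) \<in> parcs H" if "x \<in> pverts G" "y \<in> pverts G" for x y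
  proof
    assume "(?f x, ?f y) \<in> parcs H"
    then obtain x' y' where "(x', y') \<in> parcs G" "?f x = ?f x'" "?f y = ?f y'" using A' by auto
    then show "(x, y) \<in> parcs G"
      using inj that assms(2) by (metis inj_onD pair_graphD(2,3))
  qed (use A' in force)
  then have iso: "graph_iso ?f G H" using inj V by (auto simp: graph_iso_def bij_betw_def)
  then show "\<exists>f. graph_iso f G H" by blast
  have "(?f x, ?f x) \<notin> parcs H" if "x \<in> pverts G" for x
    using iso that assms(2) by (metis graph_iso_def pair_graphD(5))
  moreover have "y \<in> ?f ` pverts G" if "(y, y) \<in> parcs H" for y
    using that A' assms(2) by (auto dest: pair_graphD)
  ultimately have "(y, y) \<notin> parcs H" for y by blast
  then show "pair_graph H"
    using V A' assms(2) by (fastforce simp: pair_graph_iff)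
qed

lemma ex_nat_copy:
  assumes G: "pair_graph G"
  shows "\<exists>(H :: nat pair_pre_digraph) f. pair_graph H \<and> graph_iso f G H"
proof -
  obtain f :: "'a \<Rightarrow> nat" where f: "inj_on f (pverts G)"
    using finite_imp_inj_to_nat_seg[OF pair_graphD(1)[OF G]] by auto
  let ?H = "\<lparr>pverts = f ` pverts G, parcs = map_prod f f ` parcs G\<rparr>"
  have arc: "(x, y) \<in> parcs G \<longleftrightarrow> (f x, f y) \<in> parcs ?H" if "x \<in> pverts G" "y \<in> pverts G" for x y
  proof
    assume "(f x, f y) \<in> parcs ?H"
    then obtain x' y' where "(x', y') \<in> parcs G" "f x = f x'" "f y = f y'" by auto
    then show "(x, y) \<in> parcs G" using f that G by (metis inj_onD pair_graphD(2,3))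
  qed force
  then have iso: "graph_iso f G ?H" using f by (auto simp: graph_iso_def bij_betw_def)
  moreover have "digraph_iso (with_proj G) (with_proj ?H)"
    using G by (intro digraph_isoI[OF iso]) (auto dest: pair_graphD)
  then have "pair_graph ?H" using G digraph_isoD(1) by blast
  ultimately show ?thesis by blast
qed

lemma back_nbrs_iso:
  assumes iso: "graph_iso f G H" and xs: "set xs \<subseteq> pverts G" "v \<in> set xs"
  shows "back_nbrs H (map f xs) (f v) = f ` back_nbrs G xs v"
proof -
  have inj: "inj_on f (pverts G)" using iso by (auto simp: graph_iso_def bij_betw_def)
  have "takeWhile (\<lambda>y. y \<noteq> f v) (map f xs) = map f (takeWhile (\<lambda>y. y \<noteq> v) xs)"
    unfolding takeWhile_map using xs inj
    by (intro arg_cong[where f = "map f"] takeWhile_cong) (auto dest: inj_onD)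
  then have "before (map f xs) (f v) = f ` before xs v" by (simp add: before_def)
  moreover have "(f v, f u) \<in> parcs H \<longleftrightarrow> (v, u) \<in> parcs G" if "u \<in> before xs v" for u
    using iso xs that before_subset[of xs v] by (auto simp: graph_iso_def)
  ultimately show ?thesis by (auto simp: back_nbrs_def)
qed

lemma card_back_nbrs_iso:
  assumes iso: "graph_iso f G H" and xs: "set xs \<subseteq> pverts G" "v \<in> set xs"
  shows "card (back_nbrs H (map f xs) (f v)) = card (back_nbrs G xs v)"
proof -
  have "back_nbrs G xs v \<subseteq> pverts G" using before_subset[of xs v] xs(1) by (auto simp: back_nbrs_def)
  then have "inj_on f (back_nbrs G xs v)"
    using iso inj_on_subset unfolding graph_iso_def bij_betw_def by blast
  then show ?thesis by (simp add: back_nbrs_iso[OF assms] card_image)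
qed

lemma degs_iso:
  "graph_iso f G H \<Longrightarrow> set xs \<subseteq> pverts G \<Longrightarrow> degs H (map f xs) = degs G xs"
  by (simp add: degs_def card_back_nbrs_iso)

lemma blocks_iso:
  assumes iso: "graph_iso f G H" and arcs: "parcs H \<subseteq> pverts H \<times> pverts H" and bs: "blocks G bs"
  shows "blocks H (map (map f) bs)" "map (\<lambda>b. profile (degs H b)) (map (map f) bs) = map (\<lambda>b. profile (degs G b)) bs"
    "map (betti H) (map (map f) bs) = map (betti G) bs"
proof -
  have inj: "inj_on f (pverts G)" and im: "f ` pverts G = pverts H"
    using iso by (auto simp: graph_iso_def bij_betw_def)
  have V: "set (concat bs) = pverts G" and d: "distinct (concat bs)" and b: "\<And>b. b \<in> set bs \<Longrightarrow> block G b"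
    using bs by (auto simp: blocks_def)
  have sub: "set b \<subseteq> pverts G" if "b \<in> set bs" for b using V that by auto
  have dg: "degs H (map f b) = degs G b" if "b \<in> set bs" for b using degs_iso[OF iso sub[OF that]] .
  then show "map (\<lambda>b. profile (degs H b)) (map (map f) bs) = map (\<lambda>b. profile (degs G b)) bs" by simp
  have inj_b: "inj_on f (set b)" if "b \<in> set bs" for b using inj sub[OF that] by (rule inj_on_subset)
  have "betti H (map f b) = betti G b" if "b \<in> set bs" for b
    using card_back_nbrs_iso[OF iso sub[OF that]] inj_b[OF that]
    by (simp add: betti_def sum.reindex)
  then show "map (betti H) (map (map f) bs) = map (betti G) bs" by simp
  have c: "concat (map (map f) bs) = map f (concat bs)" by (simp add: map_concat)
  have "distinct (concat (map (map f) bs))" unfolding c using d inj V by (simp add: distinct_map)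
  moreover have "set (concat (map (map f) bs)) = pverts H" unfolding c using V im by simp
  moreover have "block H (map f b)" if "b \<in> set bs" for b
    using b[OF that] dg[OF that] inj_b[OF that] by (simp add: block_degs distinct_map)
  moreover have "\<exists>b\<in>set (map (map f) bs). x \<in> set b \<and> y \<in> set b" if xy: "(x, y) \<in> parcs H" for x y
  proof -
    obtain x' y' where xy': "x' \<in> pverts G" "y' \<in> pverts G" "x = f x'" "y = f y'"
      using xy arcs im by blast
    then have "(x', y') \<in> parcs G" using xy iso by (auto simp: graph_iso_def)
    then obtain b where "b \<in> set bs" "x' \<in> set b" "y' \<in> set b" using blocks_arcD[OF bs] by blast
    then show ?thesis using xy' by auto
  qed
  ultimately show "blocks H (map (map f) bs)" unfolding blocks_def by (auto simp del: set_concat)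
qed

lemma contractible_iso:
  assumes "nat_contractible H" "graph_iso f G H" "pair_graph G" "pair_graph H"
  shows "contractible G"
  using digraph_isoI[OF assms(2,3)] assms(1,4) by (auto simp: contractible_def pair_graph_iff)

text \<open>\<open>contractible\<close> refers to a copy on natural numbers, so list and parent
  function are carried over by an injection.\<close>

lemma contractible_tree_of:
  assumes p: "parent_fun xs p"
  shows "contractible (tree_of xs p)"
proof -
  obtain f :: "'a \<Rightarrow> nat" where f: "inj_on f (set xs)"
    using finite_imp_inj_to_nat_seg[of "set xs"] by auto
  let ?g = "the_inv_into (set xs) f"
  let ?q = "\<lambda>y. f (p (?g y))"
  have g: "?g (f x) = x" if "x \<in> set xs" for x using f that by (rule the_inv_into_f_f)
  have tl: "set (tl xs) \<subseteq> set xs" using p by (cases xs) (auto simp: parent_fun_def)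
  have px: "p x \<in> set xs" if "x \<in> set (tl xs)" for x
    using p that before_subset[of xs x] by (auto simp: parent_fun_def)
  have bf: "before (map f xs) (f x) = f ` before xs x" if "x \<in> set xs" for x
  proof -
    have "takeWhile (\<lambda>y. y \<noteq> f x) (map f xs) = map f (takeWhile (\<lambda>y. y \<noteq> x) xs)"
      unfolding takeWhile_map using that f
      by (intro arg_cong[where f = "map f"] takeWhile_cong) (auto dest: inj_onD)
    then show ?thesis by (simp add: before_def)
  qed
  have q: "parent_fun (map f xs) ?q"
    using p f tl unfolding parent_fun_def
    by (auto simp: distinct_map map_tl[symmetric] bf g subset_iff)
  have arcs: "parcs (tree_of (map f xs) ?q) = map_prod f f ` parcs (tree_of xs p)"
  proof -
    have "parcs (tree_of (map f xs) ?q) = (\<Union>x\<in>set (tl xs). {(f x, f (p x)), (f (p x), f x)})"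
      using g tl by (simp add: map_tl[symmetric] subset_iff)
    then show ?thesis by (simp add: image_UN)
  qed
  have T: "pair_graph (tree_of xs p)" using p by (rule pair_graph_tree_of)
  have "(x, y) \<in> parcs (tree_of xs p) \<longleftrightarrow> (f x, f y) \<in> parcs (tree_of (map f xs) ?q)"
    if "x \<in> set xs" "y \<in> set xs" for x y
  proof
    assume "(f x, f y) \<in> parcs (tree_of (map f xs) ?q)"
    then obtain x' y' where "(x', y') \<in> parcs (tree_of xs p)" "f x = f x'" "f y = f y'"
      unfolding arcs by auto
    then show "(x, y) \<in> parcs (tree_of xs p)"
      using f that pair_graphD(2,3)[OF T] by (metis inj_onD tree_of_simps(1))
  next
    assume "(x, y) \<in> parcs (tree_of xs p)"
    then show "(f x, f y) \<in> parcs (tree_of (map f xs) ?q)" unfolding arcs by force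
  qed
  then have "graph_iso f (tree_of xs p) (tree_of (map f xs) ?q)"
    using f by (auto simp: graph_iso_def bij_betw_def)
  then show ?thesis
    using contractible_iso nat_contractible_tree_of[OF q] pair_graph_tree_of[OF q] T by blast
qed

section \<open>Dimension of triangle-free graphs\<close>

definition triangle_free :: "'a pair_pre_digraph \<Rightarrow> bool" where
  "triangle_free G \<longleftrightarrow> (\<forall>x y z. (x, y) \<in> parcs G \<longrightarrow> (x, z) \<in> parcs G \<longrightarrow> (y, z) \<notin> parcs G)"

lemma K3_free_triangle_free:
  assumes G: "pair_graph G" and free: "K3_free G"
  shows "triangle_free G"
  unfolding triangle_free_def
proof (intro allI impI notI)
  fix x y z assume xyz: "(x, y) \<in> parcs G" "(x, z) \<in> parcs G" "(y, z) \<in> parcs G"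
  let ?K = "\<lparr>pverts = {x, y, z}, parcs = {x, y, z} \<times> {x, y, z} - Id\<rparr>"
  have d: "x \<noteq> y" "x \<noteq> z" "y \<noteq> z" using xyz G by (auto dest: pair_graphD)
  have K: "pair_graph ?K" by (auto simp: pair_graph_iff)
  have "complete_digraph 3 (with_proj ?K)"
    unfolding complete_digraph_pair_def using d by auto
  moreover have "subgraph (with_proj ?K) (with_proj G)"
  proof -
    interpret G: pair_graph G by fact
    interpret K: pair_graph ?K by fact
    show ?thesis
      using xyz pair_graphD[OF G] G.wf_digraph_axioms K.wf_digraph_axioms
      by (auto simp: subgraph_def compatible_def)
  qed
  ultimately show False using free by (auto simp: K3_free_def)
qed

lemma graph_dim_empty: "pair_graph A \<Longrightarrow> pverts A = {} \<Longrightarrow> graph_dim A = - 1"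
  by (subst graph_dim.simps) simp

lemma graph_dim_discrete:
  assumes "pair_graph A" "parcs A = {}" "pverts A \<noteq> {}"
  shows "graph_dim A = 0"
proof -
  have "graph_dim (sphere A x) = - 1" for x
    using assms by (intro graph_dim_empty) (auto simp: sphere_def pair_graph_iff)
  then show ?thesis using assms by (subst graph_dim.simps) simp
qed

text \<open>Unit spheres have dimension 0 or, if empty, -1; so a vertex contributes 1 or 0 to the
  average.\<close>

lemma graph_dim_triangle_free:
  assumes A: "pair_graph A" and tri: "triangle_free A" and ne: "pverts A \<noteq> {}"
  shows "graph_dim A = real (card {x \<in> pverts A. \<exists>y. (x, y) \<in> parcs A}) / real (card (pverts A))"
proof -
  have "1 + graph_dim (sphere A x) = of_bool (\<exists>y. (x, y) \<in> parcs A)" for x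
  proof -
    have S: "parcs (sphere A x) = {}" using tri by (auto simp: sphere_def triangle_free_def)
    have "pair_graph (sphere A x)"
      using A unfolding sphere_def by (intro pair_graph_generated) (auto dest: pair_graphD)
    moreover have "pverts (sphere A x) = {y. (x, y) \<in> parcs A}" by (simp add: sphere_def)
    ultimately show ?thesis
      using S graph_dim_empty[of "sphere A x"] graph_dim_discrete[of "sphere A x"]
      by (cases "\<exists>y. (x, y) \<in> parcs A") auto
  qed
  then have "(\<Sum>x\<in>pverts A. 1 + graph_dim (sphere A x)) = (\<Sum>x\<in>pverts A. of_bool (\<exists>y. (x, y) \<in> parcs A))"
    by simp
  also have "\<dots> = real (card {x \<in> pverts A. \<exists>y. (x, y) \<in> parcs A})"
    using pair_graphD(1)[OF A] by (simp add: sum_of_bool_eq Int_def)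
  finally show ?thesis using A ne by (subst graph_dim.simps) simp
qed

lemma graph_dim_1:
  assumes "pair_graph A" "triangle_free A" "pverts A \<noteq> {}" "\<And>x. x \<in> pverts A \<Longrightarrow> \<exists>y. (x, y) \<in> parcs A"
  shows "graph_dim A = 1"
proof -
  have "{x \<in> pverts A. \<exists>y. (x, y) \<in> parcs A} = pverts A" using assms(4) by auto
  then show ?thesis using graph_dim_triangle_free[OF assms(1-3)] assms(1,3) by (simp add: pair_graphD(1))
qed

lemma graph_dim_less_1:
  assumes "pair_graph A" "triangle_free A" "x \<in> pverts A" "\<And>y. (x, y) \<notin> parcs A"
  shows "graph_dim A < 1"
proof -
  have "{x \<in> pverts A. \<exists>y. (x, y) \<in> parcs A} \<subset> pverts A" using assms(3,4) by auto
  then have "card {x \<in> pverts A. \<exists>y. (x, y) \<in> parcs A} < card (pverts A)"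
    using pair_graphD(1)[OF assms(1)] by (rule psubset_card_mono[rotated])
  moreover have "pverts A \<noteq> {}" using assms(3) by auto
  ultimately show ?thesis unfolding graph_dim_triangle_free[OF assms(1,2) \<open>pverts A \<noteq> {}\<close>] by simp
qed

section \<open>The sub-base of an ordered graph\<close>

definition level :: "'a pair_pre_digraph \<Rightarrow> 'a list \<Rightarrow> 'a \<Rightarrow> bool" where
  "level G xs v \<longleftrightarrow> 2 \<le> card (back_nbrs G xs v)"

definition levels :: "'a pair_pre_digraph \<Rightarrow> 'a list \<Rightarrow> 'a list" where
  "levels G xs = filter (level G xs) xs"

definition par :: "'a pair_pre_digraph \<Rightarrow> 'a list \<Rightarrow> 'a \<Rightarrow> 'a" where
  "par G xs v = (SOME u. u \<in> back_nbrs G xs v)"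

text \<open>A list and not a set, so that a number \<open>t\<close> can name an additional back
  edge.\<close>

definition extra :: "'a pair_pre_digraph \<Rightarrow> 'a list \<Rightarrow> 'a \<Rightarrow> 'a list" where
  "extra G xs v = filter (\<lambda>u. u \<in> back_nbrs G xs v - {par G xs v}) xs"

definition point :: "'a \<Rightarrow> 'a pair_pre_digraph" where
  "point v = \<lparr>pverts = {v}, parcs = {}\<rparr>"

definition base_tree :: "'a pair_pre_digraph \<Rightarrow> 'a list \<Rightarrow> 'a pair_pre_digraph" where
  "base_tree G xs = tree_of xs (par G xs)"

definition extra_tree :: "'a pair_pre_digraph \<Rightarrow> 'a list \<Rightarrow> 'a \<Rightarrow> 'a \<Rightarrow> 'a pair_pre_digraph" where
  "extra_tree G xs v u = tree_of (takeWhile (\<lambda>y. y \<noteq> v) xs @ [v]) ((par G xs)(v := u))"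

text \<open>Sub-base elements carry an index \<open>(i, l, t)\<close>: \<open>i\<close> is the block, \<open>l < 2\<close> stands for one of
  the first two vertices, \<open>l = 2\<close> for the spanning tree of the block, and \<open>l = r + 3\<close> for the
  tree that ends with the \<open>t\<close>-th additional back edge of the \<open>r\<close>-th vertex of back degree at
  least 2. The index set depends on the profiles only.\<close>

type_synonym index = "nat \<times> nat \<times> nat"

definition elem :: "'a pair_pre_digraph \<Rightarrow> 'a list list \<Rightarrow> index \<Rightarrow> 'a pair_pre_digraph" where
  "elem G bs = (\<lambda>(i, l, t). let xs = bs ! i in
     if l < 2 then point (xs ! l) else if l = 2 then base_tree G xs
     else let v = levels G xs ! (l - 3) in extra_tree G xs v (extra G xs v ! t))"

text \<open>The bound on \<open>t\<close> is one less than the back degree because one back edge of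
  the vertex belongs to the spanning tree.\<close>

definition indices :: "(bool \<times> nat list \<times> bool) list \<Rightarrow> index set" where
  "indices ps = {(i, l, t). i < length ps \<and> (let ds = fst (snd (ps ! i)) in
     l < 2 \<and> t = 0 \<and> ds \<noteq> [] \<or> l = 2 \<and> t = 0 \<or> 3 \<le> l \<and> l - 3 < length ds \<and> t < ds ! (l - 3) - 1)}"

lemma before_antisym: "u \<in> before zs v \<Longrightarrow> v \<notin> before zs u"
  by (induction zs) (auto simp: before_Cons split: if_splits)

text \<open>Parents come earlier in the list, so an arc towards an earlier vertex is the parent arc
  of its source.\<close>

lemma tree_of_arc_to_before:
  assumes p: "parent_fun zs p" and u: "u \<in> before zs v" and arc: "(v, u) \<in> parcs (tree_of zs p)"
  shows "p v = u"
proof -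
  obtain x where x: "x \<in> set (tl zs)" "(v, u) = (x, p x) \<or> (v, u) = (p x, x)" using arc by auto
  then have "p x \<in> before zs x" using p by (simp add: parent_fun_def)
  then show ?thesis using x(2) before_antisym[OF u] by auto
qed

lemma tree_of_last_arc:
  assumes p: "parent_fun (ys @ [v]) p" and ys: "ys \<noteq> []" and arc: "(v, y) \<in> parcs (tree_of (ys @ [v]) p)"
  shows "y = p v"
proof -
  obtain x where x: "x \<in> set (tl (ys @ [v]))" "(v, y) = (x, p x) \<or> (v, y) = (p x, x)" using arc by auto
  have v: "v \<notin> set ys" "p v \<in> set ys" and q: "parent_fun ys p" using p ys by (auto simp: parent_fun_snoc)
  have "p x \<in> set ys"
  proof (cases "x = v")
    case False
    then have "p x \<in> before ys x" using x(1) q ys by (auto simp: parent_fun_def)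
    then show ?thesis using before_subset[of ys x] by auto
  qed (use v in simp)
  then show ?thesis using x(2) v by auto
qed

text \<open>In the first tree the leaf \<open>v\<close> has only the arc to \<open>u\<close>. In the
  second, where \<open>u\<close> is earlier than \<open>v\<close>, that arc could only be the parent
  arc of \<open>v\<close>, but \<open>q v\<close> is not \<open>u\<close>.\<close>

lemma isolated_in_inter:
  assumes "parent_fun (ys @ [v]) p" "ys \<noteq> []" "p v = u" "parent_fun zs q" "u \<in> before zs v" "q v \<noteq> u"
  shows "(v, y) \<notin> parcs (graph_inter (tree_of (ys @ [v]) p) (tree_of zs q))"
  using tree_of_last_arc[OF assms(1,2)] tree_of_arc_to_before[OF assms(4,5)] assms(3,6)
  by (auto simp: graph_inter_def simp del: tree_of_simps)

lemma tree_of_not_isolated: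
  assumes p: "parent_fun zs p" and len: "2 \<le> length zs" and x: "x \<in> set zs"
  shows "\<exists>y. (x, y) \<in> parcs (tree_of zs p)"
proof -
  obtain a b cs where zs: "zs = a # b # cs" using len by (cases zs; cases "tl zs") auto
  show ?thesis
  proof (cases "x = a")
    case True
    have "p b \<in> before zs b" using p zs by (auto simp: parent_fun_def)
    then have "p b = a" using p zs by (auto simp: before_Cons parent_fun_def split: if_splits)
    then have "(x, b) \<in> parcs (tree_of zs p)" using True zs by auto
    then show ?thesis by blast
  next
    case False
    then have "(x, p x) \<in> parcs (tree_of zs p)" using x zs by auto
    then show ?thesis by blast
  qed
qed

lemma filter_nth_split:
  assumes "r < length (filter P xs)"
  shows "\<exists>ys zs. xs = ys @ filter P xs ! r # zs \<and> P (filter P xs ! r) \<and> length (filter P ys) = r"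
  using assms
proof (induction xs arbitrary: r)
  case (Cons x xs)
  show ?case
  proof (cases "P x")
    case False
    then have "r < length (filter P xs)" using Cons.prems by simp
    from Cons.IH[OF this] obtain ys zs where "xs = ys @ filter P xs ! r # zs" "P (filter P xs ! r)"
      "length (filter P ys) = r" by blast
    then show ?thesis using False by (intro exI[of _ "x # ys"] exI[of _ zs]) auto
  next
    case True
    show ?thesis
    proof (cases r)
      case 0
      then show ?thesis using True by (intro exI[of _ "[]"] exI[of _ xs]) auto
    next
      case (Suc r')
      then have "r' < length (filter P xs)" using Cons.prems True by simp
      from Cons.IH[OF this] obtain ys zs where "xs = ys @ filter P xs ! r' # zs" "P (filter P xs ! r')"
        "length (filter P ys) = r'" by blast
      then show ?thesis using True Suc by (intro exI[of _ "x # ys"] exI[of _ zs]) auto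
    qed
  qed
qed simp

lemma par_in_back_nbrs:
  assumes "block G xs" "v \<in> set (tl xs)"
  shows "par G xs v \<in> back_nbrs G xs v"
  using assms unfolding par_def block_def by (metis some_in_eq)

lemma par_before:
  assumes "block G xs" "v \<in> set (tl xs)"
  shows "par G xs v \<in> before xs v" "(v, par G xs v) \<in> parcs G"
  using par_in_back_nbrs[OF assms] by (auto simp: back_nbrs_def)

lemma base_parent_fun: "block G xs \<Longrightarrow> parent_fun xs (par G xs)"
  using par_before[of G xs] by (auto simp: parent_fun_def block_def)

lemma takeWhile_split: "distinct (ys @ v # zs) \<Longrightarrow> takeWhile (\<lambda>y. y \<noteq> v) (ys @ v # zs) = ys"
  by (induction ys) auto

lemma before_split: "distinct (ys @ v # zs) \<Longrightarrow> before (ys @ v # zs) v = set ys"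
  by (simp only: before_def takeWhile_split)

lemma extra_parent_fun:
  assumes b: "block G xs" and xs: "xs = ys @ v # zs" and u: "u \<in> back_nbrs G xs v"
  shows "parent_fun (ys @ [v]) ((par G xs)(v := u))" "ys \<noteq> []" "u \<in> set ys" "(v, u) \<in> parcs G"
    "extra_tree G xs v u = tree_of (ys @ [v]) ((par G xs)(v := u))"
proof -
  have d: "distinct (ys @ v # zs)" using b xs by (simp add: block_def)
  show u': "u \<in> set ys" "(v, u) \<in> parcs G"
    using u before_split[OF d] xs by (auto simp: back_nbrs_def)
  then show ys: "ys \<noteq> []" by auto
  have "par G xs x \<in> before ys x" if "x \<in> set (tl ys)" for x
  proof -
    have "x \<in> set ys" using that ys by (cases ys) auto
    moreover have "par G xs x \<in> before xs x" using that b xs ys by (intro par_before) auto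
    ultimately show ?thesis using xs by (simp add: before_append)
  qed
  then have "parent_fun ys ((par G xs)(v := u))"
    using d ys by (cases ys) (auto simp: parent_fun_def)
  then show "parent_fun (ys @ [v]) ((par G xs)(v := u))"
    using ys u' d by (simp add: parent_fun_snoc)
  show "extra_tree G xs v u = tree_of (ys @ [v]) ((par G xs)(v := u))"
    unfolding extra_tree_def xs takeWhile_split[OF d] ..
qed

lemma set_extra:
  assumes "block G xs"
  shows "set (extra G xs v) = back_nbrs G xs v - {par G xs v}"
  using before_subset[of xs v] by (auto simp: extra_def back_nbrs_def)

lemma length_extra:
  assumes "block G xs" "v \<in> set (tl xs)"
  shows "length (extra G xs v) = card (back_nbrs G xs v) - 1"
proof -
  have "distinct (extra G xs v)" using assms by (simp add: extra_def block_def)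
  then have "length (extra G xs v) = card (back_nbrs G xs v - {par G xs v})"
    using set_extra[OF assms(1)] distinct_card by metis
  then show ?thesis using par_in_back_nbrs[OF assms] by simp
qed

text \<open>Back degree at least 2 requires two earlier vertices, hence the bound on
  \<open>ys\<close>. It follows that every extra tree contains the first two vertices of its
  block.\<close>

lemma level_split:
  assumes b: "block G xs" and r: "r < length (levels G xs)"
  shows "\<exists>ys zs. xs = ys @ levels G xs ! r # zs \<and> level G xs (levels G xs ! r) \<and>
    length (filter (level G xs) ys) = r \<and> 2 \<le> length ys"
proof -
  obtain ys zs where s: "xs = ys @ levels G xs ! r # zs" "level G xs (levels G xs ! r)"
      "length (filter (level G xs) ys) = r"
    using filter_nth_split[of r "level G xs" xs] r unfolding levels_def by blast
  have d: "distinct (ys @ levels G xs ! r # zs)" using b s(1) by (metis block_def)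
  have "back_nbrs G xs (levels G xs ! r) \<subseteq> set ys"
    using before_split[OF d] s(1) by (auto simp: back_nbrs_def)
  then have "card (back_nbrs G xs (levels G xs ! r)) \<le> card (set ys)" by (intro card_mono) auto
  also have "card (set ys) \<le> length ys" by (rule card_length)
  finally have "2 \<le> length ys" using s(2) unfolding level_def by linarith
  then show ?thesis using s by blast
qed

lemma distinct_concat_nth:
  assumes "distinct (concat bs)" "i < length bs" "j < length bs" "x \<in> set (bs ! i)" "x \<in> set (bs ! j)"
  shows "i = j"
  using assms
proof (induction bs arbitrary: i j)
  case (Cons b bs)
  then show ?case
    by (cases i; cases j) (auto simp: nth_mem disjoint_iff dest!: nth_mem)
qed simp

section \<open>Dimensions and intersections of the sub-base elements\<close>

locale ordered_graph =
  fixes G :: "'a pair_pre_digraph" and bs :: "'a list list"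
  assumes pair_graph: "pair_graph G" and triangle_free: "triangle_free G" and blocks: "blocks G bs"
begin

definition ps :: "(bool \<times> nat list \<times> bool) list" where
  "ps = map (\<lambda>b. profile (degs G b)) bs"

abbreviation idx :: "index set" where "idx \<equiv> indices ps"
abbreviation el :: "index \<Rightarrow> 'a pair_pre_digraph" where "el \<equiv> elem G bs"

lemma length_ps [simp]: "length ps = length bs"
  by (simp add: ps_def)

lemma block_nth: "i < length bs \<Longrightarrow> block G (bs ! i)"
  using blocks by (auto simp: blocks_def)

lemma block_nth_subset: "i < length bs \<Longrightarrow> set (bs ! i) \<subseteq> pverts G"
  using blocks unfolding blocks_def by (metis UN_upper nth_mem set_concat)

lemma distinct_nth: "i < length bs \<Longrightarrow> distinct (bs ! i)"
  using block_nth by (simp add: block_def)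

lemma ps_nth:
  assumes "i < length bs"
  shows "ps ! i = (length (bs ! i) = 1, map (\<lambda>v. card (back_nbrs G (bs ! i) v)) (levels G (bs ! i)),
    level G (bs ! i) (last (bs ! i)))"
proof -
  have "bs ! i \<noteq> []" using block_nth[OF assms] by (simp add: block_def)
  then show ?thesis using assms
    by (simp add: ps_def profile_def degs_def levels_def filter_map o_def level_def[abs_def] last_map)
qed

lemma same_block: "i < length bs \<Longrightarrow> j < length bs \<Longrightarrow> x \<in> set (bs ! i) \<Longrightarrow> x \<in> set (bs ! j) \<Longrightarrow> i = j"
  using blocks distinct_concat_nth[of bs i j x] by (auto simp: blocks_def)

lemma index_cases:
  assumes "a \<in> idx"
  obtains
    (point) i l where "a = (i, l, 0)" "i < length bs" "l < 2" "levels G (bs ! i) \<noteq> []" "el a = point (bs ! i ! l)"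
      "2 \<le> length (bs ! i)"
  | (base) i where "a = (i, 2, 0)" "i < length bs" "el a = base_tree G (bs ! i)"
  | (extra) i r t v u ys zs where "a = (i, r + 3, t)" "i < length bs" "r < length (levels G (bs ! i))"
      "v = levels G (bs ! i) ! r" "bs ! i = ys @ v # zs" "length (filter (level G (bs ! i)) ys) = r"
      "2 \<le> length ys" "t < length (extra G (bs ! i) v)" "u = extra G (bs ! i) v ! t"
      "u \<in> back_nbrs G (bs ! i) v" "u \<noteq> par G (bs ! i) v"
      "el a = tree_of (ys @ [v]) ((par G (bs ! i))(v := u))"
proof -
  obtain i l t where a: "a = (i, l, t)" by (cases a) auto
  have i: "i < length bs" using assms a by (auto simp: indices_def)
  let ?xs = "bs ! i"
  let ?ds = "map (\<lambda>v. card (back_nbrs G ?xs v)) (levels G ?xs)"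
  have *: "l < 2 \<and> t = 0 \<and> ?ds \<noteq> [] \<or> l = 2 \<and> t = 0 \<or> 3 \<le> l \<and> l - 3 < length ?ds \<and> t < ?ds ! (l - 3) - 1"
    using assms a i by (simp add: indices_def ps_nth)
  note b = block_nth[OF i]
  consider "l < 2" "t = 0" "?ds \<noteq> []" | "l = 2" "t = 0" | "3 \<le> l" "l - 3 < length ?ds" "t < ?ds ! (l - 3) - 1"
    using * by blast
  then show thesis
  proof cases
    case 1
    then have "0 < length (levels G ?xs)" by auto
    then have "2 \<le> length ?xs" using level_split[OF b, of 0] by (metis length_append trans_le_add1)
    then show ?thesis using point[of i l] 1 a i by (auto simp: elem_def)
  next
    case 2
    then show ?thesis using base[of i] a i by (auto simp: elem_def)
  next
    case 3
    define r where "r = l - 3"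
    define v where "v = levels G ?xs ! r"
    define u where "u = extra G ?xs v ! t"
    have r: "r < length (levels G ?xs)" "l = r + 3" using 3 by (auto simp: r_def)
    obtain ys zs where s: "?xs = ys @ v # zs" "level G ?xs v" "length (filter (level G ?xs) ys) = r" "2 \<le> length ys"
      using level_split[OF b r(1)] unfolding v_def by blast
    have "v \<in> set (tl ?xs)" using s(1,4) by (cases ys) auto
    then have "length (extra G ?xs v) = card (back_nbrs G ?xs v) - 1" by (rule length_extra[OF b])
    moreover have "?ds ! (l - 3) = card (back_nbrs G ?xs v)" using r by (simp add: v_def)
    ultimately have t: "t < length (extra G ?xs v)" using 3(3) by simp
    then have "u \<in> set (extra G ?xs v)" by (simp add: u_def)
    then have u: "u \<in> back_nbrs G ?xs v" "u \<noteq> par G ?xs v" using set_extra[OF b] by auto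
    have "el a = extra_tree G ?xs v u" using a r by (simp add: elem_def v_def u_def Let_def)
    also have "\<dots> = tree_of (ys @ [v]) ((par G ?xs)(v := u))" by (rule extra_parent_fun(5)[OF b s(1) u(1)])
    finally show ?thesis using extra[of i r t v ys zs u] a r i v_def s t u_def u by blast
  qed
qed

text \<open>Points included, all elements are trees given by a list and a parent function;
  contractibility and the subgraph property follow uniformly from this.\<close>

lemma parent_fun_el:
  assumes "a \<in> idx"
  shows "\<exists>zs p. parent_fun zs p \<and> el a = tree_of zs p \<and> zs \<noteq> [] \<and> set zs \<subseteq> set (bs ! fst a) \<and>
    (\<forall>x\<in>set (tl zs). (x, p x) \<in> parcs G)"
  using assms
proof (cases rule: index_cases)
  case (point i l)
  then have "el a = tree_of [bs ! i ! l] id" "bs ! i ! l \<in> set (bs ! i)"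
    by (auto simp: point_def tree_of_def)
  then show ?thesis using point(1) by (intro exI[of _ "[bs ! i ! l]"] exI[of _ id]) (simp add: parent_fun_def)
next
  case (base i)
  note b = block_nth[OF base(2)]
  then show ?thesis using base(1,3) base_parent_fun[OF b] par_before[OF b]
    by (intro exI[of _ "bs ! i"] exI[of _ "par G (bs ! i)"]) (auto simp: base_tree_def block_def)
next
  case (extra i r t v u ys zs)
  note b = block_nth[OF extra(2)]
  note e = extra_parent_fun[OF b extra(5,10)]
  have "(x, par G (bs ! i) x) \<in> parcs G" if "x \<in> set (tl ys)" for x
    using that extra(5) e(2) by (intro par_before(2)[OF b]) auto
  then show ?thesis using e extra(1,12)
    by (intro exI[of _ "ys @ [v]"] exI[of _ "(par G (bs ! i))(v := u)"]) (auto simp: extra(5))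
qed

lemma pair_graph_el: "a \<in> idx \<Longrightarrow> pair_graph (el a)"
  using parent_fun_el pair_graph_tree_of by metis

lemma contractible_el: "a \<in> idx \<Longrightarrow> contractible (el a)"
  using parent_fun_el contractible_tree_of by metis

lemma el_nonempty: "a \<in> idx \<Longrightarrow> pverts (el a) \<noteq> {}"
  using parent_fun_el by fastforce

lemma fst_index: "a \<in> idx \<Longrightarrow> fst a < length bs"
  by (auto simp: indices_def)

lemma pverts_el_block: "a \<in> idx \<Longrightarrow> pverts (el a) \<subseteq> set (bs ! fst a)"
  using parent_fun_el by fastforce

lemma parcs_el: "a \<in> idx \<Longrightarrow> parcs (el a) \<subseteq> parcs G"
  using parent_fun_el[of a] pair_graphD(4)[OF pair_graph] by fastforce

lemma triangle_free_subset: "parcs A \<subseteq> parcs G \<Longrightarrow> triangle_free A"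
  using triangle_free unfolding triangle_free_def by blast

lemma dim_el:
  assumes a: "a \<in> idx"
  shows "graph_dim (el a) = (if fst (snd a) < 2 \<or> fst (ps ! fst a) then 0 else 1)"
  using a
proof (cases rule: index_cases)
  case (point i l)
  then show ?thesis by (auto simp: point_def pair_graph_iff intro!: graph_dim_discrete)
next
  case (base i)
  note b = block_nth[OF base(2)]
  show ?thesis
  proof (cases "length (bs ! i) = 1")
    case True
    then have "tl (bs ! i) = []" "bs ! i \<noteq> []" by (auto simp: length_Suc_conv)
    then have "graph_dim (el a) = 0"
      using pair_graph_el[OF a] base(3) by (intro graph_dim_discrete) (auto simp: base_tree_def)
    then show ?thesis using True base(1,2) by (simp add: ps_nth)
  next
    case False
    then have len: "2 \<le> length (bs ! i)" using b by (cases "bs ! i") (auto simp: block_def Suc_le_eq)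
    have "graph_dim (el a) = 1"
      using tree_of_not_isolated[OF base_parent_fun[OF b] len] base(3) el_nonempty[OF a]
        triangle_free_subset[OF parcs_el[OF a]] pair_graph_el[OF a]
      by (intro graph_dim_1) (auto simp: base_tree_def simp del: tree_of_simps(2))
    then show ?thesis using False base(1,2) by (simp add: ps_nth)
  qed
next
  case (extra i r t v u ys zs)
  note b = block_nth[OF extra(2)]
  note e = extra_parent_fun[OF b extra(5,10)]
  have "2 \<le> length (ys @ [v])" using extra(7) by simp
  then have dim: "graph_dim (el a) = 1"
    using tree_of_not_isolated[OF e(1)] extra(12) el_nonempty[OF a]
      triangle_free_subset[OF parcs_el[OF a]] pair_graph_el[OF a]
    by (intro graph_dim_1) (auto simp del: tree_of_simps(2))
  have "length (bs ! i) = length ys + Suc (length zs)" by (simp add: extra(5))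
  then have "length (bs ! i) \<noteq> 1" using extra(7) by linarith
  then show ?thesis using dim extra(1,2) by (simp add: ps_nth)
qed

lemma graph_inter_commute: "graph_inter A B = graph_inter B A"
  by (simp add: graph_inter_def Int_commute)

lemma graph_inter_same: "graph_inter A A = A"
  by (intro pair_pre_digraph.equality) (simp_all add: graph_inter_def)

lemma dim_assumption_commute: "dim_assumption A B = dim_assumption B A"
  by (simp add: dim_assumption_def graph_inter_commute min.commute)

lemma pair_graph_inter: "pair_graph A \<Longrightarrow> pair_graph B \<Longrightarrow> pair_graph (graph_inter A B)"
  by (auto simp: pair_graph_iff graph_inter_def)

lemma first_two_in_el:
  assumes "a \<in> idx" "2 \<le> fst (snd a)" "levels G (bs ! fst a) \<noteq> []" "l < 2"
  shows "bs ! fst a ! l \<in> pverts (el a)"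
  using assms(1)
proof (cases rule: index_cases)
  case (base i)
  have "0 < length (levels G (bs ! i))" using base(1) assms(3) by auto
  then have "2 \<le> length (bs ! i)"
    using level_split[OF block_nth[OF base(2)], of 0] by (metis length_append trans_le_add1)
  then show ?thesis using base(1,3) assms(4) by (simp add: base_tree_def)
next
  case (extra i r t v u ys zs)
  have "l < length ys" using extra(7) assms(4) by simp
  then have "bs ! i ! l = ys ! l" "ys ! l \<in> set ys" by (simp_all add: extra(5) nth_append)
  then show ?thesis using extra(1,12) by simp
next
  case (point j l)
  show ?thesis using point(1,3) assms(2) by simp
qed

text \<open>The isolated vertex is the leaf \<open>v\<close> at which the tree \<open>a\<close>
  ends, attached to \<open>u\<close>. The condition on the levels makes \<open>v\<close> a vertex of
  the other tree as well. There its parent is \<open>par\<close>, or a different additional back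
  neighbour if that tree also ends at \<open>v\<close>; neither is \<open>u\<close>.\<close>

lemma inter_isolated:
  assumes a: "a \<in> idx" and b: "b \<in> idx" and i: "fst a = fst b" and ne: "a \<noteq> b"
    and l: "3 \<le> fst (snd a)" "fst (snd b) = 2 \<or> fst (snd a) \<le> fst (snd b)"
  shows "\<exists>v\<in>pverts (graph_inter (el a) (el b)). \<forall>y. (v, y) \<notin> parcs (graph_inter (el a) (el b))"
  using a
proof (cases rule: index_cases)
  case (extra i r t v u ys zs)
  note xs = extra(5)
  note B = block_nth[OF extra(2)]
  note e = extra_parent_fun[OF B xs extra(10)]
  have d: "distinct (ys @ v # zs)" using B xs by (simp add: block_def)
  have va: "v \<in> pverts (el a)" using extra(12) by simp
  have *: "\<exists>v\<in>pverts (graph_inter (el a) (el b)). \<forall>y. (v, y) \<notin> parcs (graph_inter (el a) (el b))"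
    if "el b = tree_of zs' q" "parent_fun zs' q" "u \<in> before zs' v" "q v \<noteq> u" "v \<in> set zs'" for zs' q
    using isolated_in_inter[OF e(1,2) _ that(2-4)] that(1,5) va
    by (intro bexI[of _ v]) (auto simp: extra(12) graph_inter_def simp del: tree_of_simps(2))
  show ?thesis using b
  proof (cases rule: index_cases)
    case (point j l)
    then show ?thesis using l by auto
  next
    case (base j)
    have "j = i" using base(1) extra(1) i by simp
    then show ?thesis
      using base(3) base_parent_fun[OF B] before_split[OF d] e(3) xs extra(11)
      by (intro *[of "bs ! i" "par G (bs ! i)"]) (auto simp: base_tree_def)
  next
    case second: (extra j r' t' v' u' ys' zs')
    have j: "j = i" using second(1) extra(1) i by simp
    note e' = extra_parent_fun[OF block_nth[OF second(2)] second(5,10)]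
    show ?thesis
    proof (cases "r' = r")
      case True
      have v': "v' = v" using True j extra(4) second(4) by simp
      have ys': "ys' = ys"
        using takeWhile_split[of ys' v' zs'] takeWhile_split[OF d] d xs second(5) j v' by metis
      have "t \<noteq> t'" using ne extra(1) second(1) True j by auto
      moreover have "distinct (extra G (bs ! i) v)" using B by (simp add: extra_def block_def)
      ultimately have "u' \<noteq> u"
        using extra(8,9) second(8,9) j v' by (auto simp: nth_eq_iff_index_eq)
      moreover have "v \<notin> set ys" using d by simp
      ultimately show ?thesis
        using second(12) e'(1) e(3) v' ys'
        by (intro *[of "ys @ [v]" "(par G (bs ! j))(v := u')"]) (auto simp: before_append before_Cons)
    next
      case False
      then have r: "r < r'" using l second(1) extra(1) by auto
      have "levels G (bs ! i) = filter (level G (bs ! i)) ys' @ filter (level G (bs ! i)) (v' # zs')"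
        using second(5) j by (simp add: levels_def)
      then have "v = filter (level G (bs ! i)) ys' ! r"
        using extra(4) r second(6) j by (metis nth_append)
      moreover have "r < length (filter (level G (bs ! i)) ys')" using r second(6) j by simp
      ultimately have vy: "v \<in> set ys'" using nth_mem by (metis filter_is_subset subsetD)
      have dj: "distinct (ys' @ v' # zs')" using B second(5) j by (simp add: block_def)
      have "before (ys' @ [v']) v = before (bs ! i) v"
        using vy second(5) j by (simp add: before_append)
      then have "u \<in> before (ys' @ [v']) v" using before_split[OF d] xs e(3) by simp
      moreover have "v \<noteq> v'" using vy dj by auto
      ultimately show ?thesis
        using second(12) e'(1) vy extra(11) j
        by (intro *[of "ys' @ [v']" "(par G (bs ! j))(v' := u')"]) auto
    qed
  qed
next
  case (point j l)
  show ?thesis using point(1,3) l(1) by simp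
next
  case (base j)
  show ?thesis using base(1) l(1) by simp
qed

lemma inter_point:
  assumes "c \<in> idx" "c' \<in> idx" "fst c = fst c'" "fst (snd c) < 2" "\<not> fst (snd c') < 2"
  shows "graph_inter (el c) (el c') = el c"
  using assms(1)
proof (cases rule: index_cases)
  case (point j l)
  have "bs ! j ! l \<in> pverts (el c')"
    using first_two_in_el[OF assms(2), of l] assms(3,5) point(1,3,4) by simp
  then show ?thesis using point(5) by (simp add: graph_inter_def point_def)
next
  case (base j)
  show ?thesis using base(1) assms(4) by simp
next
  case (extra j r t v u ys zs)
  show ?thesis using extra(1) assms(4) by simp
qed

text \<open>Elements of different blocks and different points are disjoint, so they meet in
  dimension -1. A point lies in every tree of its block and is the whole intersection. Two different
  trees of a block have dimension 1 but meet in a graph with an isolated vertex.\<close>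

lemma dim_assumption_el:
  assumes a: "a \<in> idx" and b: "b \<in> idx"
  shows "dim_assumption (el a) (el b) \<longleftrightarrow>
    a = b \<or> fst a = fst b \<and> (fst (snd a) < 2 \<longleftrightarrow> \<not> fst (snd b) < 2)"
proof -
  let ?I = "graph_inter (el a) (el b)"
  have I: "pair_graph ?I" using pair_graph_inter pair_graph_el a b by blast
  have triI: "triangle_free ?I"
    using parcs_el[OF a] by (intro triangle_free_subset) (auto simp: graph_inter_def)
  have pos: "0 \<le> graph_dim (el a)" "0 \<le> graph_dim (el b)" using dim_el a b by auto
  have disj: "\<not> dim_assumption (el a) (el b)" if "pverts (el a) \<inter> pverts (el b) = {}"
  proof -
    have "graph_dim ?I = - 1" using I that by (intro graph_dim_empty) (auto simp: graph_inter_def)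
    then show ?thesis using pos by (auto simp: dim_assumption_def)
  qed
  have eq: "dim_assumption (el a) (el a)" by (simp add: dim_assumption_def graph_inter_same)
  show ?thesis
  proof (cases "fst a = fst b")
    case False
    have "pverts (el a) \<inter> pverts (el b) = {}"
      using pverts_el_block[OF a] pverts_el_block[OF b] same_block[OF fst_index[OF a] fst_index[OF b]] False
      by blast
    then show ?thesis using disj False by auto
  next
    case i: True
    have point_tree: "dim_assumption (el c) (el c')"
      if "c \<in> idx" "c' \<in> idx" "fst c = fst c'" "fst (snd c) < 2" "\<not> fst (snd c') < 2" for c c'
      using inter_point[OF that] by (simp add: dim_assumption_def)
    consider "a = b" | "a \<noteq> b" "fst (snd a) < 2" "fst (snd b) < 2"
      | "fst (snd a) < 2" "\<not> fst (snd b) < 2" | "\<not> fst (snd a) < 2" "fst (snd b) < 2"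
      | "a \<noteq> b" "\<not> fst (snd a) < 2" "\<not> fst (snd b) < 2" by blast
    then show ?thesis
    proof cases
      case 1
      then show ?thesis using eq by simp
    next
      case 2
      show ?thesis using a
      proof (cases rule: index_cases)
        case p1: (point j l)
        show ?thesis using b
        proof (cases rule: index_cases)
          case p2: (point j' l')
          have "j' = j" "l' \<noteq> l" using i 2(1) p1(1) p2(1) by auto
          then have "bs ! j ! l \<noteq> bs ! j ! l'"
            using distinct_nth[OF p1(2)] p1(3,6) p2(3) by (simp add: nth_eq_iff_index_eq)
          then have "pverts (el a) \<inter> pverts (el b) = {}" using p1(5) p2(5) \<open>j' = j\<close> by (simp add: point_def)
          then show ?thesis using disj 2 by auto
        next
          case (base j)
          show ?thesis using base(1) 2(2,3) by simp
        next
          case (extra j r t v u ys zs)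
          show ?thesis using extra(1) 2(2,3) by simp
        qed
      next
        case (base j)
        show ?thesis using base(1) 2(2,3) by simp
      next
        case (extra j r t v u ys zs)
        show ?thesis using extra(1) 2(2,3) by simp
      qed
    next
      case 3
      then show ?thesis using point_tree[OF a b i] i by auto
    next
      case 4
      then show ?thesis using point_tree[OF b a i[symmetric]] i dim_assumption_commute by auto
    next
      case 5
      have big: "3 \<le> fst (snd c) \<or> fst (snd c) = 2 \<and> snd (snd c) = 0" if "c \<in> idx" "\<not> fst (snd c) < 2" for c
        using that by (auto simp: indices_def)
      \<comment> \<open>A block has only one index with \<open>l = 2\<close>, so of two different
        trees at least one is an extra tree.\<close>
      have some: "3 \<le> fst (snd a) \<or> 3 \<le> fst (snd b)"
        using big[OF a 5(2)] big[OF b 5(3)] 5(1) i by (cases a; cases b) auto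
      have "\<exists>v\<in>pverts ?I. \<forall>y. (v, y) \<notin> parcs ?I"
      proof (cases "3 \<le> fst (snd a) \<and> (fst (snd b) = 2 \<or> fst (snd a) \<le> fst (snd b))")
        case True
        then show ?thesis using inter_isolated[OF a b i 5(1)] by blast
      next
        case False
        then have "3 \<le> fst (snd b) \<and> (fst (snd a) = 2 \<or> fst (snd b) \<le> fst (snd a))"
          using some big[OF a 5(2)] big[OF b 5(3)] by auto
        then show ?thesis using inter_isolated[OF b a i[symmetric]] 5(1) graph_inter_commute by metis
      qed
      then have less: "graph_dim ?I < 1" using graph_dim_less_1[OF I triI] by blast
      have "\<not> fst (ps ! fst c)" if "c \<in> idx" "3 \<le> fst (snd c)" for c
        using that(1)
      proof (cases rule: index_cases)
        case (point j l)
        show ?thesis using point(1,3) that(2) by simp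
      next
        case (base j)
        show ?thesis using base(1) that(2) by simp
      next
        case (extra j r t v u ys zs)
        have "length (bs ! j) = length ys + Suc (length zs)" by (simp add: extra(5))
        then have "length (bs ! j) \<noteq> 1" using extra(7) by linarith
        then show ?thesis using extra(1,2) by (simp add: ps_nth)
      qed
      then have "\<not> fst (ps ! fst a)" using some a b i by metis
      then have "graph_dim (el a) = 1" "graph_dim (el b) = 1"
        using a b i 5(2,3) by (simp_all add: dim_el)
      then have "\<not> dim_assumption (el a) (el b)" using less by (simp add: dim_assumption_def)
      then show ?thesis using 5 by auto
    qed
  qed
qed

text \<open>Equal elements satisfy the dimension assumption, so two different indices of one element
  would be a point and a tree of the same block; but that tree contains the first two
  vertices.\<close>

lemma inj_el: "inj_on el idx"
proof (rule inj_onI, rule ccontr)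
  fix a b assume a: "a \<in> idx" and b: "b \<in> idx" and eq: "el a = el b" and ne: "a \<noteq> b"
  have "dim_assumption (el a) (el b)" using eq by (simp add: dim_assumption_def graph_inter_same)
  then have i: "fst a = fst b" and x: "fst (snd a) < 2 \<longleftrightarrow> \<not> fst (snd b) < 2"
    using dim_assumption_el[OF a b] ne by auto
  have False if c: "c \<in> idx" "c' \<in> idx" "fst c = fst c'" "fst (snd c) < 2" "\<not> fst (snd c') < 2"
    "el c = el c'" for c c'
    using c(1)
  proof (cases rule: index_cases)
    case (point j l)
    have "bs ! j ! 0 \<in> pverts (el c)" "bs ! j ! 1 \<in> pverts (el c)"
      using first_two_in_el[OF c(2), of 0] first_two_in_el[OF c(2), of 1] c(3,5,6) point(1,4) by auto
    moreover have "bs ! j ! 0 \<noteq> bs ! j ! 1"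
      using distinct_nth[OF point(2)] point(6) by (subst nth_eq_iff_index_eq) auto
    ultimately show False using point(5) by (simp add: point_def)
  next
    case (base j)
    show ?thesis using base(1) c(4) by simp
  next
    case (extra j r t v u ys zs)
    show ?thesis using extra(1) c(4) by simp
  qed
  then show False using a b i x eq by metis
qed

end

section \<open>Coding vertices by their position\<close>

text \<open>The code of a vertex records which sub-base elements contain it. The sub-base elements are the
  preimages of sets of codes that depend on the profiles only, so two ordered graphs with the same
  profiles have isomorphic lattices of open sets.\<close>

definition position :: "'a pair_pre_digraph \<Rightarrow> 'a list \<Rightarrow> 'a \<Rightarrow> nat" where
  "position G xs x = (if levels G xs \<noteq> [] \<and> x = xs ! 0 then 0 else if levels G xs \<noteq> [] \<and> x = xs ! 1 then 1
     else length (filter (level G xs) (takeWhile (\<lambda>y. y \<noteq> x) xs)) + 2)"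

definition code :: "'a pair_pre_digraph \<Rightarrow> 'a list list \<Rightarrow> 'a \<Rightarrow> nat \<times> nat" where
  "code G bs x = (let i = THE i. i < length bs \<and> x \<in> set (bs ! i) in (i, position G (bs ! i) x))"

text \<open>For \<open>l = r + 3\<close>: the end vertex of the extra tree has \<open>r\<close>
  vertices of back degree at least 2 before it, hence position \<open>r + 2\<close>, and the tree
  takes exactly the positions up to that one.\<close>

definition code_set :: "index \<Rightarrow> (nat \<times> nat) set" where
  "code_set = (\<lambda>(i, l, t). {i} \<times> (if l < 2 then {l} else if l = 2 then UNIV else {..<l}))"

text \<open>The position \<open>length ds + 2\<close> belongs to the vertices behind the last one of
  back degree at least 2; it occurs unless that one ends the block.\<close>

definition codes :: "(bool \<times> nat list \<times> bool) list \<Rightarrow> (nat \<times> nat) set" where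
  "codes ps = (SIGMA i:{..<length ps}. let ds = fst (snd (ps ! i)) in
     if ds = [] then {2} else {..<length ds + 2} \<union> (if snd (snd (ps ! i)) then {} else {length ds + 2}))"

lemma position_later:
  assumes "distinct (ys @ v # zs)" "2 \<le> length ys" "xs = ys @ v # zs"
  shows "position G xs v = length (filter (level G xs) ys) + 2"
proof -
  have "0 < length ys" "1 < length ys" using assms(2) by linarith+
  then have "xs ! 0 \<in> set ys" "xs ! 1 \<in> set ys" by (simp_all add: assms(3) nth_append)
  then have "v \<noteq> xs ! 0" "v \<noteq> xs ! 1" using assms(1) by auto
  then show ?thesis using takeWhile_split[OF assms(1)] assms(3) by (simp add: position_def)
qed

lemma levels_length:
  assumes "block G xs" "levels G xs \<noteq> []"
  shows "3 \<le> length xs"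
proof -
  obtain ys zs where "xs = ys @ levels G xs ! 0 # zs" "2 \<le> length ys"
    using level_split[OF assms(1), of 0] assms(2) by auto
  then have "length xs = length ys + Suc (length zs)" by (metis length_append length_Cons)
  with \<open>2 \<le> length ys\<close> show ?thesis by linarith
qed

lemma position_image:
  assumes b: "block G xs"
  shows "position G xs ` set xs = (if levels G xs = [] then {2} else
    {..<length (levels G xs) + 2} \<union> (if level G xs (last xs) then {} else {length (levels G xs) + 2}))"
proof (cases "levels G xs = []")
  case True
  then have "position G xs x = 2" if "x \<in> set xs" for x
    using set_takeWhileD[of _ "\<lambda>y. y \<noteq> x" xs] by (auto simp: position_def levels_def filter_empty_conv)
  moreover have "xs \<noteq> []" using b by (simp add: block_def)
  ultimately show ?thesis using True by (cases xs) auto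
next
  case False
  let ?m = "length (levels G xs)"
  have d: "distinct xs" using b by (simp add: block_def)
  have len: "3 \<le> length xs" by (rule levels_length[OF b False])
  have ne: "xs ! 0 \<noteq> xs ! 1" using len d by (subst nth_eq_iff_index_eq) auto
  have in01: "xs ! 0 \<in> set xs" "xs ! 1 \<in> set xs" using len by (intro nth_mem; linarith)+
  have pos01: "position G xs (xs ! 0) = 0" "position G xs (xs ! 1) = 1"
    using False ne by (auto simp: position_def)
  let ?R = "{..<?m + 2} \<union> (if level G xs (last xs) then {} else {?m + 2})"
  have "position G xs x \<in> ?R" if "x \<in> set xs" for x
  proof (cases "x = xs ! 0 \<or> x = xs ! 1")
    case True
    then show ?thesis using pos01 by auto
  next
    case nf: False
    from split_list[OF that] obtain ys zs where s: "xs = ys @ x # zs" by blast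
    have "takeWhile (\<lambda>y. y \<noteq> x) xs = ys" using takeWhile_split[of ys x zs] d s by simp
    then have p: "position G xs x = length (filter (level G xs) ys) + 2" using nf by (simp add: position_def)
    have l: "levels G xs = filter (level G xs) ys @ filter (level G xs) (x # zs)"
      unfolding levels_def by (subst (2) s) simp
    have last: "last xs = last (x # zs)" by (subst s) simp
    show ?thesis
    proof (cases "filter (level G xs) (x # zs) = []")
      case True
      have "last (x # zs) \<in> set (x # zs)" by (rule last_in_set) simp
      then have "\<not> level G xs (last xs)" using True last by (metis filter_empty_conv)
      then show ?thesis using p l True by simp
    next
      case False
      then have "0 < length (filter (level G xs) (x # zs))" by (simp only: length_greater_0_conv not_False_eq_True)
      then have "length (filter (level G xs) ys) < ?m"
        unfolding l length_append by linarith
      then show ?thesis using p by simp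
    qed
  qed
  moreover have "k \<in> position G xs ` set xs" if k: "k \<in> ?R" for k
  proof -
    consider "k = 0" | "k = 1" | "2 \<le> k" "k < ?m + 2" | "k = ?m + 2" "\<not> level G xs (last xs)"
      using k by (cases "k < 2"; cases "level G xs (last xs)") (auto simp: less_2_cases_iff)
    then show ?thesis
    proof cases
      case 1
      then show ?thesis using pos01 in01 by (intro image_eqI[of _ _ "xs ! 0"]) auto
    next
      case 2
      then show ?thesis using pos01 in01 by (intro image_eqI[of _ _ "xs ! 1"]) auto
    next
      case 3
      then have "k - 2 < ?m" by simp
      then obtain ys zs where s: "xs = ys @ levels G xs ! (k - 2) # zs"
          "length (filter (level G xs) ys) = k - 2" "2 \<le> length ys"
        using level_split[OF b] by blast
      have "distinct (ys @ levels G xs ! (k - 2) # zs)" using d s(1) by simp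
      then have "position G xs (levels G xs ! (k - 2)) = k"
        using position_later[OF _ s(3,1)] s(2) 3(1) by simp
      moreover have "levels G xs ! (k - 2) \<in> set xs" by (subst (2) s(1)) simp
      ultimately show ?thesis by (intro image_eqI[of _ _ "levels G xs ! (k - 2)"]) auto
    next
      case 4
      \<comment> \<open>The last vertex realises the top position: its own back degree is below 2,
        so all of \<open>levels G xs\<close> precedes it.\<close>
      have xs: "xs = butlast xs @ last xs # []" using len by (metis append_butlast_last_id list.size(3) not_numeral_le_zero)
      have "2 \<le> length (butlast xs)" using len by simp
      moreover have "distinct (butlast xs @ last xs # [])" using d xs by simp
      ultimately have "position G xs (last xs) = length (filter (level G xs) (butlast xs)) + 2"
        using position_later[of "butlast xs" "last xs" "[]" xs G] xs by blast
      also have "filter (level G xs) (butlast xs) = levels G xs"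
        unfolding levels_def by (subst (4) xs) (use 4(2) in simp)
      finally have "position G xs (last xs) = k" using 4(1) by simp
      moreover have "last xs \<in> set xs" using len by (intro last_in_set) auto
      ultimately show ?thesis by blast
    qed
  qed
  ultimately have "position G xs ` set xs = ?R" by blast
  then show ?thesis using False by simp
qed

context ordered_graph
begin

lemma ex_block:
  assumes "x \<in> pverts G"
  shows "\<exists>i<length bs. x \<in> set (bs ! i)"
  using blocks_vertD[OF blocks assms] by (metis in_set_conv_nth)

lemma code_eq:
  assumes "i < length bs" "x \<in> set (bs ! i)"
  shows "code G bs x = (i, position G (bs ! i) x)"
proof -
  have "(THE i. i < length bs \<and> x \<in> set (bs ! i)) = i"
    using assms same_block by (intro the_equality) auto
  then show ?thesis by (simp add: code_def)
qed

lemma code_image: "code G bs ` pverts G = codes ps"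
proof -
  have "pverts G = (\<Union>i<length bs. set (bs ! i))"
    using ex_block block_nth_subset by fast
  then have "code G bs ` pverts G = (\<Union>i<length bs. code G bs ` set (bs ! i))" by (simp add: image_UN)
  also have "\<dots> = (\<Union>i<length bs. {i} \<times> position G (bs ! i) ` set (bs ! i))"
  proof (rule SUP_cong[OF HOL.refl])
    fix i assume "i \<in> {..<length bs}"
    then have "code G bs x = (i, position G (bs ! i) x)" if "x \<in> set (bs ! i)" for x
      using code_eq that by simp
    then show "code G bs ` set (bs ! i) = {i} \<times> position G (bs ! i) ` set (bs ! i)" by force
  qed
  also have "\<dots> = (SIGMA i:{..<length bs}. position G (bs ! i) ` set (bs ! i))" by auto
  also have "\<dots> = codes ps"
    unfolding codes_def length_ps
    by (intro Sigma_cong HOL.refl) (auto simp: position_image[OF block_nth] ps_nth)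
  finally show ?thesis .
qed

lemma pverts_el:
  assumes a: "a \<in> idx"
  shows "pverts (el a) = {x \<in> pverts G. code G bs x \<in> code_set a}"
proof -
  let ?i = "fst a"
  have i: "?i < length bs" by (rule fst_index[OF a])
  have "code G bs x \<in> code_set a \<longleftrightarrow> x \<in> set (bs ! ?i) \<and> (?i, position G (bs ! ?i) x) \<in> code_set a"
    if x: "x \<in> pverts G" for x
  proof -
    obtain j where j: "j < length bs" "x \<in> set (bs ! j)" using ex_block[OF x] by blast
    then have c: "code G bs x = (j, position G (bs ! j) x)" by (rule code_eq)
    show ?thesis
    proof (cases "j = ?i")
      case False
      then have "x \<notin> set (bs ! ?i)" using same_block[OF j(1) i j(2)] by blast
      moreover have "code G bs x \<notin> code_set a" using c False by (auto simp: code_set_def split: prod.splits)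
      ultimately show ?thesis by blast
    qed (use c j in auto)
  qed
  then have "{x \<in> pverts G. code G bs x \<in> code_set a} =
      {x \<in> set (bs ! ?i). (?i, position G (bs ! ?i) x) \<in> code_set a}"
    using block_nth_subset[OF i] by blast
  moreover have "pverts (el a) = {x \<in> set (bs ! ?i). (?i, position G (bs ! ?i) x) \<in> code_set a}"
    using a
  proof (cases rule: index_cases)
    case (point j l)
    have "bs ! j ! 0 \<noteq> bs ! j ! 1"
      using distinct_nth[OF point(2)] point(6) by (subst nth_eq_iff_index_eq) auto
    then have "position G (bs ! j) x = l \<longleftrightarrow> x = bs ! j ! l" for x
      using point(3,4) by (auto simp: position_def less_2_cases_iff)
    moreover have "bs ! j ! l \<in> set (bs ! j)" using point(3,6) by simp
    ultimately show ?thesis using point(1,3,5) by (auto simp: point_def code_set_def)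
  next
    case (base j)
    then show ?thesis by (simp add: base_tree_def code_set_def)
  next
    case (extra j r t v u ys zs)
    let ?xs = "bs ! j"
    have d: "distinct (ys @ v # zs)" using distinct_nth[OF extra(2)] extra(5) by simp
    have lv: "levels G ?xs \<noteq> []" using extra(3) by auto
    have "position G ?xs x < r + 3 \<longleftrightarrow> x \<in> set (ys @ [v])" if x: "x \<in> set ?xs" for x
    proof (cases "x = ?xs ! 0 \<or> x = ?xs ! 1")
      case True
      have "?xs ! 0 \<in> set ys" "?xs ! 1 \<in> set ys"
        using extra(7) by (auto simp: extra(5) nth_append)
      moreover have "position G ?xs x < 2" using True lv by (auto simp: position_def)
      ultimately show ?thesis using True by auto
    next
      case False
      then have p: "position G ?xs x = length (filter (level G ?xs) (takeWhile (\<lambda>y. y \<noteq> x) ?xs)) + 2"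
        by (simp add: position_def)
      have v: "level G ?xs v"
      proof -
        have "v \<in> set (levels G ?xs)" using extra(3,4) by simp
        then show ?thesis by (simp add: levels_def)
      qed
      show ?thesis
      proof (cases "x \<in> set (ys @ [v])")
        case True
        have "length (filter (level G ?xs) (takeWhile (\<lambda>y. y \<noteq> x) ?xs)) \<le> r"
        proof (cases "x \<in> set ys")
          case True
          then have "takeWhile (\<lambda>y. y \<noteq> x) ?xs = takeWhile (\<lambda>y. y \<noteq> x) ys" by (simp add: extra(5))
          moreover have "ys = takeWhile (\<lambda>y. y \<noteq> x) ys @ dropWhile (\<lambda>y. y \<noteq> x) ys" by simp
          ultimately show ?thesis using extra(6) by (metis filter_append le_add1 length_append)
        next
          case False
          then have "x = v" using True by simp
          then show ?thesis using takeWhile_split[OF d] extra(5,6) by simp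
        qed
        then show ?thesis using p True by simp
      next
        case False
        then have "takeWhile (\<lambda>y. y \<noteq> x) ?xs = ys @ v # takeWhile (\<lambda>y. y \<noteq> x) zs"
          using extra(5) by (auto simp: takeWhile_append)
        \<comment> \<open>A vertex behind \<open>v\<close> also counts \<open>v\<close> itself, so
          its position is at least \<open>r + 3\<close>.\<close>
        then have "r < length (filter (level G ?xs) (takeWhile (\<lambda>y. y \<noteq> x) ?xs))"
          using v extra(6) by simp
        then show ?thesis using p False by simp
      qed
    qed
    moreover have "set (ys @ [v]) \<subseteq> set ?xs" by (auto simp: extra(5))
    ultimately show ?thesis using extra(1,12) by (auto simp: code_set_def)
  qed
  ultimately show ?thesis by simp
qed

lemma finite_idx: "finite idx"
proof -
  let ?d = "\<lambda>i. fst (snd (ps ! i))"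
  have "idx \<subseteq> (SIGMA i:{..<length ps}. {..<length (?d i) + 3} \<times> {..Max (set (?d i) \<union> {1})})"
  proof
    fix a assume "a \<in> idx"
    obtain i l t where a1: "a = (i, l, t)" by (cases a) auto
    with \<open>a \<in> idx\<close> have a: "i < length ps"
      "l < 2 \<and> t = 0 \<or> l = 2 \<and> t = 0 \<or> 3 \<le> l \<and> l - 3 < length (?d i) \<and> t < ?d i ! (l - 3) - 1"
      by (auto simp: indices_def Let_def)
    have "?d i ! (l - 3) \<le> Max (set (?d i) \<union> {1})" if "l - 3 < length (?d i)"
      using that by (intro Max_ge) auto
    then have "t \<le> Max (set (?d i) \<union> {1})" using a(2) by (cases "l - 3 < length (?d i)") linarith+
    then show "a \<in> (SIGMA i:{..<length ps}. {..<length (?d i) + 3} \<times> {..Max (set (?d i) \<union> {1})})"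
      using a a1 by auto
  qed
  then show ?thesis by (rule finite_subset) auto
qed

lemma betti_levels:
  assumes "block G xs"
  shows "betti G xs = sum_list (map (\<lambda>v. card (back_nbrs G xs v) - 1) (levels G xs))"
proof -
  have "betti G xs = (\<Sum>v\<in>set (levels G xs). card (back_nbrs G xs v) - 1)"
    unfolding betti_def by (intro sum.mono_neutral_right) (auto simp: levels_def level_def)
  also have "\<dots> = sum_list (map (\<lambda>v. card (back_nbrs G xs v) - 1) (levels G xs))"
    using assms by (intro sum.distinct_set_conv_list) (simp add: levels_def block_def)
  finally show ?thesis .
qed

text \<open>A vertex of back degree \<open>d\<close> at least 2 yields \<open>d - 1\<close> extra
  trees, which add up to the Betti number; the spanning tree is one more. The two points are present
  exactly if the Betti number is positive.\<close>

lemma color_count_idx: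
  "card {a \<in> idx. (fst a, fst (snd a) < 2) = c} = color_count (map (betti G) bs) c"
proof (cases "fst c < length bs")
  case False
  then have "{a \<in> idx. (fst a, fst (snd a) < 2) = c} = {}" using fst_index by auto
  then have "card {a \<in> idx. (fst a, fst (snd a) < 2) = c} = 0" by (simp only: card.empty)
  then show ?thesis using False by (simp add: color_count_def)
next
  case True
  obtain i s where c: "c = (i, s)" by (cases c)
  have i: "i < length bs" using True c by simp
  let ?xs = "bs ! i"
  define ds where "ds = map (\<lambda>v. card (back_nbrs G ?xs v)) (levels G ?xs)"
  have betti: "betti G ?xs = sum_list (map (\<lambda>d. d - 1) ds)"
    using betti_levels[OF block_nth[OF i]] by (simp add: o_def ds_def)
  have idx: "(i, l, t) \<in> idx \<longleftrightarrow> l < 2 \<and> t = 0 \<and> ds \<noteq> [] \<or> l = 2 \<and> t = 0 \<or>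
      3 \<le> l \<and> l - 3 < length ds \<and> t < ds ! (l - 3) - 1" for l t
    using i by (simp add: indices_def ps_nth ds_def)
  show ?thesis
  proof (cases s)
    case True
    have "{a \<in> idx. (fst a, fst (snd a) < 2) = c} = (if ds = [] then {} else {(i, 0, 0), (i, 1, 0)})"
    proof -
      have "(i, l, t) \<in> idx \<and> l < 2 \<longleftrightarrow> ds \<noteq> [] \<and> (l = 0 \<or> l = 1) \<and> t = 0" for l t
        unfolding idx by auto
      moreover have "{a \<in> idx. (fst a, fst (snd a) < 2) = c} = {(i, l, t) |l t. (i, l, t) \<in> idx \<and> l < 2}"
        using c True by auto
      ultimately show ?thesis by (simp del: One_nat_def) (cases "ds = []"; auto)
    qed
    moreover have "betti G ?xs = 0 \<longleftrightarrow> ds = []"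
    proof
      assume "betti G ?xs = 0"
      then have zero: "d - 1 = 0" if "d \<in> set ds" for d using betti that by simp
      have two: "2 \<le> d" if "d \<in> set ds" for d using that by (auto simp: ds_def levels_def level_def)
      show "ds = []"
      proof (cases ds)
        case (Cons d ds')
        then have "d \<in> set ds" by simp
        then show ?thesis using zero[of d] two[of d] by linarith
      qed
    qed (simp add: betti)
    ultimately show ?thesis using c True i by (simp add: color_count_def)
  next
    case False
    let ?S = "SIGMA r:{..<length ds}. {..<ds ! r - 1}"
    let ?A = "(\<lambda>(r, t). (i, r + 3, t)) ` ?S"
    have L: "{a \<in> idx. (fst a, fst (snd a) < 2) = c} = insert (i, 2, 0) ((\<lambda>(r, t). (i, r + 3, t)) ` ?S)" (is "?L = ?R")
    proof (intro equalityI subsetI)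
      fix a assume "a \<in> ?L"
      then obtain l t where a: "a = (i, l, t)" "(i, l, t) \<in> idx" "\<not> l < 2" using c False by (cases a) auto
      show "a \<in> ?R"
      proof (cases "l = 2 \<and> t = 0")
        case False
        then have "3 \<le> l" "(l - 3, t) \<in> ?S" using a(2,3) unfolding idx by auto
        then show ?thesis using a(1) by (intro insertI2 image_eqI[of _ _ "(l - 3, t)"]) auto
      qed (use a in simp)
    next
      fix a assume "a \<in> ?R"
      then obtain l t where a: "a = (i, l, t)" "l = 2 \<and> t = 0 \<or> 3 \<le> l \<and> (l - 3, t) \<in> ?S" by auto
      then have "(i, l, t) \<in> idx" "\<not> l < 2" unfolding idx by auto
      then show "a \<in> ?L" using a c False by auto
    qed
    have cA: "card ?A = card ?S" by (intro card_image) (auto simp: inj_on_def)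
    have cS: "card ?S = betti G ?xs" unfolding betti by (simp add: sum_list_sum_nth atLeast0LessThan)
    have "finite ?A" "(i, 2, 0) \<notin> ?A" by auto
    then have "card (insert (i, 2, 0) ?A) = Suc (card ?A)" by (rule card_insert_disjoint)
    then have "card ?L = Suc (betti G ?xs)" unfolding L cA cS .
    then show ?thesis using c False i by (simp add: color_count_def)
  qed
qed

section \<open>The nerve and its homotopy type\<close>

definition subbase :: "'a pair_pre_digraph set" where
  "subbase = el ` idx"

lemma nerve_arc:
  assumes "a \<in> idx" "b \<in> idx"
  shows "(el a, el b) \<in> parcs (nerve subbase) \<longleftrightarrow> fst a = fst b \<and> (fst (snd a) < 2) \<noteq> (fst (snd b) < 2)"
proof -
  have "el a = el b \<longleftrightarrow> a = b" using inj_el assms by (auto dest: inj_onD)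
  then show ?thesis using assms dim_assumption_el[OF assms] by (auto simp: nerve_def subbase_def)
qed

lemma nerve_bipartite:
  defines "\<mu> \<equiv> \<lambda>A. let a = the_inv_into idx el A in (fst a, fst (snd a) < 2)"
  shows "bipartite_blocks (nerve subbase) \<mu>"
    "card {A \<in> pverts (nerve subbase). \<mu> A = c} = color_count (map (betti G) bs) c"
proof -
  have mu: "\<mu> (el a) = (fst a, fst (snd a) < 2)" if "a \<in> idx" for a
    using the_inv_into_f_f[OF inj_el that] by (simp add: \<mu>_def)
  have V: "pverts (nerve subbase) = el ` idx" by (simp add: nerve_def subbase_def)
  have sub: "parcs (nerve subbase) \<subseteq> el ` idx \<times> el ` idx" by (auto simp: nerve_def subbase_def)
  have "(A, B) \<in> parcs (nerve subbase) \<longleftrightarrow> A \<in> el ` idx \<and> B \<in> el ` idx \<and>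
      fst (\<mu> A) = fst (\<mu> B) \<and> snd (\<mu> A) \<noteq> snd (\<mu> B)" for A B
    using sub mu nerve_arc by auto
  then show "bipartite_blocks (nerve subbase) \<mu>"
    unfolding bipartite_blocks_def V using finite_idx by auto
  have "{A \<in> el ` idx. \<mu> A = c} = el ` {a \<in> idx. (fst a, fst (snd a) < 2) = c}"
    using mu by auto
  moreover have "inj_on el {a \<in> idx. (fst a, fst (snd a) < 2) = c}"
    using inj_el by (rule inj_on_subset) auto
  ultimately show "card {A \<in> pverts (nerve subbase). \<mu> A = c} = color_count (map (betti G) bs) c"
    unfolding V by (simp only: card_image color_count_idx)
qed

lemma pair_graph_bipartite_blocks: "bipartite_blocks F \<kappa> \<Longrightarrow> pair_graph F"
  by (auto simp: bipartite_blocks_def pair_graph_iff)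

text \<open>The nerve and the normal form of the graph have equally many vertices of each colour, so
  they are isomorphic.\<close>

lemma homotopic_nerve: "homotopic (nerve subbase) G"
proof -
  obtain H :: "nat pair_pre_digraph" and f where H: "pair_graph H" and iso: "graph_iso f G H"
    using ex_nat_copy[OF pair_graph] by blast
  have sub: "parcs H \<subseteq> pverts H \<times> pverts H" using H by (simp add: pair_graph_iff)
  note bH = blocks_iso[OF iso sub blocks]
  let ?cs = "map (map f) bs"
  have triH: "(u, w) \<notin> parcs H" if vu: "(v, u) \<in> parcs H" "(v, w) \<in> parcs H" for v u w
  proof
    assume uw: "(u, w) \<in> parcs H"
    have "v \<in> f ` pverts G" "u \<in> f ` pverts G" "w \<in> f ` pverts G"
      using vu sub iso by (auto simp: graph_iso_def bij_betw_def)
    then obtain v' u' w' where "v = f v'" "u = f u'" "w = f w'" "v' \<in> pverts G" "u' \<in> pverts G" "w' \<in> pverts G"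
      by blast
    then show False using vu uw iso triangle_free unfolding graph_iso_def triangle_free_def by metis
  qed
  have "\<exists>F \<kappa>. nat_homotopic H F \<and> bipartite_blocks F \<kappa> \<and>
    (\<forall>c. card {x \<in> pverts F. \<kappa> x = c} = color_count ([] @ map (betti H) ?cs) c)"
  \<comment> \<open>Nothing is normalised yet, so there are no vertices to colour.\<close>
  proof (rule blocks_normal_form[of H ?cs "{}" undefined "[]"])
    show "u \<in> set b" if "b \<in> set ?cs" "v \<in> set b" "(v, u) \<in> parcs H" for b v u
      using blocks_closed[OF bH(1)] that by blast
    show "pverts H = {} \<union> set (concat ?cs)" "distinct (concat ?cs)"
      using bH(1) unfolding blocks_def by simp_all
    show "block H b" if "b \<in> set ?cs" for b using bH(1) that unfolding blocks_def by blast
    show "bipartite_blocks (generated H {}) undefined" by (simp add: bipartite_blocks_def)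
    show "(u, w) \<notin> parcs H" if "(v, u) \<in> parcs H" "(v, w) \<in> parcs H" for v u w
      using triH that .
    show "card {x \<in> {}. undefined x = c} = color_count [] c" for c by (simp add: color_count_def)
  qed (use H in simp_all)
  then obtain F \<kappa> where F: "nat_homotopic H F" "bipartite_blocks F \<kappa>"
      "\<And>c. card {x \<in> pverts F. \<kappa> x = c} = color_count (map (betti G) bs) c"
    unfolding append_Nil bH(3) by blast
  have "\<exists>g. graph_iso g (nerve subbase) F"
    using bipartite_blocks_iso[OF nerve_bipartite(1) F(2)] nerve_bipartite(2) F(3)
    unfolding graph_iso_def by presburger
  then obtain g where "graph_iso g (nerve subbase) F" by blast
  then have "digraph_iso (with_proj (nerve subbase)) (with_proj F)"
    using pair_graph_bipartite_blocks[OF nerve_bipartite(1)] pair_graph_bipartite_blocks[OF F(2)]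
    by (intro digraph_isoI) (auto simp: pair_graph_iff)
  moreover have "digraph_iso (with_proj G) (with_proj H)"
    using pair_graph sub by (intro digraph_isoI[OF iso])
  ultimately show ?thesis using nat_homotopic_sym[OF F(1)] unfolding homotopic_def by blast
qed

lemma before_total: "x \<in> set xs \<Longrightarrow> y \<in> set xs \<Longrightarrow> x \<noteq> y \<Longrightarrow> x \<in> before xs y \<or> y \<in> before xs x"
  by (induction xs) (auto simp: before_Cons)

text \<open>A back edge to the chosen parent lies in the spanning tree. Any other one shows that its
  source has back degree at least 2, and it is the last edge of its own extra tree.\<close>

lemma back_arc_covered:
  assumes i: "i < length bs" and u: "u \<in> back_nbrs G (bs ! i) v" and v: "v \<in> set (bs ! i)"
  shows "\<exists>a\<in>idx. (v, u) \<in> parcs (el a) \<and> (u, v) \<in> parcs (el a)"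
proof -
  let ?xs = "bs ! i"
  note b = block_nth[OF i]
  obtain ys zs where s: "?xs = ys @ v # zs" using v split_list by metis
  note e = extra_parent_fun[OF b s u]
  have tl: "v \<in> set (tl ?xs)" using s e(2) by (cases ys) auto
  show ?thesis
  proof (cases "u = par G ?xs v")
    case True
    have "(i, 2, 0) \<in> idx" using i by (simp add: indices_def)
    moreover have "(v, u) \<in> parcs (el (i, 2, 0))" "(u, v) \<in> parcs (el (i, 2, 0))"
      using tl True by (auto simp: elem_def base_tree_def Let_def)
    ultimately show ?thesis by blast
  next
    case False
    have "{u, par G ?xs v} \<subseteq> back_nbrs G ?xs v" using u par_in_back_nbrs[OF b tl] by simp
    then have "card {u, par G ?xs v} \<le> card (back_nbrs G ?xs v)" by (intro card_mono) auto
    then have "v \<in> set (levels G ?xs)" using False v by (simp add: levels_def level_def)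
    then obtain r where r: "r < length (levels G ?xs)" "levels G ?xs ! r = v" by (metis in_set_conv_nth)
    have "u \<in> set (extra G ?xs v)" using set_extra[OF b] u False by simp
    then obtain t where t: "t < length (extra G ?xs v)" "extra G ?xs v ! t = u" by (metis in_set_conv_nth)
    let ?a = "(i, r + 3, t)"
    have "?a \<in> idx" using i r t length_extra[OF b tl] by (simp add: indices_def ps_nth)
    moreover have "el ?a = tree_of (ys @ [v]) ((par G ?xs)(v := u))"
      using e(5) r(2) t(2) by (simp add: elem_def)
    moreover have "v \<in> set (tl (ys @ [v]))" using e(2) by (cases ys) auto
    ultimately show ?thesis by (intro bexI[of _ ?a]) auto
  qed
qed

lemma arc_covered:
  assumes "e \<in> parcs G"
  shows "\<exists>B\<in>subbase. e \<in> parcs B"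
proof -
  obtain x y where e: "e = (x, y)" by (cases e)
  obtain b where "b \<in> set bs" "x \<in> set b" "y \<in> set b" using blocks_arcD[OF blocks] assms e by blast
  then obtain i where i: "i < length bs" "x \<in> set (bs ! i)" "y \<in> set (bs ! i)" by (metis in_set_conv_nth)
  have "x \<noteq> y" using assms e pair_graphD(5)[OF pair_graph] by auto
  then consider "y \<in> back_nbrs G (bs ! i) x" | "x \<in> back_nbrs G (bs ! i) y"
    using before_total[OF i(2,3)] assms e pair_graphD(4)[OF pair_graph] by (auto simp: back_nbrs_def)
  then show ?thesis
    using back_arc_covered[OF i(1) _ i(2)] back_arc_covered[OF i(1) _ i(3)] e
    unfolding subbase_def by cases blast+
qed

section \<open>The generated topology\<close>

definition top_space :: "'a topology" where
  "top_space = topology (arbitrary union_of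
     (finite intersection_of (\<lambda>U. U \<in> pverts ` subbase) relative_to pverts G))"

lemma topspace_top_space [simp]: "topspace top_space = pverts G"
  by (simp add: top_space_def)

text \<open>Basic open sets are preimages under \<open>code\<close> of intersections of code sets.
  So an open set is described by a family of index sets alone, and this description makes sense in
  every graph with the same profiles.\<close>

lemma openin_top_space_iff:
  "openin top_space U \<longleftrightarrow> (\<exists>\<I>. (\<forall>J\<in>\<I>. finite J \<and> J \<subseteq> idx) \<and>
     U = {x \<in> pverts G. \<exists>J\<in>\<I>. \<forall>a\<in>J. code G bs x \<in> code_set a})" (is "?L \<longleftrightarrow> ?R")
proof -
  have open_iff: "openin top_space U \<longleftrightarrow>
      (arbitrary union_of (finite intersection_of (\<lambda>U. U \<in> pverts ` subbase) relative_to pverts G)) U"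
    by (simp add: top_space_def openin_subbase)
  define N where "N J = {x \<in> pverts G. \<forall>a\<in>J. code G bs x \<in> code_set a}" for J
  have N: "pverts G \<inter> \<Inter>((\<lambda>a. pverts (el a)) ` J) = N J" if "J \<subseteq> idx" for J
  proof -
    have "(\<forall>a\<in>J. x \<in> pverts (el a)) \<longleftrightarrow> (\<forall>a\<in>J. code G bs x \<in> code_set a)" if "x \<in> pverts G" for x
      using pverts_el that \<open>J \<subseteq> idx\<close> by (intro ball_cong) auto
    then show ?thesis by (auto simp: N_def)
  qed
  have UN: "{x \<in> pverts G. \<exists>J\<in>\<I>. \<forall>a\<in>J. code G bs x \<in> code_set a} = \<Union>(N ` \<I>)" for \<I>
    by (auto simp: N_def)
  show ?thesis
  proof
    assume ?L
    then obtain \<U> where U: "\<Union>\<U> = U" and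
      basic: "\<And>W. W \<in> \<U> \<Longrightarrow> (finite intersection_of (\<lambda>U. U \<in> pverts ` subbase) relative_to pverts G) W"
      unfolding open_iff union_of_def by auto
    \<comment> \<open>Taking every finite index set whose basic open set fits into \<open>U\<close>
      avoids a choice for each member of \<open>\<U>\<close>.\<close>
    let ?\<I> = "{J. finite J \<and> J \<subseteq> idx \<and> N J \<subseteq> U}"
    have "x \<in> \<Union>(N ` ?\<I>)" if x: "x \<in> U" for x
    proof -
      obtain W where W: "W \<in> \<U>" "x \<in> W" using x U by blast
      obtain F where F: "finite F" "F \<subseteq> pverts ` el ` idx" "pverts G \<inter> \<Inter>F = W"
        using basic[OF W(1)] by (auto simp: relative_to_def intersection_of_def subbase_def)
      obtain J where J: "finite J" "J \<subseteq> idx" "F = (\<lambda>a. pverts (el a)) ` J"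
        using finite_subset_image[OF F(1), of "\<lambda>a. pverts (el a)" idx] F(2) by (auto simp: image_image)
      have "W = N J" using F(3) N[OF J(2)] J(3) by simp
      then have "J \<in> ?\<I>" "x \<in> N J" using J W U by auto
      then show ?thesis by blast
    qed
    then have "U = \<Union>(N ` ?\<I>)" by auto
    then show ?R unfolding UN by (intro exI[of _ ?\<I>] conjI) auto
  next
    assume ?R
    then obtain \<I> where I: "\<And>J. J \<in> \<I> \<Longrightarrow> finite J \<and> J \<subseteq> idx" and U: "U = \<Union>(N ` \<I>)"
      unfolding UN by blast
    have "(finite intersection_of (\<lambda>U. U \<in> pverts ` subbase) relative_to pverts G) (N J)" if "J \<in> \<I>" for J
    proof -
      let ?F = "(\<lambda>a. pverts (el a)) ` J"
      have "finite ?F" "?F \<subseteq> {U. U \<in> pverts ` subbase}" using I[OF that] by (auto simp: subbase_def)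
      then have "(finite intersection_of (\<lambda>U. U \<in> pverts ` subbase)) (\<Inter>?F)"
        unfolding intersection_of_def by blast
      then show ?thesis unfolding relative_to_def using N[of J] I[OF that] by blast
    qed
    then have "N ` \<I> \<subseteq> Collect (finite intersection_of (\<lambda>U. U \<in> pverts ` subbase) relative_to pverts G)"
      by auto
    then have "(arbitrary union_of (finite intersection_of (\<lambda>U. U \<in> pverts ` subbase) relative_to pverts G)) U"
      unfolding union_of_def U by (intro exI[of _ "N ` \<I>"]) (simp add: arbitrary_def)
    then show ?L by (simp only: open_iff)
  qed
qed

lemma topological_graph: "topological_graph G subbase top_space"
  unfolding topological_graph_def
proof (intro conjI ballI impI)
  show "subbase_of subbase top_space"
    unfolding subbase_of_def by (rule ext) (simp add: top_space_def openin_subbase)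
  show "homotopic (nerve subbase) G" by (rule homotopic_nerve)
  show "\<exists>B\<in>subbase. e \<in> parcs B" if "e \<in> parcs G" for e using arc_covered that .
next
  fix A assume "A \<in> subbase"
  then obtain a where a: "a \<in> idx" "A = el a" by (auto simp: subbase_def)
  show "pair_graph A" using a pair_graph_el by simp
  show "contractible A" using a contractible_el by simp
  interpret A: pair_graph A by fact
  interpret G: pair_graph G by (rule pair_graph)
  show "subgraph (with_proj A) (with_proj G)"
    using parcs_el[OF a(1)] pverts_el[OF a(1)] a(2) A.wf_digraph_axioms G.wf_digraph_axioms
    by (auto simp: subgraph_def compatible_def)
next
  fix A B assume "A \<in> subbase" "B \<in> subbase" and dim: "dim_assumption A B"
  then obtain a b where a: "a \<in> idx" "A = el a" and b: "b \<in> idx" "B = el b" by (auto simp: subbase_def)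
  consider "a = b" | "fst a = fst b" "fst (snd a) < 2" "\<not> fst (snd b) < 2"
    | "fst b = fst a" "fst (snd b) < 2" "\<not> fst (snd a) < 2"
    using dim dim_assumption_el[OF a(1) b(1)] a(2) b(2) by auto
  then show "contractible (graph_inter A B)"
  proof cases
    case 1
    then show ?thesis using a b contractible_el graph_inter_same by metis
  next
    case 2
    then show ?thesis using inter_point[OF a(1) b(1)] contractible_el[OF a(1)] a(2) b(2) by simp
  next
    case 3
    then show ?thesis
      using inter_point[OF b(1) a(1)] contractible_el[OF b(1)] a(2) b(2) graph_inter_commute[of A B] by simp
  qed
qed (use pair_graph in auto)

end

section \<open>Transfer between graphs with the same profiles\<close>

definition transport :: "('a pair_pre_digraph \<times> 'a list list) \<Rightarrow> ('b pair_pre_digraph \<times> 'b list list) \<Rightarrow> 'a set \<Rightarrow> 'b set" where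
  "transport = (\<lambda>(G, bs) (H, cs) U. {y \<in> pverts H. code H cs y \<in> code G bs ` U})"

text \<open>By \<open>code_image\<close> both graphs realise the same codes, so the preimage of a
  set \<open>Q\<close> of codes goes to the preimage of \<open>Q\<close> in the other graph, and
  back.\<close>

lemma transport_open:
  assumes "ordered_graph G bs" "ordered_graph H cs" and ps: "ordered_graph.ps G bs = ordered_graph.ps H cs"
  shows "openin (ordered_graph.top_space G bs) U \<Longrightarrow>
      openin (ordered_graph.top_space H cs) (transport (G, bs) (H, cs) U) \<and>
      transport (H, cs) (G, bs) (transport (G, bs) (H, cs) U) = U"
    and "a \<in> indices (ordered_graph.ps G bs) \<Longrightarrow>
      pverts (elem H cs a) = transport (G, bs) (H, cs) (pverts (elem G bs a))"
proof -
  interpret G: ordered_graph G bs by fact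
  interpret H: ordered_graph H cs by fact
  have im: "code G bs ` pverts G = code H cs ` pverts H" using G.code_image H.code_image ps by simp
  have int: "code G bs ` {x \<in> pverts G. code G bs x \<in> Q} = code G bs ` pverts G \<inter> Q"
    "code H cs ` {y \<in> pverts H. code H cs y \<in> Q} = code H cs ` pverts H \<inter> Q" for Q by auto
  have tr: "transport (G, bs) (H, cs) {x \<in> pverts G. code G bs x \<in> Q} = {y \<in> pverts H. code H cs y \<in> Q}" for Q
    unfolding transport_def prod.case int im by auto
  have tr': "transport (H, cs) (G, bs) {y \<in> pverts H. code H cs y \<in> Q} = {x \<in> pverts G. code G bs x \<in> Q}" for Q
    unfolding transport_def prod.case int im[symmetric] by auto
  show "openin H.top_space (transport (G, bs) (H, cs) U) \<and>
      transport (H, cs) (G, bs) (transport (G, bs) (H, cs) U) = U" if "openin G.top_space U"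
  proof -
    from that obtain \<I> where I: "\<forall>J\<in>\<I>. finite J \<and> J \<subseteq> G.idx"
      and U: "U = {x \<in> pverts G. \<exists>J\<in>\<I>. \<forall>a\<in>J. code G bs x \<in> code_set a}"
      unfolding G.openin_top_space_iff by blast
    define Q where "Q = {q. \<exists>J\<in>\<I>. \<forall>a\<in>J. q \<in> code_set a}"
    have U': "U = {x \<in> pverts G. code G bs x \<in> Q}" by (simp add: U Q_def)
    have "openin H.top_space {y \<in> pverts H. code H cs y \<in> Q}"
      unfolding H.openin_top_space_iff using I ps by (intro exI[of _ \<I>]) (simp add: Q_def)
    then show ?thesis by (simp add: U' tr tr')
  qed
  show "pverts (elem H cs a) = transport (G, bs) (H, cs) (pverts (elem G bs a))" if "a \<in> G.idx"
    using G.pverts_el[OF that] H.pverts_el[of a] that ps tr by simp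
qed

text \<open>\<open>f\<close> keeps the index, and both adjacency in the nerve and dimension are
  functions of index and profiles; the dimensions even agree.\<close>

lemma transport_continuous:
  assumes "ordered_graph G bs" "ordered_graph H cs" and ps: "ordered_graph.ps G bs = ordered_graph.ps H cs"
  defines "f \<equiv> \<lambda>A. elem H cs (the_inv_into (indices (ordered_graph.ps G bs)) (elem G bs) A)"
  shows "continuous_graph_map (ordered_graph.subbase G bs) (ordered_graph.top_space G bs)
      (ordered_graph.subbase H cs) (ordered_graph.top_space H cs) (transport (G, bs) (H, cs)) f"
    and "a \<in> indices (ordered_graph.ps G bs) \<Longrightarrow> f (elem G bs a) = elem H cs a"
proof -
  interpret G: ordered_graph G bs by fact
  interpret H: ordered_graph H cs by fact
  note t = transport_open[OF assms(1-3)]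
  show f: "f (elem G bs a) = elem H cs a" if "a \<in> G.idx" for a
    using the_inv_into_f_f[OF G.inj_el that] by (simp add: f_def)
  have arc: "(f A, f B) \<in> parcs (nerve H.subbase)" if AB: "(A, B) \<in> parcs (nerve G.subbase)" for A B
  proof -
    have "A \<in> G.subbase" "B \<in> G.subbase" using AB by (auto simp: nerve_def)
    then obtain a b where "a \<in> G.idx" "A = elem G bs a" "b \<in> G.idx" "B = elem G bs b"
      by (auto simp: G.subbase_def)
    then show ?thesis using AB f ps G.nerve_arc[of a b] H.nerve_arc[of a b] by simp
  qed
  show "continuous_graph_map G.subbase G.top_space H.subbase H.top_space (transport (G, bs) (H, cs)) f"
    unfolding continuous_graph_map_def
  proof (intro conjI ballI allI impI)
    show "openin H.top_space (transport (G, bs) (H, cs) U)" if "openin G.top_space U" for U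
      using t(1)[OF that] by blast
    show "case p of (A, B) \<Rightarrow> (f A, f B) \<in> parcs (nerve H.subbase)" if "p \<in> parcs (nerve G.subbase)" for p
      using arc that by (cases p) simp
  next
    fix A assume "A \<in> G.subbase"
    then obtain a where a: "a \<in> G.idx" "A = elem G bs a" by (auto simp: G.subbase_def)
    then show "f A \<in> H.subbase" using f ps by (simp add: H.subbase_def)
    show "pverts (f A) = transport (G, bs) (H, cs) (pverts A)" using t(2) f a by simp
    show "graph_dim (f A) \<le> graph_dim A" using f a ps G.dim_el[of a] H.dim_el[of a] by simp
  qed
qed

lemma ordered_graphs_homeomorphic:
  assumes G: "ordered_graph G bs" and H: "ordered_graph H cs"
    and ps: "ordered_graph.ps G bs = ordered_graph.ps H cs"
  shows "homeomorphic_topological_graphs (ordered_graph.subbase G bs) (ordered_graph.top_space G bs)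
    (ordered_graph.subbase H cs) (ordered_graph.top_space H cs)"
proof -
  interpret G: ordered_graph G bs by fact
  interpret H: ordered_graph H cs by fact
  let ?f = "\<lambda>A. elem H cs (the_inv_into G.idx (elem G bs) A)"
  let ?g = "\<lambda>A. elem G bs (the_inv_into H.idx (elem H cs) A)"
  note f = transport_continuous[OF G H ps] and g = transport_continuous[OF H G ps[symmetric]]
  have "\<forall>A\<in>G.subbase. ?g (?f A) = A" "\<forall>C\<in>H.subbase. ?f (?g C) = C"
    using f(2) g(2) ps by (auto simp: G.subbase_def H.subbase_def)
  moreover have "\<forall>U. openin G.top_space U \<longrightarrow> transport (H, cs) (G, bs) (transport (G, bs) (H, cs) U) = U"
    "\<forall>U. openin H.top_space U \<longrightarrow> transport (G, bs) (H, cs) (transport (H, cs) (G, bs) U) = U"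
    using transport_open(1)[OF G H ps] transport_open(1)[OF H G ps[symmetric]] by blast+
  ultimately show ?thesis
    unfolding homeomorphic_topological_graphs_def using f(1) g(1) by blast
qed

theorem theorem7:
  fixes G :: "'a pair_pre_digraph" and H :: "'b pair_pre_digraph"
  assumes "pair_graph G" and "pair_graph H"
    and "K3_free G" and "K3_free H"
    and "one_homeomorphic G H"
  shows "\<exists>\<B> T \<C> P. topological_graph G \<B> T \<and> topological_graph H \<C> P \<and>
           homeomorphic_topological_graphs \<B> T \<C> P"
proof -
  obtain G' H' :: "nat pair_pre_digraph" where
    isos: "digraph_iso (with_proj G) (with_proj G')" "digraph_iso (with_proj H) (with_proj H')"
    and equiv: "equivclp subdivision_of G' H'"
    using assms(5) unfolding one_homeomorphic_def by blast
  obtain f g where G': "pair_graph G'" "graph_iso f G G'" and H': "pair_graph H'" "graph_iso g H H'"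
    using digraph_isoD[OF isos(1) assms(1)] digraph_isoD[OF isos(2) assms(2)] by blast
  obtain bs' cs' where bc: "blocks G' bs'" "blocks H' cs'"
      "map (\<lambda>b. profile (degs G' b)) bs' = map (\<lambda>b. profile (degs H' b)) cs'"
    using common_profile[OF equiv G'(1)] by blast
  have subG: "parcs G \<subseteq> pverts G \<times> pverts G" and subH: "parcs H \<subseteq> pverts H \<times> pverts H"
    using assms(1,2) by (auto simp: pair_graph_iff)
  \<comment> \<open>The common profile was found on the copies with natural numbers as vertices; the
    orders are pulled back along the inverse isomorphisms.\<close>
  note bG = blocks_iso[OF graph_iso_inverse[OF G'(2)] subG bc(1)]
  note bH = blocks_iso[OF graph_iso_inverse[OF H'(2)] subH bc(2)]
  let ?bs = "map (map (the_inv_into (pverts G) f)) bs'"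
  let ?cs = "map (map (the_inv_into (pverts H) g)) cs'"
  have oG: "ordered_graph G ?bs" and oH: "ordered_graph H ?cs"
    using assms bG(1) bH(1) K3_free_triangle_free by (simp_all add: ordered_graph_def)
  have "ordered_graph.ps G ?bs = ordered_graph.ps H ?cs"
    unfolding ordered_graph.ps_def[OF oG] ordered_graph.ps_def[OF oH] using bG(2) bH(2) bc(3) by simp
  then have "homeomorphic_topological_graphs (ordered_graph.subbase G ?bs) (ordered_graph.top_space G ?bs)
      (ordered_graph.subbase H ?cs) (ordered_graph.top_space H ?cs)"
    by (rule ordered_graphs_homeomorphic[OF oG oH])
  then show ?thesis
    using ordered_graph.topological_graph[OF oG] ordered_graph.topological_graph[OF oH] by blast
qed

end
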